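(* Let $X=\{\mathbf{z}^TA\mathbf{z}=0\}\subseteq\mathbb{P}^2$ be a projective conic and $A$ be its representative complex symmetric $3\times3$ matrix. If $A$ is singular then (i) $\mathrm{vHDdeg}(X)=1$ and $\mathrm{HDdeg}(X)=\{1\}$ if $\mathrm{rk}(A)=1$; (ii) $\mathrm{vHDdeg}(X)=2$ and $\mathrm{HDdeg}(X)=\{2\}$ if $\mathrm{rk}(A)=2$. If $A$ is non singular then (i) $\mathrm{vHDdeg}(X)=2$ and $\mathrm{HDdeg}(X)=\{2\}$ if $A$ has only one singular value; (ii) $\mathrm{vHDdeg}(X)=6$ if $A$ has two different singular values; (iii) $\mathrm{vHDdeg}(X)=8$ if $A$ has three different singular values.
   Context: For a projective variety in $\mathbb{P}^2$, $\mathrm{vHDdeg}$ and $\mathrm{HDdeg}$ are by definition those of its affine cone in $\mathbb{V}=\mathbb{C}^3$ (as a reduced variety). For an irreducible affine variety $X=V(I_X)\subseteq\mathbb{V}=\mathbb{C}^n$ of codimension $c$ with prime ideal $I_X=\langle f_1,\dots,f_s\rangle\subseteq\mathbb{C}[\mathbf{z}]$ and Jacobian $J(f)$, put $I_{X_{\mathrm{sing}}}=I_X+\langle c\text{-minors of }J(f)\rangle$. Let $\ast$ be the antilinear ring involution of $\mathbb{C}[\mathbf{z},\mathbf{w},\mathbf{u},\mathbf{v}]$ with $z_k\leftrightarrow w_k$, $u_k\leftrightarrow v_k$ and $a^\ast=\bar a$ for $a\in\mathbb{C}$. With $I_X'=\left\langle (c+1)\text{-minors of }\begin{bmatrix}\mathbf{v}-\mathbf{w}\\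 J_{\mathbf{z}}(f)\end{bmatrix}\right\rangle$, the Hermitian critical ideal of $X$ is $$\left(I_X+(I_X)^\ast+I_X'+(I_X')^\ast\right):\left(I_{X_{\mathrm{sing}}}\cdot(I_{X_{\mathrm{sing}}})^\ast\right)^\infty ;$$ for fixed $(\mathbf{u},\mathbf{v})\in\mathbb{V}^2$ it is considered as an ideal of $\mathbb{C}[\mathbf{z},\mathbf{w}]$. $\mathrm{vHDdeg}(X)$ is the number of zeros in $\mathbb{V}^2$ of the Hermitian critical ideal of $(\mathbf{u},\mathbf{v})$, constant for $(\mathbf{u},\mathbf{v})$ in a Zariski-open dense subset of $\mathbb{V}^2$. Let $q_{\mathbf{u}}(\mathbf{z})=\sum_k|u_k-z_k|^2$; its critical points on $X$ are the regular points $\mathbf{z}\in X$ with $\sum_k(\bar u_k-\bar z_k)\nu_k=0$ for all $\nu\in T_{\mathbf{z}}X$ (equivalently, for generic $\mathbf{u}$, the zeros of the form $(\mathbf{z},\bar{\mathbf{z}})$ of the Hermitian critical ideal of $(\mathbf{u},\bar{\mathbf{u}})$). $\mathrm{HDdeg}(X)\subseteq\mathbb{N}$ is the set of numbers $m$ such that $q_{\mathbf{u}}$ has exactly $m$ critical points on $X$ for all $\mathbf{u}$ in some nonempty Euclidean-open subset of $\mathbb{V}$. For a reducible variety the counts of solutions are defined additively, by summing over the irreducible components. *)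

theory Defs
  imports "HOL-Analysis.Analysis" "HOL-Library.Poly_Mapping"
begin

section \<open>Complex polynomials in several variables\<close>

text \<open>Polynomials are the monoid algebra of finitely supported exponent vectors, so the
  commutative ring structure is the one of \<^theory>\<open>HOL-Library.Poly_Mapping\<close>.\<close>

type_synonym 'x mpoly = "('x \<Rightarrow>\<^sub>0 nat) \<Rightarrow>\<^sub>0 complex"

definition Const :: "complex \<Rightarrow> 'x mpoly" where
  "Const a = Poly_Mapping.single 0 a"

definition Var :: "'x \<Rightarrow> 'x mpoly" where
  "Var x = Poly_Mapping.single (Poly_Mapping.single x 1) 1"

text \<open>The ring homomorphism that is \<open>h\<close> on coefficients (for a ring homomorphism \<open>h\<close>) and sends
  the variable \<open>x\<close> to \<open>s x\<close>.\<close>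

definition mpoly_hom :: "(complex \<Rightarrow> 'b) \<Rightarrow> ('x \<Rightarrow> 'b) \<Rightarrow> 'x mpoly \<Rightarrow> 'b::comm_ring_1" where
  "mpoly_hom h s p = (\<Sum>m\<in>Poly_Mapping.keys p. h (Poly_Mapping.lookup p m) *
     (\<Prod>x\<in>Poly_Mapping.keys m. s x ^ Poly_Mapping.lookup m x))"

definition peval :: "complex ^ 'x \<Rightarrow> 'x mpoly \<Rightarrow> complex" where
  "peval z = mpoly_hom (\<lambda>a. a) (\<lambda>x. z $ x)"

definition pderiv_mpoly :: "'x \<Rightarrow> 'x mpoly \<Rightarrow> 'x mpoly" where
  "pderiv_mpoly x p = (\<Sum>m\<in>Poly_Mapping.keys p.
     Poly_Mapping.single (m - Poly_Mapping.single x 1)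
       (of_nat (Poly_Mapping.lookup m x) * Poly_Mapping.lookup p m))"

section \<open>Ideals\<close>

text \<open>A commutative ring is a module over itself, whose submodules are its ideals:
  \<open>ideal.span S\<close> is the ideal generated by \<open>S\<close>.\<close>

interpretation ideal: module "(*) :: 'a::comm_ring_1 \<Rightarrow> 'a \<Rightarrow> 'a"
  by standard (simp_all add: algebra_simps)

definition ideal_prod :: "'a::comm_ring_1 set \<Rightarrow> 'a set \<Rightarrow> 'a set" where
  "ideal_prod I J = ideal.span {a * b | a b. a \<in> I \<and> b \<in> J}"

fun ideal_pow :: "'a::comm_ring_1 set \<Rightarrow> nat \<Rightarrow> 'a set" where
  "ideal_pow J 0 = UNIV"
| "ideal_pow J (Suc N) = ideal_prod J (ideal_pow J N)"

definition ideal_quotient :: "'a::comm_ring_1 set \<Rightarrow> 'a set \<Rightarrow> 'a set" where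
  "ideal_quotient I J = {g. \<forall>h\<in>J. g * h \<in> I}"

definition saturation :: "'a::comm_ring_1 set \<Rightarrow> 'a set \<Rightarrow> 'a set" where
  "saturation I J = (\<Union>N. ideal_quotient I (ideal_pow J N))"

section \<open>Affine varieties\<close>

definition zeros :: "'x mpoly set \<Rightarrow> (complex ^ 'x) set" where
  "zeros S = {z. \<forall>f\<in>S. peval z f = 0}"

definition vanishing_ideal :: "(complex ^ 'x) set \<Rightarrow> 'x mpoly set" where
  "vanishing_ideal X = {f. \<forall>z\<in>X. peval z f = 0}"

definition zariski_closed :: "(complex ^ 'x) set \<Rightarrow> bool" where
  "zariski_closed X \<longleftrightarrow> (\<exists>S. X = zeros S)"

definition zariski_open :: "(complex ^ 'x) set \<Rightarrow> bool" where
  "zariski_open U \<longleftrightarrow> zariski_closed (- U)"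

definition zariski_dense :: "(complex ^ 'x) set \<Rightarrow> bool" where
  "zariski_dense U \<longleftrightarrow> (\<forall>C. zariski_closed C \<and> U \<subseteq> C \<longrightarrow> C = UNIV)"

definition irreducible_variety :: "(complex ^ 'x) set \<Rightarrow> bool" where
  "irreducible_variety X \<longleftrightarrow> zariski_closed X \<and> X \<noteq> {} \<and>
     (\<forall>C D. zariski_closed C \<and> zariski_closed D \<and> X = C \<union> D \<longrightarrow> X = C \<or> X = D)"

definition irreducible_components :: "(complex ^ 'x) set \<Rightarrow> (complex ^ 'x) set set" where
  "irreducible_components X = {Y. irreducible_variety Y \<and> Y \<subseteq> X \<and>
     (\<forall>Z. irreducible_variety Z \<and> Y \<subseteq> Z \<and> Z \<subseteq> X \<longrightarrow> Z = Y)}"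

text \<open>Codimension in the ambient affine space: the greatest length of a chain
  \<open>X = Z\<^sub>0 \<subset> \<dots> \<subset> Z\<^sub>c\<close> of irreducible closed subsets.\<close>

definition codim :: "(complex ^ 'x) set \<Rightarrow> nat" where
  "codim X = (GREATEST c. \<exists>Z :: nat \<Rightarrow> (complex ^ 'x) set. Z 0 = X \<and>
     (\<forall>i\<le>c. irreducible_variety (Z i)) \<and> (\<forall>i<c. Z i \<subset> Z (Suc i)))"

text \<open>Matrices with a varying number of rows are lists of rows. The injections \<open>r\<close> and \<open>c\<close> choose
  rows and columns; their order changes a minor only by a sign.\<close>

definition minors :: "nat \<Rightarrow> ('a::comm_ring_1 ^ 'n) list \<Rightarrow> 'a set" where
  "minors k M = {(\<Sum>p | p permutes {..<k}. of_int (sign p) * (\<Prod>i<k. M ! r i $ c (p i))) | r c.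
     inj_on r {..<k} \<and> r ` {..<k} \<subseteq> {..<length M} \<and> inj_on c {..<k}}"

definition generators :: "(complex ^ 'n) set \<Rightarrow> 'n mpoly list" where
  "generators X = (SOME fs. ideal.span (set fs) = vanishing_ideal X)"

definition jacobian :: "'n mpoly list \<Rightarrow> ('n mpoly ^ 'n) list" where
  "jacobian fs = map (\<lambda>f. \<chi> k. pderiv_mpoly k f) fs"

definition sing_ideal :: "(complex ^ 'n) set \<Rightarrow> 'n mpoly set" where
  "sing_ideal X = ideal.span (vanishing_ideal X \<union> minors (codim X) (jacobian (generators X)))"

definition regular_points :: "(complex ^ 'n) set \<Rightarrow> (complex ^ 'n) set" where
  "regular_points X = X - zeros (sing_ideal X)"

definition tangent_space :: "(complex ^ 'n) set \<Rightarrow> complex ^ 'n \<Rightarrow> (complex ^ 'n) set" where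
  "tangent_space X z =
     {\<nu>. \<forall>f\<in>vanishing_ideal X. (\<Sum>k\<in>UNIV. peval z (pderiv_mpoly k f) * \<nu> $ k) = 0}"

section \<open>The Hermitian critical ideal\<close>

text \<open>The variables of \<open>\<complex>[z,w,u,v]\<close>. The ring \<open>\<complex>[z,w]\<close> has the variables \<^typ>\<open>'n + 'n\<close>, with
  \<open>Inl k\<close> for \<open>z\<^sub>k\<close> and \<open>Inr k\<close> for \<open>w\<^sub>k\<close>, so that \<open>V\<^sup>2\<close> is \<^typ>\<open>complex ^ ('n + 'n)\<close>.\<close>

datatype 'n hvar = Zv 'n | Wv 'n | Uv 'n | Vv 'n

fun swap_hvar :: "'n hvar \<Rightarrow> 'n hvar" where
  "swap_hvar (Zv k) = Wv k"
| "swap_hvar (Wv k) = Zv k"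
| "swap_hvar (Uv k) = Vv k"
| "swap_hvar (Vv k) = Uv k"

definition star :: "'n hvar mpoly \<Rightarrow> 'n hvar mpoly" where
  "star = mpoly_hom (\<lambda>a. Const (cnj a)) (\<lambda>x. Var (swap_hvar x))"

definition in_z :: "'n mpoly \<Rightarrow> 'n hvar mpoly" where
  "in_z = mpoly_hom Const (\<lambda>k. Var (Zv k))"

text \<open>The ideal of \<open>\<complex>[z,w,u,v]\<close> generated by an ideal of \<open>\<complex>[z]\<close>.\<close>

definition extend_z :: "'n mpoly set \<Rightarrow> 'n hvar mpoly set" where
  "extend_z I = ideal.span (in_z ` I)"

definition hcrit_minor_ideal :: "(complex ^ 'n) set \<Rightarrow> 'n hvar mpoly set" where
  "hcrit_minor_ideal X = ideal.span (minors (codim X + 1)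
     ((\<chi> k. Var (Vv k) - Var (Wv k)) #
      map (\<lambda>row. \<chi> k. in_z (row $ k)) (jacobian (generators X))))"

definition hcrit_sum_ideal :: "(complex ^ 'n) set \<Rightarrow> 'n hvar mpoly set" where
  "hcrit_sum_ideal X = ideal.span
     (extend_z (vanishing_ideal X) \<union> star ` extend_z (vanishing_ideal X) \<union>
      hcrit_minor_ideal X \<union> star ` hcrit_minor_ideal X)"

definition hcrit_sing_ideal :: "(complex ^ 'n) set \<Rightarrow> 'n hvar mpoly set" where
  "hcrit_sing_ideal X =
     ideal_prod (extend_z (sing_ideal X)) (star ` extend_z (sing_ideal X))"

definition specialize ::
    "complex ^ 'n \<Rightarrow> complex ^ 'n \<Rightarrow> 'n hvar mpoly \<Rightarrow> ('n + 'n) mpoly" where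
  "specialize u v = mpoly_hom Const
     (\<lambda>x. case x of Zv k \<Rightarrow> Var (Inl k) | Wv k \<Rightarrow> Var (Inr k)
                   | Uv k \<Rightarrow> Const (u $ k) | Vv k \<Rightarrow> Const (v $ k))"

text \<open>The Hermitian critical ideal of fixed data \<open>(u,v)\<close>, for irreducible \<open>X\<close>. The star exchanges
  \<open>u\<close> and \<open>v\<close> as variables, so it is applied before they are specialized; the saturation is taken
  in \<open>\<complex>[z,w]\<close>. Since \<^term>\<open>specialize u v\<close> is surjective, the images are ideals.\<close>

definition hermitian_critical_ideal ::
    "(complex ^ 'n) set \<Rightarrow> complex ^ 'n \<Rightarrow> complex ^ 'n \<Rightarrow> ('n + 'n) mpoly set" where
  "hermitian_critical_ideal X u v =
     saturation (specialize u v ` hcrit_sum_ideal X) (specialize u v ` hcrit_sing_ideal X)"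

section \<open>Hermitian distance degrees\<close>

definition pair :: "complex ^ 'n \<Rightarrow> complex ^ 'n \<Rightarrow> complex ^ ('n + 'n)" where
  "pair u v = (\<chi> x. case x of Inl k \<Rightarrow> u $ k | Inr k \<Rightarrow> v $ k)"

text \<open>Both counts are sums over the irreducible components of \<open>X\<close>.\<close>

definition vHD_count ::
    "(complex ^ 'n) set \<Rightarrow> complex ^ 'n \<Rightarrow> complex ^ 'n \<Rightarrow> nat \<Rightarrow> bool" where
  "vHD_count X u v N \<longleftrightarrow>
     (\<forall>Y\<in>irreducible_components X. finite (zeros (hermitian_critical_ideal Y u v))) \<and>
     (\<Sum>Y\<in>irreducible_components X. card (zeros (hermitian_critical_ideal Y u v))) = N"

definition vHDdeg :: "(complex ^ 'n) set \<Rightarrow> nat" where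
  "vHDdeg X = (THE N. \<exists>U. zariski_open U \<and> zariski_dense U \<and>
     (\<forall>u v. pair u v \<in> U \<longrightarrow> vHD_count X u v N))"

text \<open>The critical points on irreducible \<open>Y\<close> of \<open>q\<^sub>u(z) = \<Sum>\<^sub>k \<bar>u\<^sub>k - z\<^sub>k\<bar>\<^sup>2\<close>.\<close>

definition critical_points :: "(complex ^ 'n) set \<Rightarrow> complex ^ 'n \<Rightarrow> (complex ^ 'n) set" where
  "critical_points Y u = {z \<in> regular_points Y. \<forall>\<nu>\<in>tangent_space Y z.
     (\<Sum>k\<in>UNIV. (cnj (u $ k) - cnj (z $ k)) * \<nu> $ k) = 0}"

definition HD_count :: "(complex ^ 'n) set \<Rightarrow> complex ^ 'n \<Rightarrow> nat \<Rightarrow> bool" where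
  "HD_count X u m \<longleftrightarrow>
     (\<forall>Y\<in>irreducible_components X. finite (critical_points Y u)) \<and>
     (\<Sum>Y\<in>irreducible_components X. card (critical_points Y u)) = m"

definition HDdeg :: "(complex ^ 'n) set \<Rightarrow> nat set" where
  "HDdeg X = {m. \<exists>U. open U \<and> U \<noteq> {} \<and> (\<forall>u\<in>U. HD_count X u m)}"

section \<open>Projective conics\<close>

text \<open>Points of projective space are lines through the origin.\<close>

definition proj_point :: "complex ^ 'n \<Rightarrow> (complex ^ 'n) set" where
  "proj_point p = range (\<lambda>c. c *s p)"

definition proj_quadric :: "complex ^ 'n ^ 'n \<Rightarrow> (complex ^ 'n) set set" where
  "proj_quadric A = {proj_point p | p. p \<noteq> 0 \<and> (\<Sum>i\<in>UNIV. p $ i * (A *v p) $ i) = 0}"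

definition affine_cone :: "(complex ^ 'n) set set \<Rightarrow> (complex ^ 'n) set" where
  "affine_cone X = insert 0 (\<Union>X)"

definition proj_vHDdeg :: "(complex ^ 'n) set set \<Rightarrow> nat" where
  "proj_vHDdeg X = vHDdeg (affine_cone X)"

definition proj_HDdeg :: "(complex ^ 'n) set set \<Rightarrow> nat set" where
  "proj_HDdeg X = HDdeg (affine_cone X)"

definition conj_transpose :: "complex ^ 'n ^ 'm \<Rightarrow> complex ^ 'm ^ 'n" where
  "conj_transpose A = map_matrix cnj (transpose A)"

text \<open>The set of singular values, without multiplicities.\<close>

definition singular_values :: "complex ^ 'n ^ 'm \<Rightarrow> real set" where
  "singular_values A = {\<sigma>. \<sigma> \<ge> 0 \<and>
     (\<exists>x. x \<noteq> 0 \<and> (conj_transpose A ** A) *v x = complex_of_real (\<sigma>\<^sup>2) *s x)}"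

end

theory Submission
  imports Defs "HOL-Computational_Algebra.Fundamental_Theorem_Algebra"
begin

text \<open>By Takagi's factorization a unitary change of coordinates makes \<open>A\<close> diagonal with the singular
  values \<open>\<sigma>\<^sub>k\<close> on the diagonal. If \<open>A\<close> is singular, the cone is a plane or the union of two planes, and
  each plane has exactly one critical point, the projection of the data.

  If \<open>A\<close> is nonsingular, the cone is an irreducible hypersurface, and for generic data the zeros of
  the Hermitian critical ideal are the pairs of nonzero vectors with \<open>u = z + \<nu> D w\<close>,
  \<open>v = w + \<mu> D z\<close>, \<open>z\<^sup>T D z = 0\<close> and \<open>w\<^sup>T D w = 0\<close>. For \<open>D\<close> a multiple of the identity these
  equations are solved by two quadratic equations for \<open>\<mu>\<close> and \<open>\<nu>\<close>. Otherwise \<open>u\<close>, \<open>z\<close>, \<open>D w\<close> are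
  dependent, which determines \<open>\<mu>\<close>, and thus \<open>w\<close>, from the point \<open>z\<close> of the conic; the condition
  \<open>w\<^sup>T D w = 0\<close> then cuts out a quartic on the conic, hence eight points. When two singular
  values agree, this quartic splits off a line, which cuts the conic in two spurious points, and a
  cubic with six points remains. That the points are distinct for generic data is checked on one
  special choice of data, where the eliminant becomes a pencil of polynomials in one variable.\<close>

text \<open>As a simplification rule, this fact would reassociate products and loop with
  \<open>mult_ac\<close>.\<close>

declare ideal.scale_scale [simp del]

section \<open>Homomorphisms of polynomial rings\<close>

text \<open>The degree \<open>vHDdeg\<close> is a count valid on a Zariski-open set, so a condition
  on the data is proved by one polynomial in (u, v) and one datum where it is nonzero; finitely many
  conditions can then be imposed together. For the eliminant this means that only an upper bound on
  its degree is needed for all data. That the bound is attained by simple roots is the nonvanishing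
  of a determinant in its coefficients, for which one datum with the full number of distinct roots
  suffices. The obstacle is that roots and critical pairs need not correspond. At a root where
  \<open>alpha\<close> vanishes and \<open>beta\<close> does not there is no multiplier \<mu>, and
  if z and D w are parallel then \<nu> is not determined. Common zeros of \<open>alpha\<close> and
  \<open>beta\<close> are multiple roots, hence excluded; the remaining dangers sit at finitely many
  points of the conic that depend on D alone, and \<open>u\<close> or \<open>v\<close> is chosen to
  avoid them. Conjugation is not polynomial, so \<open>v\<close> and \<open>w\<close> stay
  independent unknowns. Only \<open>HDdeg\<close> returns to v = conj u; for one singular value the
  discriminant is then a nonnegative real number, and both pairs have the form (z, conj z).\<close>

definition ring_hom :: "('a::comm_ring_1 \<Rightarrow> 'b::comm_ring_1) \<Rightarrow> bool" where
  "ring_hom h \<longleftrightarrow> h 1 = 1 \<and> (\<forall>a b. h (a + b) = h a + h b) \<and> (\<forall>a b. h (a * b) = h a * h b)"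

lemma
  assumes "ring_hom h"
  shows ring_hom_0: "h 0 = 0" and ring_hom_1: "h 1 = 1"
    and ring_hom_add: "h (a + b) = h a + h b"
    and ring_hom_mult: "h (a * b) = h a * h b"
    and ring_hom_uminus: "h (- a) = - h a"
    and ring_hom_diff: "h (a - b) = h a - h b"
    and ring_hom_sum: "h (\<Sum>x\<in>S. g x) = (\<Sum>x\<in>S. h (g x))"
    and ring_hom_power: "h (a ^ n) = h a ^ n"
proof -
  show 1: "h 1 = 1" and add: "h (a + b) = h a + h b" and mul: "h (a * b) = h a * h b" for a b
    using assms by (auto simp: ring_hom_def)
  show z: "h 0 = 0" using add[of 0 0] by simp
  show um: "h (- a) = - h a" for a using add[of a "- a"] z by (simp add: eq_neg_iff_add_eq_0 add.commute)
  show "h (a - b) = h a - h b" using add[of a "- b"] um by simp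
  show "h (\<Sum>x\<in>S. g x) = (\<Sum>x\<in>S. h (g x))"
    by (induction S rule: infinite_finite_induct) (auto simp: z add)
  show "h (a ^ n) = h a ^ n" by (induction n) (auto simp: 1 mul)
qed

lemmas ring_hom_simps = ring_hom_0 ring_hom_1 ring_hom_add ring_hom_mult ring_hom_uminus
  ring_hom_diff ring_hom_sum ring_hom_power

lemma ring_hom_id: "ring_hom (\<lambda>a. a)"
  by (simp add: ring_hom_def)

lemma ring_hom_comp: "ring_hom g \<Longrightarrow> ring_hom h \<Longrightarrow> ring_hom (\<lambda>a. g (h a))"
  by (simp add: ring_hom_def)

lemma ring_hom_Const: "ring_hom Const"
  by (simp add: ring_hom_def Const_def single_add mult_single)

lemma ring_hom_Const_cnj: "ring_hom (\<lambda>a. Const (cnj a))"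
  by (simp add: ring_hom_def Const_def single_add mult_single)

lemma ring_hom_pCons: "ring_hom (\<lambda>a::'a::comm_ring_1. [:a:])"
  by (simp add: ring_hom_def one_pCons)

definition monom_value :: "('x \<Rightarrow> 'b::comm_ring_1) \<Rightarrow> ('x \<Rightarrow>\<^sub>0 nat) \<Rightarrow> 'b" where
  "monom_value s m = (\<Prod>x\<in>Poly_Mapping.keys m. s x ^ Poly_Mapping.lookup m x)"

lemma monom_value_superset:
  assumes "finite S" "Poly_Mapping.keys m \<subseteq> S"
  shows "monom_value s m = (\<Prod>x\<in>S. s x ^ Poly_Mapping.lookup m x)"
  unfolding monom_value_def using assms
  by (intro prod.mono_neutral_left) (auto simp: in_keys_iff)

lemma monom_value_0 [simp]: "monom_value s 0 = 1"
  by (simp add: monom_value_def)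

lemma monom_value_add: "monom_value s (m + n) = monom_value s m * monom_value s n"
proof -
  let ?S = "Poly_Mapping.keys m \<union> Poly_Mapping.keys n"
  have "monom_value s (m + n) = (\<Prod>x\<in>?S. s x ^ Poly_Mapping.lookup (m + n) x)"
    by (intro monom_value_superset) (auto simp: keys_add)
  moreover have "monom_value s m = (\<Prod>x\<in>?S. s x ^ Poly_Mapping.lookup m x)"
    by (intro monom_value_superset) auto
  moreover have "monom_value s n = (\<Prod>x\<in>?S. s x ^ Poly_Mapping.lookup n x)"
    by (intro monom_value_superset) auto
  ultimately show ?thesis by (simp add: lookup_add power_add prod.distrib)
qed

lemma monom_value_single [simp]: "monom_value s (Poly_Mapping.single x n) = s x ^ n"
  by (subst monom_value_superset[of "{x}"]) (auto simp: lookup_single)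

lemma sum_single_lookup: "p = (\<Sum>m\<in>Poly_Mapping.keys p. Poly_Mapping.single m (Poly_Mapping.lookup p m))"
proof (rule poly_mapping_eqI)
  fix k
  show "Poly_Mapping.lookup p k =
      Poly_Mapping.lookup (\<Sum>m\<in>Poly_Mapping.keys p. Poly_Mapping.single m (Poly_Mapping.lookup p m)) k"
    by (simp add: lookup_sum lookup_single when_def in_keys_iff)
qed

lemma poly_mapping_single_induct [case_names single add]:
  assumes "\<And>m a. P (Poly_Mapping.single m a)" and "\<And>p q. P p \<Longrightarrow> P q \<Longrightarrow> P (p + q)"
  shows "P (p :: 'a \<Rightarrow>\<^sub>0 'b::comm_monoid_add)"
proof -
  have "P (\<Sum>m\<in>S. Poly_Mapping.single m (Poly_Mapping.lookup p m))" if "finite S" for S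
    using that
  proof induction
    case empty
    show ?case using assms(1)[of undefined 0] by simp
  qed (auto intro: assms)
  then show ?thesis by (subst sum_single_lookup) simp
qed

context
  fixes h :: "complex \<Rightarrow> 'b::comm_ring_1"
  assumes h: "ring_hom h"
begin

text \<open>Cancellation can make the support of \<open>p + q\<close> smaller than the union of the
  supports, so additivity is read off over a common finite index set.\<close>

lemma mpoly_hom_superset:
  assumes "finite S" "Poly_Mapping.keys p \<subseteq> S"
  shows "mpoly_hom h s p = (\<Sum>m\<in>S. h (Poly_Mapping.lookup p m) * monom_value s m)"
  unfolding mpoly_hom_def monom_value_def using assms
  by (intro sum.mono_neutral_left) (auto simp: in_keys_iff ring_hom_0[OF h])

lemma mpoly_hom_add: "mpoly_hom h s (p + q) = mpoly_hom h s p + mpoly_hom h s q"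
proof -
  let ?S = "Poly_Mapping.keys p \<union> Poly_Mapping.keys q"
  have "mpoly_hom h s (p + q) = (\<Sum>m\<in>?S. h (Poly_Mapping.lookup (p + q) m) * monom_value s m)"
    by (intro mpoly_hom_superset) (auto simp: keys_add)
  moreover have "mpoly_hom h s p = (\<Sum>m\<in>?S. h (Poly_Mapping.lookup p m) * monom_value s m)"
    by (intro mpoly_hom_superset) auto
  moreover have "mpoly_hom h s q = (\<Sum>m\<in>?S. h (Poly_Mapping.lookup q m) * monom_value s m)"
    by (intro mpoly_hom_superset) auto
  ultimately show ?thesis by (simp add: lookup_add ring_hom_add[OF h] sum.distrib distrib_right)
qed

lemma mpoly_hom_single: "mpoly_hom h s (Poly_Mapping.single m a) = h a * monom_value s m"
  by (subst mpoly_hom_superset[of "{m}"]) auto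

lemma mpoly_hom_mult: "mpoly_hom h s (p * q) = mpoly_hom h s p * mpoly_hom h s q"
proof (induction p rule: poly_mapping_single_induct)
  case (single m a)
  show ?case
  proof (induction q rule: poly_mapping_single_induct)
    case (single n b)
    show ?case
      by (simp only: mult_single mpoly_hom_single monom_value_add ring_hom_mult[OF h] mult_ac)
  qed (simp add: distrib_left mpoly_hom_add)
qed (simp add: distrib_right mpoly_hom_add)

lemma mpoly_hom_Const [simp]: "mpoly_hom h s (Const a) = h a"
  by (simp add: Const_def mpoly_hom_single)

lemma mpoly_hom_Var [simp]: "mpoly_hom h s (Var x) = s x"
  by (simp add: Var_def mpoly_hom_single ring_hom_1[OF h])

lemma ring_hom_mpoly_hom: "ring_hom (mpoly_hom h s)"
  using mpoly_hom_single[of s 0 1]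
  by (simp add: ring_hom_def mpoly_hom_add mpoly_hom_mult ring_hom_1[OF h])

end

text \<open>Every monomial is a product of powers of variables, so constants and variables generate
  the ring. Identities between evaluations are later checked on these generators only.\<close>

lemma mpoly_induct [case_names Const Var add mult]:
  assumes "\<And>a. P (Const a)" "\<And>x. P (Var x)"
    and "\<And>p q. P p \<Longrightarrow> P q \<Longrightarrow> P (p + q)" "\<And>p q. P p \<Longrightarrow> P q \<Longrightarrow> P (p * q)"
  shows "P (p :: 'x mpoly)"
proof (induction p rule: poly_mapping_single_induct)
  case (single m a)
  have pow: "P (Var x ^ n)" for x n
    by (induction n) (use assms(1)[of 1] in \<open>auto simp: Const_def intro: assms(2,4)\<close>)
  have vm: "Var x ^ n = Poly_Mapping.single (Poly_Mapping.single x n) 1" for x :: 'x and n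
    by (induction n) (auto simp: Var_def mult_single simp flip: single_add)
  have "P (Poly_Mapping.single (\<Sum>x\<in>S. Poly_Mapping.single x (Poly_Mapping.lookup m x)) a)"
    if "finite S" for S
    using that
  proof induction
    case empty
    show ?case using assms(1)[of a] by (simp add: Const_def)
  next
    case (insert x S)
    have "P (Var x ^ Poly_Mapping.lookup m x *
        Poly_Mapping.single (\<Sum>x\<in>S. Poly_Mapping.single x (Poly_Mapping.lookup m x)) a)"
      by (intro assms(4) pow insert.IH)
    then show ?case using insert.hyps by (simp add: vm mult_single)
  qed
  from this[of "Poly_Mapping.keys m"] show ?case by (simp flip: sum_single_lookup)
qed (rule assms(3))

lemma ring_hom_peval: "ring_hom (peval z)"
  unfolding peval_def by (intro ring_hom_mpoly_hom ring_hom_id)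

lemma peval_Const [simp]: "peval z (Const a) = a"
  and peval_Var [simp]: "peval z (Var x) = z $ x"
  unfolding peval_def by (simp_all add: ring_hom_id)

lemmas peval_simps [simp] = ring_hom_simps[OF ring_hom_peval]

section \<open>Partial derivatives\<close>

lemma pderiv_mpoly_superset:
  assumes "finite S" "Poly_Mapping.keys p \<subseteq> S"
  shows "pderiv_mpoly x p = (\<Sum>m\<in>S. Poly_Mapping.single (m - Poly_Mapping.single x 1)
       (of_nat (Poly_Mapping.lookup m x) * Poly_Mapping.lookup p m))"
  unfolding pderiv_mpoly_def using assms
  by (intro sum.mono_neutral_left) (auto simp: in_keys_iff)

lemma pderiv_mpoly_add: "pderiv_mpoly x (p + q) = pderiv_mpoly x p + pderiv_mpoly x q"
proof -
  let ?S = "Poly_Mapping.keys p \<union> Poly_Mapping.keys q"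
  have "pderiv_mpoly x r = (\<Sum>m\<in>?S. Poly_Mapping.single (m - Poly_Mapping.single x 1)
       (of_nat (Poly_Mapping.lookup m x) * Poly_Mapping.lookup r m))" if "r \<in> {p, q, p + q}" for r
    using that by (intro pderiv_mpoly_superset) (use keys_add[of p q] in auto)
  then show ?thesis by (simp add: lookup_add distrib_left single_add sum.distrib)
qed

lemma pderiv_mpoly_single: "pderiv_mpoly x (Poly_Mapping.single m a) =
    Poly_Mapping.single (m - Poly_Mapping.single x 1) (of_nat (Poly_Mapping.lookup m x) * a)"
  by (subst pderiv_mpoly_superset[of "{m}"]) auto

lemma pderiv_mpoly_mult:
  "pderiv_mpoly x (p * q) = p * pderiv_mpoly x q + q * pderiv_mpoly x p"
proof (induction p rule: poly_mapping_single_induct)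
  case (single m a)
  show ?case
  proof (induction q rule: poly_mapping_single_induct)
    case (single n b)
    let ?e = "Poly_Mapping.single x (1::nat)"
    have sub: "l + k - ?e = l + (k - ?e)" if "Poly_Mapping.lookup k x \<noteq> 0" for l k :: "'a \<Rightarrow>\<^sub>0 nat"
      by (rule poly_mapping_eqI) (use that in \<open>auto simp: lookup_add lookup_minus lookup_single when_def\<close>)
    have "Poly_Mapping.single (m + n - ?e) (of_nat (Poly_Mapping.lookup n x) * (a * b)) =
        Poly_Mapping.single (m + (n - ?e)) (a * (of_nat (Poly_Mapping.lookup n x) * b))"
      using sub[of n m] by (cases "Poly_Mapping.lookup n x = 0") (simp_all add: mult_ac)
    moreover have "Poly_Mapping.single (m + n - ?e) (of_nat (Poly_Mapping.lookup m x) * (a * b)) =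
        Poly_Mapping.single (n + (m - ?e)) (b * (of_nat (Poly_Mapping.lookup m x) * a))"
      using sub[of m n]
      by (cases "Poly_Mapping.lookup m x = 0") (simp_all add: mult_ac add.commute[of n m])
    ultimately show ?case
      by (simp only: mult_single pderiv_mpoly_single lookup_add of_nat_add distrib_right single_add add.commute)
  qed (simp add: distrib_left distrib_right pderiv_mpoly_add)
qed (simp add: distrib_left distrib_right pderiv_mpoly_add)

lemma pderiv_mpoly_0 [simp]: "pderiv_mpoly x 0 = 0"
  by (simp add: pderiv_mpoly_def)

lemma pderiv_mpoly_Const [simp]: "pderiv_mpoly x (Const a) = 0"
  by (simp add: Const_def pderiv_mpoly_single)

lemma pderiv_mpoly_Var: "pderiv_mpoly x (Var y) = (if x = y then 1 else 0)"
  by (auto simp: Var_def pderiv_mpoly_single lookup_single)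

lemma lookup_pderiv_mpoly:
  "Poly_Mapping.lookup (pderiv_mpoly x p) k =
    of_nat (Suc (Poly_Mapping.lookup k x)) * Poly_Mapping.lookup p (k + Poly_Mapping.single x 1)"
proof (induction p rule: poly_mapping_single_induct)
  case (single m a)
  let ?e = "Poly_Mapping.single x (1::nat)"
  show ?case
  proof (cases "Poly_Mapping.lookup m x = 0")
    case True
    then have "m \<noteq> k + ?e" by (auto simp: lookup_add)
    with True show ?thesis by (simp add: pderiv_mpoly_single lookup_single)
  next
    case False
    have "m - ?e = k \<longleftrightarrow> m = k + ?e"
    proof
      assume "m - ?e = k"
      then show "m = k + ?e"
        by (intro poly_mapping_eqI)
          (use False in \<open>auto simp: lookup_add lookup_minus lookup_single when_def\<close>)
    qed auto
    then show ?thesis by (auto simp: pderiv_mpoly_single lookup_single lookup_add when_def)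
  qed
qed (simp add: pderiv_mpoly_add lookup_add algebra_simps)

text \<open>Ties the formal derivative to the analytic one, so that uniqueness of derivatives
  applies to a polynomial that vanishes as a function.\<close>

lemma peval_has_field_derivative:
  "((\<lambda>t. peval (\<chi> k. if k = x then t else z $ k) p) has_field_derivative
    peval (\<chi> k. if k = x then t else z $ k) (pderiv_mpoly x p)) (at t)"
proof (induction p rule: mpoly_induct)
  case (Var y)
  show ?case
    by (cases "x = y") (auto simp: pderiv_mpoly_Var intro!: derivative_eq_intros)
qed (auto intro!: derivative_eq_intros simp: pderiv_mpoly_add pderiv_mpoly_mult)

lemma peval_eq_0_imp_pderiv:
  assumes "\<And>z. peval z p = 0"
  shows "peval z (pderiv_mpoly x p) = 0"
proof -
  have eq: "(\<chi> k. if k = x then z $ x else z $ k) = z"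
    by (simp add: vec_eq_iff)
  have "((\<lambda>t. 0) has_field_derivative peval z (pderiv_mpoly x p)) (at (z $ x))"
    using peval_has_field_derivative[of x z p "z $ x"] by (simp add: assms eq)
  then show ?thesis using DERIV_unique DERIV_const by blast
qed

text \<open>Induction on the total degree: all partial derivatives vanish as functions, hence as
  polynomials, so that only the constant term survives.\<close>

lemma peval_eq_0_imp:
  fixes p :: "'x::finite mpoly"
  assumes "\<And>z. peval z p = 0"
  shows "p = 0"
proof -
  let ?deg = "\<lambda>m :: 'x \<Rightarrow>\<^sub>0 nat. \<Sum>x\<in>UNIV. Poly_Mapping.lookup m x"
  have "\<forall>m\<in>Poly_Mapping.keys p. ?deg m < N \<Longrightarrow> (\<And>z. peval z p = 0) \<Longrightarrow> p = 0" for N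
  proof (induction N arbitrary: p)
    case 0
    then have "Poly_Mapping.keys p = {}" by auto
    then show ?case by simp
  next
    case (Suc N)
    have deg: "?deg (m + Poly_Mapping.single x 1) = Suc (?deg m)" for m x
      by (simp add: lookup_add sum.distrib lookup_single when_def)
    have d0: "pderiv_mpoly x p = 0" for x
    proof (rule Suc.IH)
      show "\<forall>m\<in>Poly_Mapping.keys (pderiv_mpoly x p). ?deg m < N"
      proof
        fix m assume "m \<in> Poly_Mapping.keys (pderiv_mpoly x p)"
        then have "m + Poly_Mapping.single x 1 \<in> Poly_Mapping.keys p"
          by (auto simp: in_keys_iff lookup_pderiv_mpoly)
        with Suc.prems(1) deg[of m x] show "?deg m < N" by fastforce
      qed
    qed (rule peval_eq_0_imp_pderiv[OF Suc.prems(2)])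
    \<comment> \<open>Some variable occurs in \<open>m\<close>; up to a positive integer factor, the
      coefficient of \<open>m\<close> is a coefficient of the derivative in that variable, hence
      zero in characteristic zero.\<close>
    have "Poly_Mapping.lookup p m = 0" if "m \<noteq> 0" for m
    proof -
      obtain x where x: "Poly_Mapping.lookup m x \<noteq> 0"
        using \<open>m \<noteq> 0\<close> poly_mapping_eqI[of m 0] by auto
      let ?k = "m - Poly_Mapping.single x 1"
      have "m = ?k + Poly_Mapping.single x 1"
        by (rule poly_mapping_eqI) (use x in \<open>auto simp: lookup_add lookup_minus lookup_single when_def\<close>)
      moreover have "Poly_Mapping.lookup (pderiv_mpoly x p) ?k = 0" by (simp add: d0)
      ultimately show ?thesis by (simp only: lookup_pderiv_mpoly) (simp del: of_nat_Suc)
    qed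
    then have p: "p = Const (Poly_Mapping.lookup p 0)"
      by (intro poly_mapping_eqI) (auto simp: Const_def lookup_single when_def)
    with Suc.prems(2)[of 0] have "Poly_Mapping.lookup p 0 = 0" by (metis peval_Const)
    with p show ?case by (simp add: Const_def)
  qed
  from this[of "Suc (Max (?deg ` Poly_Mapping.keys p))"] assms show ?thesis
    by (simp add: less_Suc_eq_le)
qed

lemma peval_eqI:
  fixes p q :: "'x::finite mpoly"
  assumes "\<And>z. peval z p = peval z q"
  shows "p = q"
  using peval_eq_0_imp[of "p - q"] assms by simp

section \<open>Irreducible sets\<close>

text \<open>Substituting a polynomial curve turns a polynomial in several variables into one in the
  curve parameter, where the absence of zero divisors is available.\<close>

lemma poly_mpoly_hom: "poly (mpoly_hom (\<lambda>a. [:a:]) c p) t = peval (\<chi> k. poly (c k) t) p"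
  by (induction p rule: mpoly_induct)
    (simp_all add: ring_hom_pCons mpoly_hom_add mpoly_hom_mult)

lemma zeros_Int: "zeros S \<inter> zeros T = zeros (S \<union> T)"
  by (auto simp: zeros_def)

lemma zariski_closed_zeros: "zariski_closed (zeros S)"
  by (auto simp: zariski_closed_def)

text \<open>Joining any two points by a polynomial curve is enough: if \<open>X\<close> were a union
  of two proper closed pieces, the curve through a point missed by each would carry two nonzero
  univariate polynomials with product zero.\<close>

lemma irreducible_varietyI:
  fixes X :: "(complex ^ 'x) set"
  assumes closed: "zariski_closed X" and ne: "X \<noteq> {}"
    and curve: "\<And>a b. a \<in> X \<Longrightarrow> b \<in> X \<Longrightarrow> \<exists>c. (\<forall>t. (\<chi> k. poly (c k) t) \<in> X) \<and>
      (\<exists>t. a = (\<chi> k. poly (c k) t)) \<and> (\<exists>t. b = (\<chi> k. poly (c k) t))"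
  shows "irreducible_variety X"
  unfolding irreducible_variety_def
proof (intro conjI allI impI closed ne)
  fix C D assume "zariski_closed C \<and> zariski_closed D \<and> X = C \<union> D"
  then obtain S T where S: "C = zeros S" and T: "D = zeros T" and X: "X = C \<union> D"
    by (auto simp: zariski_closed_def)
  show "X = C \<or> X = D"
  proof (rule ccontr)
    assume "\<not> ?thesis"
    with X obtain a b where a: "a \<in> X" "a \<notin> C" and b: "b \<in> X" "b \<notin> D" by blast
    then obtain f g where f: "f \<in> S" "peval a f \<noteq> 0" and g: "g \<in> T" "peval b g \<noteq> 0"
      by (auto simp: S T zeros_def)
    obtain c where c: "\<And>t. (\<chi> k. poly (c k) t) \<in> X"
      and ca: "\<exists>t. a = (\<chi> k. poly (c k) t)" and cb: "\<exists>t. b = (\<chi> k. poly (c k) t)"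
      using curve[OF a(1) b(1)] by blast
    let ?h = "mpoly_hom (\<lambda>a. [:a:]) c"
    have "peval z f * peval z g = 0" if "z \<in> X" for z
      using that f(1) g(1) by (auto simp: X S T zeros_def)
    then have "poly (?h f * ?h g) t = 0" for t using c by (simp add: poly_mpoly_hom)
    then have "?h f * ?h g = 0" by (metis poly_all_0_iff_0)
    then have "?h f = 0 \<or> ?h g = 0" by simp
    moreover have "?h f \<noteq> 0" using f(2) ca poly_mpoly_hom[of c f] by auto
    moreover have "?h g \<noteq> 0" using g(2) cb poly_mpoly_hom[of c g] by auto
    ultimately show False by blast
  qed
qed

lemma irreducible_variety_UNIV: "irreducible_variety (UNIV :: (complex ^ 'x) set)"
proof (rule irreducible_varietyI)
  show "zariski_closed (UNIV :: (complex ^ 'x) set)"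
    unfolding zariski_closed_def by (intro exI[of _ "{}"]) (simp add: zeros_def)
  fix a b :: "complex ^ 'x"
  show "\<exists>c. (\<forall>t. (\<chi> k. poly (c k) t) \<in> UNIV) \<and>
      (\<exists>t. a = (\<chi> k. poly (c k) t)) \<and> (\<exists>t. b = (\<chi> k. poly (c k) t))"
  proof (intro exI conjI allI UNIV_I)
    show "a = (\<chi> k. poly [:a $ k, b $ k - a $ k:] 0)"
      and "b = (\<chi> k. poly [:a $ k, b $ k - a $ k:] 1)" by (simp_all add: vec_eq_iff)
  qed
qed simp

section \<open>Prime ideals, absence of zero divisors, irreducible components\<close>

lemma vanishing_ideal_prime:
  assumes X: "irreducible_variety X" and fg: "f * g \<in> vanishing_ideal X"
  shows "f \<in> vanishing_ideal X \<or> g \<in> vanishing_ideal X"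
proof -
  obtain S where S: "X = zeros S" using X by (auto simp: irreducible_variety_def zariski_closed_def)
  have "X = (X \<inter> zeros {f}) \<union> (X \<inter> zeros {g})"
    using fg by (auto simp: zeros_def vanishing_ideal_def)
  moreover have "zariski_closed (X \<inter> zeros {h})" for h
    by (simp add: S zeros_Int zariski_closed_zeros)
  ultimately have "X = X \<inter> zeros {f} \<or> X = X \<inter> zeros {g}"
    using X unfolding irreducible_variety_def by blast
  then show ?thesis by (auto simp: vanishing_ideal_def zeros_def)
qed

lemma vanishing_ideal_UNIV: "vanishing_ideal UNIV = {0 :: 'x::finite mpoly}"
  by (auto simp: vanishing_ideal_def peval_eq_0_imp)

text \<open>Affine space is irreducible, so its vanishing ideal is prime; this ideal is zero because
  a polynomial vanishing at every point is zero.\<close>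

lemma mpoly_mult_eq_0_iff:
  fixes f g :: "'x::finite mpoly"
  shows "f * g = 0 \<longleftrightarrow> f = 0 \<or> g = 0"
  using vanishing_ideal_prime[OF irreducible_variety_UNIV, of f g]
  by (auto simp: vanishing_ideal_UNIV)

lemma irreducible_components_irreducible:
  assumes "irreducible_variety X"
  shows "irreducible_components X = {X}"
  using assms by (auto simp: irreducible_components_def)

lemma irreducible_subset_Un:
  assumes "irreducible_variety Y" "Y \<subseteq> P \<union> Q" "zariski_closed P" "zariski_closed Q"
  shows "Y \<subseteq> P \<or> Y \<subseteq> Q"
proof -
  obtain S T R where "Y = zeros R" "P = zeros S" "Q = zeros T"
    using assms by (auto simp: irreducible_variety_def zariski_closed_def)
  then have "zariski_closed (Y \<inter> P)" "zariski_closed (Y \<inter> Q)"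
    by (simp_all add: zeros_Int zariski_closed_zeros)
  moreover have "Y = (Y \<inter> P) \<union> (Y \<inter> Q)" using assms(2) by auto
  ultimately have "Y = Y \<inter> P \<or> Y = Y \<inter> Q"
    using assms(1) unfolding irreducible_variety_def by blast
  then show ?thesis by blast
qed

lemma irreducible_components_Un:
  assumes P: "irreducible_variety P" and Q: "irreducible_variety Q"
    and "\<not> P \<subseteq> Q" "\<not> Q \<subseteq> P"
  shows "irreducible_components (P \<union> Q) = {P, Q}"
proof -
  have sub: "Y \<subseteq> P \<or> Y \<subseteq> Q" if "irreducible_variety Y" "Y \<subseteq> P \<union> Q" for Y
    using irreducible_subset_Un[OF that] P Q by (auto simp: irreducible_variety_def)
  show ?thesis
  proof (intro equalityI subsetI)
    fix Y assume "Y \<in> irreducible_components (P \<union> Q)"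
    then have Y: "irreducible_variety Y" "Y \<subseteq> P \<union> Q"
      and max: "\<And>Z. irreducible_variety Z \<Longrightarrow> Y \<subseteq> Z \<Longrightarrow> Z \<subseteq> P \<union> Q \<Longrightarrow> Z = Y"
      by (auto simp: irreducible_components_def)
    show "Y \<in> {P, Q}" using sub[OF Y] max[OF P] max[OF Q] by auto
  next
    fix Y assume "Y \<in> {P, Q}"
    then have "Y = P \<or> Y = Q" by simp
    then show "Y \<in> irreducible_components (P \<union> Q)"
    proof
      assume "Y = P"
      moreover have "Z = P" if "irreducible_variety Z" "P \<subseteq> Z" "Z \<subseteq> P \<union> Q" for Z
        using sub[OF that(1,3)] that(2) assms(3) by blast
      ultimately show ?thesis using P by (auto simp: irreducible_components_def)
    next
      assume "Y = Q"
      moreover have "Z = Q" if "irreducible_variety Z" "Q \<subseteq> Z" "Z \<subseteq> P \<union> Q" for Z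
        using sub[OF that(1,3)] that(2) assms(4) by blast
      ultimately show ?thesis using Q by (auto simp: irreducible_components_def)
    qed
  qed
qed

section \<open>Generic properties of pairs\<close>

lemma pair_nth [simp]: "pair u v $ Inl k = u $ k" "pair u v $ Inr k = v $ k"
  by (simp_all add: pair_def)

lemma pair_surj: "\<exists>u v. x = pair u v"
  by (intro exI[of _ "\<chi> k. x $ Inl k"] exI[of _ "\<chi> k. x $ Inr k"])
    (simp add: vec_eq_iff pair_def split: sum.split)

lemma pair_eq_iff [simp]: "pair u v = pair u' v' \<longleftrightarrow> u = u' \<and> v = v'"
proof
  assume eq: "pair u v = pair u' v'"
  have "u $ k = u' $ k" "v $ k = v' $ k" for k
    using arg_cong[OF eq, of "\<lambda>x. x $ Inl k"] arg_cong[OF eq, of "\<lambda>x. x $ Inr k"] by simp_all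
  then show "u = u' \<and> v = v'" by (simp add: vec_eq_iff)
qed simp

text \<open>The regular functions on the space of data pairs. Conjugation is not among them, so
  conjugate data enter as the separate argument \<open>v\<close>.\<close>

definition poly_fun2 :: "(complex ^ 'n \<Rightarrow> complex ^ 'n \<Rightarrow> complex) \<Rightarrow> bool" where
  "poly_fun2 F \<longleftrightarrow> (\<exists>p. \<forall>u v. F u v = peval (pair u v) p)"

lemma poly_fun2_const [intro]: "poly_fun2 (\<lambda>u v. c)"
  unfolding poly_fun2_def by (intro exI[of _ "Const c"]) simp

lemma poly_fun2_fst [intro]: "poly_fun2 (\<lambda>u v. u $ k)"
  unfolding poly_fun2_def by (intro exI[of _ "Var (Inl k)"]) simp

lemma poly_fun2_snd [intro]: "poly_fun2 (\<lambda>u v. v $ k)"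
  unfolding poly_fun2_def by (intro exI[of _ "Var (Inr k)"]) simp

lemma poly_fun2_add [intro]:
  assumes "poly_fun2 F" "poly_fun2 G" shows "poly_fun2 (\<lambda>u v. F u v + G u v)"
proof -
  obtain p q where "\<forall>u v. F u v = peval (pair u v) p" "\<forall>u v. G u v = peval (pair u v) q"
    using assms by (auto simp: poly_fun2_def)
  then show ?thesis unfolding poly_fun2_def by (intro exI[of _ "p + q"]) simp
qed

lemma poly_fun2_mult [intro]:
  assumes "poly_fun2 F" "poly_fun2 G" shows "poly_fun2 (\<lambda>u v. F u v * G u v)"
proof -
  obtain p q where "\<forall>u v. F u v = peval (pair u v) p" "\<forall>u v. G u v = peval (pair u v) q"
    using assms by (auto simp: poly_fun2_def)
  then show ?thesis unfolding poly_fun2_def by (intro exI[of _ "p * q"]) simp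
qed

lemma poly_fun2_uminus [intro]: "poly_fun2 F \<Longrightarrow> poly_fun2 (\<lambda>u v. - F u v)"
  using poly_fun2_mult[OF poly_fun2_const[of "-1"]] by simp

lemma poly_fun2_diff [intro]:
  "poly_fun2 F \<Longrightarrow> poly_fun2 G \<Longrightarrow> poly_fun2 (\<lambda>u v. F u v - G u v)"
  using poly_fun2_add[OF _ poly_fun2_uminus, of F G] by simp

lemma poly_fun2_power [intro]: "poly_fun2 F \<Longrightarrow> poly_fun2 (\<lambda>u v. F u v ^ n)"
  by (induction n) auto

lemma poly_fun2_sum [intro]:
  "(\<And>i. i \<in> I \<Longrightarrow> poly_fun2 (F i)) \<Longrightarrow> poly_fun2 (\<lambda>u v. \<Sum>i\<in>I. F i u v)"
  by (induction I rule: infinite_finite_induct) auto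

lemma poly_fun2_prod [intro]:
  "(\<And>i. i \<in> I \<Longrightarrow> poly_fun2 (F i)) \<Longrightarrow> poly_fun2 (\<lambda>u v. \<Prod>i\<in>I. F i u v)"
  by (induction I rule: infinite_finite_induct) auto

lemma poly_fun2_compose:
  assumes F: "poly_fun2 F" and "\<And>k. poly_fun2 (\<lambda>u v. L u v $ k)" "\<And>k. poly_fun2 (\<lambda>u v. M u v $ k)"
  shows "poly_fun2 (\<lambda>u v. F (L u v) (M u v))"
proof -
  obtain p where p: "\<And>u v. F u v = peval (pair u v) p" using F by (auto simp: poly_fun2_def)
  have "poly_fun2 (\<lambda>u v. pair (L u v) (M u v) $ k)" for k
    by (cases k) (simp_all add: assms)
  then have "poly_fun2 (\<lambda>u v. peval (pair (L u v) (M u v)) p)"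
    by (induction p rule: mpoly_induct) auto
  then show ?thesis by (simp add: p)
qed

text \<open>Holding on a nonempty principal open set of pairs. Nonemptiness is recorded by a witness
  \<open>u0\<close>, \<open>v0\<close>, so that one datum proves a condition generic; closure under
  conjunction then uses that the polynomial ring is a domain.\<close>

definition generic :: "(complex ^ 'n \<Rightarrow> complex ^ 'n \<Rightarrow> bool) \<Rightarrow> bool" where
  "generic P \<longleftrightarrow> (\<exists>F u0 v0. poly_fun2 F \<and> F u0 v0 \<noteq> 0 \<and> (\<forall>u v. F u v \<noteq> 0 \<longrightarrow> P u v))"

lemma genericI: "poly_fun2 F \<Longrightarrow> F u0 v0 \<noteq> 0 \<Longrightarrow> generic (\<lambda>u v. F u v \<noteq> 0)"
  by (auto simp: generic_def)

lemma generic_mono: "generic P \<Longrightarrow> (\<And>u v. P u v \<Longrightarrow> Q u v) \<Longrightarrow> generic Q"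
  unfolding generic_def by blast

lemma generic_True [simp]: "generic (\<lambda>u v. True)"
  unfolding generic_def by (intro exI[of _ "\<lambda>u v. 1"]) auto

lemma generic_conj:
  assumes "generic P" "generic Q" shows "generic (\<lambda>u v. P u v \<and> Q u v)"
proof -
  obtain F u0 v0 where F: "poly_fun2 F" "F u0 v0 \<noteq> 0" "\<And>u v. F u v \<noteq> 0 \<Longrightarrow> P u v"
    using assms(1) unfolding generic_def by metis
  obtain G u1 v1 where G: "poly_fun2 G" "G u1 v1 \<noteq> 0" "\<And>u v. G u v \<noteq> 0 \<Longrightarrow> Q u v"
    using assms(2) unfolding generic_def by metis
  obtain p q where p: "\<And>u v. F u v = peval (pair u v) p" and q: "\<And>u v. G u v = peval (pair u v) q"
    using F(1) G(1) by (auto simp: poly_fun2_def)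
  have "p * q \<noteq> 0" using F(2) G(2) by (auto simp: mpoly_mult_eq_0_iff p q)
  then obtain x where "peval x (p * q) \<noteq> 0" using peval_eq_0_imp by blast
  then obtain u v where "F u v * G u v \<noteq> 0" using pair_surj[of x] by (auto simp: p q)
  then show ?thesis unfolding generic_def
    by (intro exI[of _ "\<lambda>u v. F u v * G u v"] exI[of _ u] exI[of _ v]) (auto intro: F(1,3) G(1,3))
qed

lemma generic_ball:
  assumes "finite I" "\<And>i. i \<in> I \<Longrightarrow> generic (P i)"
  shows "generic (\<lambda>u v. \<forall>i\<in>I. P i u v)"
  using assms by (induction I rule: finite_induct) (auto simp: generic_conj)

lemma generic_compose:
  assumes "generic P" and "\<And>k. poly_fun2 (\<lambda>u v. L u v $ k)" "\<And>k. poly_fun2 (\<lambda>u v. M u v $ k)"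
    and surj: "\<And>a b. \<exists>u v. L u v = a \<and> M u v = b"
  shows "generic (\<lambda>u v. P (L u v) (M u v))"
proof -
  obtain F a b where F: "poly_fun2 F" "F a b \<noteq> 0" "\<And>u v. F u v \<noteq> 0 \<Longrightarrow> P u v"
    using assms(1) unfolding generic_def by metis
  obtain u v where "L u v = a" "M u v = b" using surj by blast
  with F poly_fun2_compose[OF F(1) assms(2,3)] show ?thesis
    unfolding generic_def by (intro exI[of _ "\<lambda>u v. F (L u v) (M u v)"]) blast
qed

text \<open>Two dense open sets of data meet, so the count on one determines the count on the other.
  This is the uniqueness that the definite description requires.\<close>

lemma vHDdeg_eqI:
  fixes X :: "(complex ^ 'n) set"
  assumes "generic (\<lambda>u v. vHD_count X u v N)"
  shows "vHDdeg X = N"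
proof -
  obtain F u0 v0 where F: "poly_fun2 F" "F u0 v0 \<noteq> 0" "\<And>u v. F u v \<noteq> 0 \<Longrightarrow> vHD_count X u v N"
    using assms unfolding generic_def by metis
  obtain p where p: "\<And>u v. F u v = peval (pair u v) p" using F(1) by (auto simp: poly_fun2_def)
  then have p0: "p \<noteq> 0" using F(2) by auto
  let ?U = "- zeros {p}"
  have "zariski_open ?U" by (simp add: zariski_open_def zariski_closed_zeros)
  moreover have dense: "zariski_dense ?U"
    unfolding zariski_dense_def
  proof (intro allI impI)
    fix C assume "zariski_closed C \<and> ?U \<subseteq> C"
    then obtain S where C: "C = zeros S" and sub: "?U \<subseteq> zeros S" by (auto simp: zariski_closed_def)
    \<comment> \<open>Each \<open>f\<close> in \<open>S\<close> vanishes wherever \<open>p\<close>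
      does not, so \<open>f * p\<close> vanishes everywhere and \<open>p\<close> can be
      cancelled.\<close>
    have "peval x f = 0" if "f \<in> S" for f x
    proof -
      have "peval z f = 0 \<or> peval z p = 0" for z using that sub by (auto simp: zeros_def)
      then have "f * p = 0" by (intro peval_eq_0_imp) auto
      with p0 have "f = 0" by (simp add: mpoly_mult_eq_0_iff)
      then show ?thesis by simp
    qed
    then show "C = UNIV" by (auto simp: C zeros_def)
  qed
  moreover have "\<forall>u v. pair u v \<in> ?U \<longrightarrow> vHD_count X u v N" using F(3) by (auto simp: zeros_def p)
  ultimately have ex: "\<exists>U. zariski_open U \<and> zariski_dense U \<and> (\<forall>u v. pair u v \<in> U \<longrightarrow> vHD_count X u v N)"
    by blast
  show ?thesis unfolding vHDdeg_def
  proof (rule the_equality, rule ex)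
    fix M assume "\<exists>U. zariski_open U \<and> zariski_dense U \<and> (\<forall>u v. pair u v \<in> U \<longrightarrow> vHD_count X u v M)"
    then obtain U where U: "zariski_open U" "zariski_dense U"
      "\<And>u v. pair u v \<in> U \<Longrightarrow> vHD_count X u v M" by blast
    have "\<exists>x. x \<in> U \<inter> ?U"
    proof (rule ccontr)
      assume "\<not> ?thesis"
      then have "U \<subseteq> zeros {p}" by blast
      then have "zeros {p} = UNIV" using U(2) by (simp add: zariski_dense_def zariski_closed_zeros)
      then show False using p0 peval_eq_0_imp[of p] by (auto simp: zeros_def)
    qed
    then obtain u v where uv: "pair u v \<in> U" "pair u v \<in> ?U" using pair_surj by (metis IntE)
    then have "vHD_count X u v M" "vHD_count X u v N" using U(3) F(3) by (auto simp: zeros_def p)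
    then show "M = N" by (simp add: vHD_count_def)
  qed
qed

section \<open>Ideals and saturation\<close>

lemma ideal_span_minimal:
  assumes "S \<subseteq> T" "0 \<in> T" "\<And>x y. x \<in> T \<Longrightarrow> y \<in> T \<Longrightarrow> x + y \<in> T" "\<And>c x. x \<in> T \<Longrightarrow> c * x \<in> T"
  shows "ideal.span S \<subseteq> T"
  using assms by (intro ideal.span_minimal) (auto simp: ideal.subspace_def)

lemma ideal_span_mult_right: "x \<in> ideal.span S \<Longrightarrow> x * c \<in> ideal.span S"
  using ideal.span_scale[of x S c] by (simp add: mult.commute)

lemma ring_hom_span_subset:
  assumes h: "ring_hom h" and "\<And>x. x \<in> S \<Longrightarrow> h x \<in> ideal.span T" and x: "x \<in> ideal.span S"
  shows "h x \<in> ideal.span T"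
proof -
  have "ideal.span S \<subseteq> {x. h x \<in> ideal.span T}"
    by (rule ideal_span_minimal)
      (use assms in \<open>auto simp: ring_hom_simps[OF h] intro: ideal.span_zero ideal.span_add ideal.span_scale\<close>)
  with x show ?thesis by blast
qed

lemma zeros_ring_hom_image_span:
  assumes h: "ring_hom h" shows "zeros (h ` ideal.span S) = zeros (h ` S)"
proof (intro equalityI subsetI)
  fix z assume "z \<in> zeros (h ` S)"
  then have "ideal.span S \<subseteq> {x. peval z (h x) = 0}"
    by (intro ideal_span_minimal) (auto simp: zeros_def ring_hom_simps[OF h])
  then show "z \<in> zeros (h ` ideal.span S)" by (auto simp: zeros_def)
qed (auto simp: zeros_def ideal.span_base)

lemma subspace_ring_hom_image:
  assumes h: "ring_hom h" and surj: "surj h"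
  shows "ideal.subspace (h ` ideal.span S)"
  unfolding ideal.subspace_def
proof (intro conjI allI ballI)
  show "0 \<in> h ` ideal.span S" using ring_hom_0[OF h] ideal.span_zero by force
next
  fix x y assume "x \<in> h ` ideal.span S" "y \<in> h ` ideal.span S"
  then obtain a b where "a \<in> ideal.span S" "x = h a" "b \<in> ideal.span S" "y = h b" by blast
  then show "x + y \<in> h ` ideal.span S"
    by (intro image_eqI[of _ _ "a + b"]) (auto simp: ring_hom_add[OF h] ideal.span_add)
next
  fix c x assume "x \<in> h ` ideal.span S"
  then obtain a where "a \<in> ideal.span S" "x = h a" by blast
  moreover obtain b where "c = h b" using surj by blast
  ultimately show "c * x \<in> h ` ideal.span S"
    by (intro image_eqI[of _ _ "b * a"]) (auto simp: ring_hom_mult[OF h] ideal.span_scale)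
qed

lemma saturation_superset:
  assumes "ideal.subspace I" shows "I \<subseteq> saturation I J"
proof
  fix g assume "g \<in> I"
  then have "g \<in> ideal_quotient I (ideal_pow J 0)"
    using ideal.subspace_scale[OF assms, of g] by (simp add: ideal_quotient_def mult.commute[of g])
  then show "g \<in> saturation I J" unfolding saturation_def by blast
qed

lemma power_in_ideal_pow: "h \<in> J \<Longrightarrow> h ^ N \<in> ideal_pow J N"
  by (induction N) (auto simp: ideal_prod_def intro: ideal.span_base)

text \<open>A zero outside the zero set of \<open>J\<close> survives: some \<open>h\<close> in
  \<open>J\<close> is nonzero there, and a power of \<open>h\<close> carries a given element of the
  saturation into \<open>I\<close>.\<close>

lemma zeros_saturation:
  assumes "p \<in> zeros I" "p \<notin> zeros J" shows "p \<in> zeros (saturation I J)"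
proof -
  obtain h where h: "h \<in> J" "peval p h \<noteq> 0" using assms(2) by (auto simp: zeros_def)
  have "peval p g = 0" if "g \<in> saturation I J" for g
  proof -
    obtain N where "g \<in> ideal_quotient I (ideal_pow J N)"
      using \<open>g \<in> saturation I J\<close> by (auto simp: saturation_def)
    then have "g * h ^ N \<in> I" using power_in_ideal_pow[OF h(1)] by (auto simp: ideal_quotient_def)
    then have "peval p (g * h ^ N) = 0" using assms(1) by (auto simp: zeros_def)
    with h(2) show ?thesis by simp
  qed
  then show ?thesis by (auto simp: zeros_def)
qed

text \<open>The second power of \<open>J\<close> is the exponent that the vertex of a quadric cone
  calls for: the element that cuts out the vertex enters \<open>I\<close> after multiplication with
  two entries of the gradient.\<close>

lemma in_saturationI:
  assumes I: "ideal.subspace I" and J: "\<And>x y. x \<in> J \<Longrightarrow> y \<in> J \<Longrightarrow> g * x * y \<in> I"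
  shows "g \<in> saturation I J"
proof -
  note closed = ideal.subspace_0[OF I] ideal.subspace_add[OF I] ideal.subspace_scale[OF I]
  have *: "ideal_prod J UNIV \<subseteq> {y. g * x * y \<in> I}" if "x \<in> J" for x
    unfolding ideal_prod_def
  proof (rule ideal_span_minimal)
    show "{a * b |a b. a \<in> J \<and> b \<in> UNIV} \<subseteq> {y. g * x * y \<in> I}"
    proof clarify
      fix a b assume "a \<in> J"
      then have "b * (g * x * a) \<in> I" by (intro closed(3) J that)
      then show "g * x * (a * b) \<in> I" by (simp add: mult_ac)
    qed
    fix c y assume "y \<in> {y. g * x * y \<in> I}"
    then have "c * (g * x * y) \<in> I" using closed(3) by blast
    then show "c * y \<in> {y. g * x * y \<in> I}" by (simp add: mult_ac)
  qed (use closed in \<open>auto simp: distrib_left\<close>)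
  have "ideal_prod J (ideal_prod J UNIV) \<subseteq> {y. g * y \<in> I}"
    unfolding ideal_prod_def[of J "ideal_prod J UNIV"]
  proof (rule ideal_span_minimal)
    show "{a * b |a b. a \<in> J \<and> b \<in> ideal_prod J UNIV} \<subseteq> {y. g * y \<in> I}"
      using * by (auto simp: mult.assoc)
    fix c y assume "y \<in> {y. g * y \<in> I}"
    then have "c * (g * y) \<in> I" using closed(3) by blast
    then show "c * y \<in> {y. g * y \<in> I}" by (simp add: mult_ac)
  qed (use closed in \<open>auto simp: distrib_left\<close>)
  then have "g \<in> ideal_quotient I (ideal_pow J 2)"
    by (auto simp: ideal_quotient_def numeral_2_eq_2)
  then show ?thesis unfolding saturation_def by blast
qed

section \<open>Minors of order one and two\<close>

lemma minors_1: "minors 1 M = {M ! i $ a | i a. i < length M}" (is "?L = ?R")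
proof (intro equalityI subsetI)
  have p: "{p. p permutes {..<1::nat}} = {id}" by (auto simp: lessThan_Suc)
  show "x \<in> ?R" if "x \<in> ?L" for x
    using that by (auto simp: minors_def p lessThan_Suc)
  fix x assume "x \<in> ?R"
  then obtain i a where "i < length M" "x = M ! i $ a" by blast
  then show "x \<in> ?L"
    unfolding minors_def
    by (intro CollectI exI[of _ "\<lambda>_. i"] exI[of _ "\<lambda>_. a"]) (auto simp: p lessThan_Suc)
qed

lemma minors_2:
  fixes M :: "('a::comm_ring_1 ^ 'n) list"
  shows "minors 2 M = {M ! i $ a * M ! j $ b - M ! i $ b * M ! j $ a | i j a b.
    i < length M \<and> j < length M \<and> i \<noteq> j \<and> a \<noteq> b}" (is "?L = ?R")
proof -
  have two: "{..<2::nat} = {0, 1}" by auto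
  have p: "{p. p permutes {0, 1::nat}} = {id, Transposition.transpose 0 1}"
    by (auto simp: permutes_doubleton_iff)
  have neq: "id \<noteq> Transposition.transpose 0 (1::nat)"
    by (metis id_apply transpose_apply_first zero_neq_one)
  have det: "(\<Sum>p | p permutes {..<2}. of_int (sign p) * (\<Prod>i<2. M ! r i $ c (p i))) =
      M ! r 0 $ c 0 * M ! r 1 $ c 1 - M ! r 0 $ c 1 * M ! r 1 $ c 0" for r :: "nat \<Rightarrow> nat" and c
    unfolding two p using neq by (simp add: sign_swap_id)
  show ?thesis
  proof (intro equalityI subsetI)
    fix x assume "x \<in> ?L"
    then obtain r c where x: "x = M ! r 0 $ c 0 * M ! r 1 $ c 1 - M ! r 0 $ c 1 * M ! r 1 $ c 0"
      and r: "inj_on r {0, 1::nat}" "r ` {0, 1} \<subseteq> {..<length M}" "inj_on c {0, 1::nat}"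
      unfolding minors_def det unfolding two by blast
    then show "x \<in> ?R"
      by (intro CollectI exI[of _ "r 0"] exI[of _ "r 1"] exI[of _ "c 0"] exI[of _ "c 1"])
        (auto simp: inj_on_def)
  next
    fix x assume "x \<in> ?R"
    then obtain i j a b where *: "i < length M" "j < length M" "i \<noteq> j" "a \<noteq> b"
      and x: "x = M ! i $ a * M ! j $ b - M ! i $ b * M ! j $ a" by blast
    show "x \<in> ?L" unfolding minors_def det
      by (intro CollectI exI[of _ "\<lambda>k. if k = 0 then i else j"] exI[of _ "\<lambda>k. if k = 0 then a else b"])
        (use * in \<open>auto simp: two x inj_on_def\<close>)
  qed
qed

section \<open>Evaluation of the Hermitian critical ideal\<close>

definition cvec :: "complex ^ 'n \<Rightarrow> complex ^ 'n" where
  "cvec z = (\<chi> k. cnj (z $ k))"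

lemma cvec_nth [simp]: "cvec z $ k = cnj (z $ k)"
  by (simp add: cvec_def)

lemma cvec_cvec [simp]: "cvec (cvec z) = z"
  by (simp add: vec_eq_iff)

fun hvar_value :: "complex ^ 'n \<Rightarrow> complex ^ 'n \<Rightarrow> complex ^ 'n \<Rightarrow> complex ^ 'n \<Rightarrow> 'n hvar \<Rightarrow> complex" where
  "hvar_value z w u v (Zv k) = z $ k"
| "hvar_value z w u v (Wv k) = w $ k"
| "hvar_value z w u v (Uv k) = u $ k"
| "hvar_value z w u v (Vv k) = v $ k"

lemma ring_hom_in_z: "ring_hom in_z"
  and ring_hom_star: "ring_hom star"
  and ring_hom_specialize: "ring_hom (specialize u v)"
  unfolding in_z_def star_def specialize_def
  by (intro ring_hom_mpoly_hom ring_hom_Const ring_hom_Const_cnj)+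

lemma specialize_simps [simp]:
  "specialize u v (Const a) = Const a"
  "specialize u v (Var (Zv k)) = Var (Inl k)" "specialize u v (Var (Wv k)) = Var (Inr k)"
  "specialize u v (Var (Uv k)) = Const (u $ k)" "specialize u v (Var (Vv k)) = Const (v $ k)"
  unfolding specialize_def by (simp_all add: ring_hom_Const)

lemma star_simps [simp]: "star (Const a) = Const (cnj a)" "star (Var x) = Var (swap_hvar x)"
  unfolding star_def by (simp_all add: ring_hom_Const_cnj)

lemma in_z_simps [simp]: "in_z (Const a) = Const a" "in_z (Var k) = Var (Zv k)"
  unfolding in_z_def by (simp_all add: ring_hom_Const)

definition heval :: "complex ^ 'n \<Rightarrow> complex ^ 'n \<Rightarrow> complex ^ 'n \<Rightarrow> complex ^ 'n \<Rightarrow> 'n hvar mpoly \<Rightarrow> complex" where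
  "heval z w u v = mpoly_hom (\<lambda>a. a) (hvar_value z w u v)"

lemma ring_hom_heval: "ring_hom (heval z w u v)"
  unfolding heval_def by (intro ring_hom_mpoly_hom ring_hom_id)

lemma heval_simps [simp]: "heval z w u v (Const a) = a" "heval z w u v (Var x) = hvar_value z w u v x"
  unfolding heval_def by (simp_all add: ring_hom_id)

lemma peval_specialize: "peval (pair z w) (specialize u v p) = heval z w u v p"
proof (induction p rule: mpoly_induct)
  case (Var x)
  show ?case by (cases x) simp_all
qed (simp_all add: ring_hom_simps[OF ring_hom_specialize] ring_hom_simps[OF ring_hom_heval])

lemma heval_in_z: "heval z w u v (in_z p) = peval z p"
  by (induction p rule: mpoly_induct)
    (simp_all add: ring_hom_simps[OF ring_hom_in_z] ring_hom_simps[OF ring_hom_heval])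

text \<open>Conjugating coefficients and swapping variables is the same as conjugating the value at
  the conjugated and swapped point. Every fact about the starred half of the ideal thus follows from
  the unstarred half for conjugate data.\<close>

lemma heval_star: "heval z w u v (star p) = cnj (heval (cvec w) (cvec z) (cvec v) (cvec u) p)"
proof (induction p rule: mpoly_induct)
  case (Var x)
  show ?case by (cases x) simp_all
qed (simp_all add: ring_hom_simps[OF ring_hom_star] ring_hom_simps[OF ring_hom_heval])

lemma surj_specialize: "surj (specialize u v)"
proof -
  have "\<exists>q. p = specialize u v q" for p
  proof (induction p rule: mpoly_induct)
    case (Const a)
    show ?case by (intro exI[of _ "Const a"]) simp
  next
    case (Var x)
    show ?case by (cases x) (metis specialize_simps(2), metis specialize_simps(3))
  next
    case (add p q)
    then show ?case by (metis ring_hom_add[OF ring_hom_specialize])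
  next
    case (mult p q)
    then show ?case by (metis ring_hom_mult[OF ring_hom_specialize])
  qed
  then show ?thesis by blast
qed

section \<open>Irreducible hypersurfaces\<close>

lemma parallel_if_annihilates:
  fixes g c :: "complex ^ 'n"
  assumes "g \<noteq> 0" and "\<And>\<nu>. (\<Sum>k\<in>UNIV. g $ k * \<nu> $ k) = 0 \<Longrightarrow> (\<Sum>k\<in>UNIV. c $ k * \<nu> $ k) = 0"
  shows "\<exists>\<mu>. c = \<mu> *s g"
proof -
  obtain i where i: "g $ i \<noteq> 0" using assms(1) by (auto simp: vec_eq_iff)
  have "c $ j = c $ i / g $ i * g $ j" for j
  proof -
    \<comment> \<open>The test vector is \<open>g $ i\<close> times the \<open>j\<close>-th unit
      vector minus \<open>g $ j\<close> times the \<open>i\<close>-th. It lies in the kernel of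
      \<open>g\<close>, and \<open>c\<close> takes on it the value of a two-by-two minor of
      \<open>c\<close> and \<open>g\<close>.\<close>
    let ?\<nu> = "\<chi> k. (if k = j then g $ i else 0) - (if k = i then g $ j else 0)"
    have *: "(\<Sum>k\<in>UNIV. h $ k * ?\<nu> $ k) = h $ j * g $ i - h $ i * g $ j" for h :: "complex ^ 'n"
      by (simp add: algebra_simps sum_subtractf if_distrib[of "\<lambda>x. _ * x"] cong: if_cong)
    then have "c $ j * g $ i = c $ i * g $ j" using assms(2)[of ?\<nu>] by (simp only: *) simp
    with i show ?thesis by (simp add: field_simps)
  qed
  then show ?thesis unfolding vec_eq_iff vector_smult_component by blast
qed

lemma parallel_if_minors:
  fixes g c :: "complex ^ 'n"
  assumes "g \<noteq> 0" and "\<And>i j. c $ i * g $ j = c $ j * g $ i"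
  shows "\<exists>\<mu>. c = \<mu> *s g"
proof -
  obtain i where i: "g $ i \<noteq> 0" using assms(1) by (auto simp: vec_eq_iff)
  have "c $ j = c $ i / g $ i * g $ j" for j using assms(2)[of i j] i by (simp add: field_simps)
  then show ?thesis unfolding vec_eq_iff vector_smult_component by blast
qed

definition grad :: "'n mpoly \<Rightarrow> complex ^ 'n \<Rightarrow> complex ^ 'n" where
  "grad f z = (\<chi> i. peval z (pderiv_mpoly i f))"

lemma grad_nth [simp]: "grad f z $ i = peval z (pderiv_mpoly i f)"
  by (simp add: grad_def)

definition hminor :: "'n mpoly \<Rightarrow> 'n \<Rightarrow> 'n \<Rightarrow> 'n hvar mpoly" where
  "hminor f i j = (Var (Vv i) - Var (Wv i)) * in_z (pderiv_mpoly j f) -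
     (Var (Vv j) - Var (Wv j)) * in_z (pderiv_mpoly i f)"

definition hminors :: "'n mpoly \<Rightarrow> 'n hvar mpoly set" where
  "hminors f = {hminor f i j | i j. True}"

lemma ball_hminors: "(\<forall>p\<in>hminors f. P p) \<longleftrightarrow> (\<forall>i j. P (hminor f i j))"
  by (auto simp: hminors_def)

text \<open>Generators built from the single equation \<open>f\<close> in place of the list picked
  by \<open>generators\<close>; \<open>hcrit_sum_ideal_eq\<close> justifies the exchange.\<close>

definition hcrit_generators :: "'n mpoly \<Rightarrow> 'n hvar mpoly set" where
  "hcrit_generators f = {in_z f, star (in_z f)} \<union> hminors f \<union> star ` hminors f"

lemma heval_hminor: "heval z w u v (hminor f i j) =
    (v - w) $ i * grad f z $ j - (v - w) $ j * grad f z $ i"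
  by (simp add: hminor_def ring_hom_simps[OF ring_hom_heval] heval_in_z)

text \<open>Treats planes and nondegenerate cones alike. That the vanishing ideal is principal is
  the substantial assumption: the Jacobian is formed from an arbitrary list of generators, and all
  of them are multiples of \<open>f\<close>.\<close>

locale irreducible_hypersurface =
  fixes f :: "'n::finite mpoly" and X :: "(complex ^ 'n) set"
  assumes X_eq: "X = zeros {f}" and vanishing_ideal_eq: "vanishing_ideal X = ideal.span {f}"
    and irreducible: "irreducible_variety X" and f_nonzero: "f \<noteq> 0"
begin

lemma in_X_iff: "z \<in> X \<longleftrightarrow> peval z f = 0"
  by (simp add: X_eq zeros_def)

lemma f_in: "f \<in> vanishing_ideal X"
  by (simp add: vanishing_ideal_eq ideal.span_base)

lemma vanishing_ideal_multiple: "h \<in> vanishing_ideal X \<Longrightarrow> \<exists>g. h = g * f"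
  by (auto simp: vanishing_ideal_eq ideal.span_singleton)

lemma X_neq_UNIV: "X \<noteq> UNIV"
  using peval_eq_0_imp[of f] f_nonzero in_X_iff by blast

text \<open>The degree that decreases in the induction is that of the restriction to a line that starts
  on \<open>X\<close>, where \<open>f\<close> vanishes at one point but not identically.\<close>

lemma no_irreducible_above:
  assumes Z: "irreducible_variety Z" "X \<subset> Z" shows "Z = UNIV"
proof (rule ccontr)
  assume "Z \<noteq> UNIV"
  then obtain z where z: "z \<notin> Z" by blast
  obtain S where S: "Z = zeros S" using Z by (auto simp: irreducible_variety_def zariski_closed_def)
  with z obtain g where "g \<in> S" "peval z g \<noteq> 0" by (auto simp: zeros_def)
  then have g: "g \<in> vanishing_ideal Z" "g \<noteq> 0" by (auto simp: S zeros_def vanishing_ideal_def)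
  obtain x where x: "x \<in> X" using irreducible by (auto simp: irreducible_variety_def)
  have "g * f \<noteq> 0" using g f_nonzero by (simp add: mpoly_mult_eq_0_iff)
  then obtain y where y: "peval y g \<noteq> 0" "peval y f \<noteq> 0" using peval_eq_0_imp[of "g * f"] by auto
  define L where "L = mpoly_hom (\<lambda>a. [:a:]) (\<lambda>k. [:x $ k, y $ k - x $ k:])"
  have L0: "poly (L h) 0 = peval x h" and L1: "poly (L h) 1 = peval y h" for h
    unfolding L_def poly_mpoly_hom by (simp_all add: vec_lambda_eta)
  have L: "L (g * h) = L g * L h" for g h unfolding L_def by (simp add: mpoly_hom_mult ring_hom_pCons)
  have Lf: "degree (L f) \<noteq> 0" 
  proof
    assume "degree (L f) = 0"
    then obtain a where "L f = [:a:]" by (metis degree_eq_zeroE)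
    with L0[of f] L1[of f] y(2) x show False by (simp add: in_X_iff)
  qed
  have fZ: "f \<notin> vanishing_ideal Z" using Z(2) by (auto simp: vanishing_ideal_def in_X_iff)
  \<comment> \<open>An \<open>h\<close> vanishing on \<open>Z\<close> vanishes on \<open>X\<close>,
    so it is a multiple \<open>c * f\<close>; as \<open>f\<close> does not vanish on
    \<open>Z\<close>, primality puts \<open>c\<close> in the ideal of \<open>Z\<close> again, and
    the descent repeats with \<open>c\<close>.\<close>
  have "False" if "h \<in> vanishing_ideal Z" "peval y h \<noteq> 0" for h
    using that
  proof (induction "degree (L h)" arbitrary: h rule: less_induct)
    case less
    have "h \<in> vanishing_ideal X" using less.prems(1) Z(2) by (auto simp: vanishing_ideal_def)
    then obtain c where c: "h = c * f" using vanishing_ideal_multiple by blast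
    then have cZ: "c \<in> vanishing_ideal Z"
      using vanishing_ideal_prime[OF Z(1), of c f] less.prems(1) fZ by auto
    have cy: "peval y c \<noteq> 0" using less.prems(2) c by auto
    then have "L c \<noteq> 0" "L f \<noteq> 0" using L1[of c] L1[of f] y(2) by auto
    then have "degree (L c) < degree (L h)" using Lf by (simp add: c L degree_mult_eq)
    then show False using less.hyps cZ cy by blast
  qed
  with g(1) y(1) show False by blast
qed

lemma codim_eq: "codim X = 1"
  unfolding codim_def
proof (rule Greatest_equality)
  show "\<exists>Z. Z 0 = X \<and> (\<forall>i\<le>1. irreducible_variety (Z i)) \<and> (\<forall>i<1. Z i \<subset> Z (Suc i))"
    using irreducible irreducible_variety_UNIV X_neq_UNIV
    by (intro exI[of _ "\<lambda>i. if i = 0 then X else UNIV"]) auto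
  fix c assume "\<exists>Z. Z 0 = X \<and> (\<forall>i\<le>c. irreducible_variety (Z i)) \<and> (\<forall>i<c. Z i \<subset> Z (Suc i))"
  then obtain Z where Z: "Z 0 = X" "\<And>i. i \<le> c \<Longrightarrow> irreducible_variety (Z i)"
    "\<And>i. i < c \<Longrightarrow> Z i \<subset> Z (Suc i)" by blast
  show "c \<le> 1"
  proof (rule ccontr)
    assume "\<not> c \<le> 1"
    then have "irreducible_variety (Z 1)" "X \<subset> Z 1" "Z 1 \<subset> Z 2"
      using Z(2)[of 1] Z(3)[of 0] Z(3)[of 1] Z(1) by (auto simp: numeral_2_eq_2)
    with no_irreducible_above[of "Z 1"] show False by auto
  qed
qed

lemma span_generators: "ideal.span (set (generators X)) = ideal.span {f}"
  unfolding generators_def vanishing_ideal_eq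
  by (rule someI[of "\<lambda>fs. ideal.span (set fs) = ideal.span {f}" "[f]"]) simp

lemma generator_multiple: "h \<in> set (generators X) \<Longrightarrow> \<exists>g. h = g * f"
  using vanishing_ideal_multiple ideal.span_base[of h "set (generators X)"]
  by (simp add: span_generators vanishing_ideal_eq)

text \<open>By the product rule the derivatives of a multiple of \<open>f\<close> lie in the ideal
  of \<open>f\<close> and its partial derivatives, so the choice of generators does not
  matter.\<close>

lemma sing_ideal_eq: "sing_ideal X = ideal.span ({f} \<union> range (\<lambda>i. pderiv_mpoly i f))"
  (is "_ = ideal.span ?G")
proof
  let ?M = "minors (codim X) (jacobian (generators X))"
  have minors: "?M = {pderiv_mpoly i h | h i. h \<in> set (generators X)}"
  proof -
    have "?M = {r $ i | r i. r \<in> set (jacobian (generators X))}"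
      unfolding codim_eq minors_1 in_set_conv_nth by blast
    also have "\<dots> = {pderiv_mpoly i h | h i. h \<in> set (generators X)}"
      by (force simp: jacobian_def)
    finally show ?thesis .
  qed
  have fG: "f \<in> ideal.span ?G" and dG: "pderiv_mpoly i f \<in> ideal.span ?G" for i
    by (auto intro: ideal.span_base)
  have "vanishing_ideal X \<union> ?M \<subseteq> ideal.span ?G"
  proof
    fix x assume "x \<in> vanishing_ideal X \<union> ?M"
    then show "x \<in> ideal.span ?G"
    proof
      assume "x \<in> vanishing_ideal X"
      then show ?thesis using vanishing_ideal_multiple fG ideal.span_scale by blast
    next
      assume "x \<in> ?M"
      then obtain h i where "h \<in> set (generators X)" and x: "x = pderiv_mpoly i h" by (auto simp: minors)
      then obtain g where "h = g * f" using generator_multiple by blast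
      then show ?thesis using fG dG
        by (simp add: x pderiv_mpoly_mult ideal.span_add ideal.span_scale ideal_span_mult_right)
    qed
  qed
  then show "sing_ideal X \<subseteq> ideal.span ?G"
    unfolding sing_ideal_def by (intro ideal.span_minimal) auto
  let ?K = "ideal.span (vanishing_ideal X \<union> ?M)"
  have fK: "f \<in> ?K" using f_in by (auto intro: ideal.span_base)
  \<comment> \<open>The polynomials that lie in \<open>?K\<close> together with all their
    derivatives form an ideal. It contains the generators and therefore \<open>f\<close>.\<close>
  have "ideal.span (set (generators X)) \<subseteq> {h. h \<in> ?K \<and> (\<forall>i. pderiv_mpoly i h \<in> ?K)}"
  proof (rule ideal_span_minimal)
    show "set (generators X) \<subseteq> {h. h \<in> ?K \<and> (\<forall>i. pderiv_mpoly i h \<in> ?K)}"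
    proof (intro subsetI CollectI conjI allI)
      fix h i assume h: "h \<in> set (generators X)"
      then have "h \<in> vanishing_ideal X" using ideal.span_base[of h "set (generators X)"]
        by (simp add: span_generators vanishing_ideal_eq)
      then show "h \<in> ?K" by (auto intro: ideal.span_base)
      show "pderiv_mpoly i h \<in> ?K" using h unfolding minors by (intro ideal.span_base) blast
    qed
  qed (auto simp: pderiv_mpoly_add pderiv_mpoly_mult intro: ideal.span_zero ideal.span_add
      ideal.span_scale ideal_span_mult_right)
  moreover have "f \<in> ideal.span (set (generators X))" by (simp add: span_generators ideal.span_base)
  ultimately have "?G \<subseteq> ?K" by auto
  then show "ideal.span ?G \<subseteq> sing_ideal X"
    unfolding sing_ideal_def by (intro ideal.span_minimal) auto
qed

lemma zeros_sing_ideal: "zeros (sing_ideal X) = {z \<in> X. grad f z = 0}"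
proof -
  have "zeros (sing_ideal X) = zeros ({f} \<union> range (\<lambda>i. pderiv_mpoly i f))"
    unfolding sing_ideal_eq using zeros_ring_hom_image_span[OF ring_hom_id] by simp
  then show ?thesis by (auto simp: zeros_def in_X_iff vec_eq_iff)
qed

lemma regular_points_eq: "regular_points X = {z \<in> X. grad f z \<noteq> 0}"
  by (auto simp: regular_points_def zeros_sing_ideal)

lemma tangent_space_eq:
  assumes "z \<in> X"
  shows "tangent_space X z = {\<nu>. (\<Sum>k\<in>UNIV. grad f z $ k * \<nu> $ k) = 0}"
proof (intro equalityI subsetI)
  fix \<nu> assume "\<nu> \<in> {\<nu>. (\<Sum>k\<in>UNIV. grad f z $ k * \<nu> $ k) = 0}"
  then have \<nu>: "(\<Sum>k\<in>UNIV. peval z (pderiv_mpoly k f) * \<nu> $ k) = 0" by simp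
  have "(\<Sum>k\<in>UNIV. peval z (pderiv_mpoly k (g * f)) * \<nu> $ k) = 0" for g
  proof -
    have "(\<Sum>k\<in>UNIV. peval z (pderiv_mpoly k (g * f)) * \<nu> $ k) =
        peval z g * (\<Sum>k\<in>UNIV. peval z (pderiv_mpoly k f) * \<nu> $ k)"
      using assms by (simp add: pderiv_mpoly_mult in_X_iff sum_distrib_left mult_ac)
    then show ?thesis by (simp add: \<nu>)
  qed
  then show "\<nu> \<in> tangent_space X z"
    unfolding tangent_space_def using vanishing_ideal_multiple by fastforce
next
  fix \<nu> assume "\<nu> \<in> tangent_space X z"
  then show "\<nu> \<in> {\<nu>. (\<Sum>k\<in>UNIV. grad f z $ k * \<nu> $ k) = 0}"
    using f_in by (auto simp: tangent_space_def)
qed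

text \<open>The Lagrange multiplier condition: a covector that annihilates the kernel of a nonzero
  gradient is a multiple of it.\<close>

lemma critical_points_eq:
  "critical_points X u = {z \<in> X. grad f z \<noteq> 0 \<and> (\<exists>\<mu>. cvec u - cvec z = \<mu> *s grad f z)}"
proof -
  have "(\<forall>\<nu>\<in>tangent_space X z. (\<Sum>k\<in>UNIV. (cnj (u $ k) - cnj (z $ k)) * \<nu> $ k) = 0) \<longleftrightarrow>
      (\<exists>\<mu>. cvec u - cvec z = \<mu> *s grad f z)" if z: "z \<in> X" "grad f z \<noteq> 0" for z
  proof
    assume "\<forall>\<nu>\<in>tangent_space X z. (\<Sum>k\<in>UNIV. (cnj (u $ k) - cnj (z $ k)) * \<nu> $ k) = 0"
    then show "\<exists>\<mu>. cvec u - cvec z = \<mu> *s grad f z"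
      by (intro parallel_if_annihilates[OF z(2)]) (auto simp: tangent_space_eq[OF z(1)])
  next
    assume "\<exists>\<mu>. cvec u - cvec z = \<mu> *s grad f z"
    then obtain \<mu> where \<mu>: "cvec u - cvec z = \<mu> *s grad f z" by blast
    have "cnj (u $ k) - cnj (z $ k) = \<mu> * grad f z $ k" for k
      using arg_cong[OF \<mu>, of "\<lambda>x. x $ k"] by simp
    then show "\<forall>\<nu>\<in>tangent_space X z. (\<Sum>k\<in>UNIV. (cnj (u $ k) - cnj (z $ k)) * \<nu> $ k) = 0"
      by (simp add: tangent_space_eq[OF z(1)] mult.assoc flip: sum_distrib_left)
  qed
  then show ?thesis by (auto simp: critical_points_def regular_points_eq)
qed

lemma extend_z_vanishing_ideal: "extend_z (vanishing_ideal X) = ideal.span {in_z f}"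
proof
  have "in_z ` vanishing_ideal X \<subseteq> ideal.span {in_z f}"
    using vanishing_ideal_multiple
    by (force simp: ring_hom_mult[OF ring_hom_in_z] intro: ideal.span_scale ideal.span_base)
  then show "extend_z (vanishing_ideal X) \<subseteq> ideal.span {in_z f}"
    unfolding extend_z_def by (intro ideal.span_minimal) auto
  show "ideal.span {in_z f} \<subseteq> extend_z (vanishing_ideal X)"
    unfolding extend_z_def using f_in by (intro ideal.span_mono) auto
qed

text \<open>Modulo \<open>f\<close>, each Jacobian row is a multiple of the gradient of
  \<open>f\<close>. Minors with the row \<open>v - w\<close> therefore reduce to
  \<open>hminor\<close>, minors of two Jacobian rows to zero, and the star of this computation
  settles the other half.\<close>

lemma hcrit_sum_ideal_eq: "hcrit_sum_ideal X = ideal.span (hcrit_generators f)"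
proof
  let ?K = "ideal.span (hcrit_generators f)"
  let ?b = "(\<chi> k. Var (Vv k) - Var (Wv k)) :: 'n hvar mpoly ^ 'n"
  let ?row = "\<lambda>h. (\<chi> k. in_z (pderiv_mpoly k h)) :: 'n hvar mpoly ^ 'n"
  define M where "M = ?b # map ?row (generators X)"
  have map: "map (\<lambda>row. \<chi> k. in_z (row $ k)) (jacobian (generators X)) = map ?row (generators X)"
    by (simp add: jacobian_def)
  have minor_ideal: "hcrit_minor_ideal X = ideal.span (minors 2 M)"
    unfolding hcrit_minor_ideal_def codim_eq map M_def by (simp add: numeral_2_eq_2)
  let ?S = "{in_z f} \<union> hminors f"
  have fS: "in_z f \<in> ideal.span ?S" by (auto intro: ideal.span_base)
  have hS: "hminor f i j \<in> ideal.span ?S" for i j by (auto simp: hminors_def intro: ideal.span_base)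
  have fS': "c * in_z f \<in> ideal.span ?S" "in_z f * c \<in> ideal.span ?S" for c
    using fS by (auto intro: ideal.span_scale ideal_span_mult_right)
  have sub: "minors 2 M \<subseteq> ideal.span ?S"
  proof
    fix x assume "x \<in> minors 2 M"
    then obtain i j a b where ij: "i < length M" "j < length M" "i \<noteq> j"
      and x: "x = M ! i $ a * M ! j $ b - M ! i $ b * M ! j $ a" by (auto simp: minors_2)
    have row: "\<exists>g. M ! i = ?row (g * f)" if "i < length M" "i \<noteq> 0" for i
    proof -
      obtain k where k: "i = Suc k" using \<open>i \<noteq> 0\<close> by (cases i) auto
      then have "generators X ! k \<in> set (generators X)" using that(1) by (simp add: M_def)
      then obtain g where "generators X ! k = g * f" using generator_multiple by blast
      then show ?thesis using that(1) k by (intro exI[of _ g]) (simp add: M_def)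
    qed
    have bg: "?b $ a * ?row (g * f) $ b - ?b $ b * ?row (g * f) $ a \<in> ideal.span ?S" for g a b
    proof -
      have "?b $ a * ?row (g * f) $ b - ?b $ b * ?row (g * f) $ a =
          in_z g * hminor f a b +
          (?b $ a * in_z (pderiv_mpoly b g) - ?b $ b * in_z (pderiv_mpoly a g)) * in_z f"
        by (simp add: hminor_def pderiv_mpoly_mult ring_hom_simps[OF ring_hom_in_z] algebra_simps)
      then show ?thesis using fS' hS by (simp add: ideal.span_add ideal.span_scale)
    qed
    consider "i = 0" "j \<noteq> 0" | "i \<noteq> 0" "j = 0" | "i \<noteq> 0" "j \<noteq> 0" using ij by linarith
    then show "x \<in> ideal.span ?S"
    proof cases
      case 1
      then obtain g where "M ! j = ?row (g * f)" using row ij by blast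
      then show ?thesis using bg[of a g b] 1 by (simp add: x M_def)
    next
      case 2
      then obtain g where "M ! i = ?row (g * f)" using row ij by blast
      then show ?thesis using bg[of b g a] 2 by (simp add: x M_def mult.commute)
    next
      case 3
      then obtain g h where gh: "M ! i = ?row (g * f)" "M ! j = ?row (h * f)" using row ij by meson
      \<comment> \<open>The terms without the factor \<open>in_z f\<close> form a minor of two
        multiples of the same gradient and cancel.\<close>
      have "x = (in_z g * in_z (pderiv_mpoly a f) * in_z (pderiv_mpoly b h)
            + in_z (pderiv_mpoly a g) * in_z h * in_z (pderiv_mpoly b f)
            + in_z (pderiv_mpoly a g) * in_z f * in_z (pderiv_mpoly b h)
            - in_z g * in_z (pderiv_mpoly b f) * in_z (pderiv_mpoly a h)
            - in_z (pderiv_mpoly b g) * in_z h * in_z (pderiv_mpoly a f)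
            - in_z (pderiv_mpoly b g) * in_z f * in_z (pderiv_mpoly a h)) * in_z f"
        unfolding x gh
        by (simp add: pderiv_mpoly_mult ring_hom_simps[OF ring_hom_in_z] algebra_simps)
      then show ?thesis using fS' by simp
    qed
  qed
  have SK: "ideal.span ?S \<subseteq> ?K" by (intro ideal.span_mono) (auto simp: hcrit_generators_def)
  have starK: "star x \<in> ?K" if "x \<in> ideal.span ?S" for x
    using that by (rule ring_hom_span_subset[OF ring_hom_star, rotated])
      (auto simp: hcrit_generators_def intro: ideal.span_base)
  have E: "extend_z (vanishing_ideal X) \<subseteq> ideal.span ?S"
    unfolding extend_z_vanishing_ideal by (intro ideal.span_mono) auto
  have H: "hcrit_minor_ideal X \<subseteq> ideal.span ?S"
    unfolding minor_ideal using sub by (intro ideal.span_minimal) auto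
  show "hcrit_sum_ideal X \<subseteq> ?K"
    unfolding hcrit_sum_ideal_def
    by (intro ideal.span_minimal) (use E H SK starK in auto)
  let ?T = "extend_z (vanishing_ideal X) \<union> star ` extend_z (vanishing_ideal X) \<union>
      hcrit_minor_ideal X \<union> star ` hcrit_minor_ideal X"
  let ?T1 = "extend_z (vanishing_ideal X) \<union> hcrit_minor_ideal X"
  \<comment> \<open>Again the polynomials whose image and minors belong to the target form an ideal
    that contains the generators, hence \<open>f\<close>.\<close>
  have "ideal.span (set (generators X)) \<subseteq> {h. in_z h \<in> ideal.span ?T1 \<and>
      (\<forall>i j. hminor h i j \<in> ideal.span ?T1)}"
  proof (rule ideal_span_minimal)
    show "set (generators X) \<subseteq> {h. in_z h \<in> ideal.span ?T1 \<and>
        (\<forall>i j. hminor h i j \<in> ideal.span ?T1)}"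
    proof (intro subsetI CollectI conjI allI)
      fix h i j assume h: "h \<in> set (generators X)"
      then have "h \<in> vanishing_ideal X" using ideal.span_base[of h "set (generators X)"]
        by (simp add: span_generators vanishing_ideal_eq)
      then show "in_z h \<in> ideal.span ?T1" by (auto simp: extend_z_def intro!: ideal.span_base)
      show "hminor h i j \<in> ideal.span ?T1"
      proof (cases "i = j")
        case True
        then show ?thesis by (simp add: hminor_def ideal.span_zero)
      next
        case False
        obtain k where k: "k < length (generators X)" "generators X ! k = h"
          using h by (auto simp: in_set_conv_nth)
        have "hminor h i j = M ! 0 $ i * M ! Suc k $ j - M ! 0 $ j * M ! Suc k $ i"
          using k by (simp add: hminor_def M_def)
        moreover have "0 < length M" "Suc k < length M" using k by (simp_all add: M_def)
        ultimately have "hminor h i j \<in> minors 2 M" unfolding minors_2 using False by blast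
        then show ?thesis unfolding minor_ideal by (auto intro!: ideal.span_base)
      qed
    qed
    fix c h assume h: "h \<in> {h. in_z h \<in> ideal.span ?T1 \<and> (\<forall>i j. hminor h i j \<in> ideal.span ?T1)}"
    have "hminor (c * h) i j = in_z c * hminor h i j +
        (?b $ i * in_z (pderiv_mpoly j c) - ?b $ j * in_z (pderiv_mpoly i c)) * in_z h" for i j
      by (simp add: hminor_def pderiv_mpoly_mult ring_hom_simps[OF ring_hom_in_z] algebra_simps)
    with h show "c * h \<in> {h. in_z h \<in> ideal.span ?T1 \<and> (\<forall>i j. hminor h i j \<in> ideal.span ?T1)}"
      by (auto simp: ring_hom_mult[OF ring_hom_in_z] intro!: ideal.span_add ideal.span_scale)
  next
    fix h k assume "h \<in> {h. in_z h \<in> ideal.span ?T1 \<and> (\<forall>i j. hminor h i j \<in> ideal.span ?T1)}"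
      "k \<in> {h. in_z h \<in> ideal.span ?T1 \<and> (\<forall>i j. hminor h i j \<in> ideal.span ?T1)}"
    moreover have "hminor (h + k) i j = hminor h i j + hminor k i j" for i j
      by (simp add: hminor_def pderiv_mpoly_add ring_hom_simps[OF ring_hom_in_z] algebra_simps)
    ultimately show "h + k \<in> {h. in_z h \<in> ideal.span ?T1 \<and> (\<forall>i j. hminor h i j \<in> ideal.span ?T1)}"
      by (auto simp: ring_hom_add[OF ring_hom_in_z] intro!: ideal.span_add)
  qed (simp add: hminor_def ring_hom_0[OF ring_hom_in_z] ideal.span_zero)
  moreover have "f \<in> ideal.span (set (generators X))" by (simp add: span_generators ideal.span_base)
  ultimately have fT: "in_z f \<in> ideal.span ?T1" "hminor f i j \<in> ideal.span ?T1" for i j by auto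
  have T1T: "ideal.span ?T1 \<subseteq> ideal.span ?T" by (intro ideal.span_mono) auto
  have starT: "star x \<in> ideal.span ?T" if "x \<in> ideal.span ?T1" for x
    using that by (rule ring_hom_span_subset[OF ring_hom_star, rotated]) (auto intro: ideal.span_base)
  show "?K \<subseteq> hcrit_sum_ideal X"
    unfolding hcrit_sum_ideal_def
    by (intro ideal.span_minimal) (use fT T1T starT in \<open>auto simp: hcrit_generators_def hminors_def\<close>)
qed

lemma pair_in_zeros_hcrit_sum:
  "pair z w \<in> zeros (specialize u v ` hcrit_sum_ideal X) \<longleftrightarrow>
    z \<in> X \<and> cvec w \<in> X \<and>
    (\<forall>i j. (v - w) $ i * grad f z $ j = (v - w) $ j * grad f z $ i) \<and>
    (\<forall>i j. (u - z) $ i * cvec (grad f (cvec w)) $ j = (u - z) $ j * cvec (grad f (cvec w)) $ i)"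
proof -
  have cnj: "cnj x = 0 \<longleftrightarrow> x = 0" for x by simp
  have "pair z w \<in> zeros (specialize u v ` hcrit_sum_ideal X) \<longleftrightarrow>
      (\<forall>p\<in>hcrit_generators f. heval z w u v p = 0)"
    unfolding hcrit_sum_ideal_eq zeros_ring_hom_image_span[OF ring_hom_specialize]
    by (simp add: zeros_def peval_specialize)
  also have "\<dots> \<longleftrightarrow> z \<in> X \<and> cvec w \<in> X \<and> (\<forall>i j. heval z w u v (hminor f i j) = 0) \<and>
      (\<forall>i j. heval (cvec w) (cvec z) (cvec v) (cvec u) (hminor f i j) = 0)"
    by (simp add: hcrit_generators_def ball_Un ball_hminors heval_star heval_in_z in_X_iff)
  also have "(\<forall>i j. heval z w u v (hminor f i j) = 0) \<longleftrightarrow>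
      (\<forall>i j. (v - w) $ i * grad f z $ j = (v - w) $ j * grad f z $ i)"
    by (simp only: heval_hminor right_minus_eq)
  also have "(\<forall>i j. heval (cvec w) (cvec z) (cvec v) (cvec u) (hminor f i j) = 0) \<longleftrightarrow>
      (\<forall>i j. cnj (heval (cvec w) (cvec z) (cvec v) (cvec u) (hminor f i j)) = 0)"
    by (simp only: cnj)
  also have "\<dots> \<longleftrightarrow> (\<forall>i j. (u - z) $ i * cvec (grad f (cvec w)) $ j = (u - z) $ j * cvec (grad f (cvec w)) $ i)"
    by (simp add: heval_hminor)
  finally show ?thesis .
qed

text \<open>All products of values vanish only if one of the two factors vanishes on its whole
  ideal, so the removed locus is where \<open>z\<close> or the conjugate of \<open>w\<close> is
  singular.\<close>

lemma pair_in_zeros_hcrit_sing: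
  "pair z w \<in> zeros (specialize u v ` hcrit_sing_ideal X) \<longleftrightarrow>
    z \<in> X \<and> grad f z = 0 \<or> cvec w \<in> X \<and> grad f (cvec w) = 0"
proof -
  let ?E = "extend_z (sing_ideal X)"
  have E: "(\<forall>p\<in>?E. heval z w u v p = 0) \<longleftrightarrow> z \<in> zeros (sing_ideal X)" for z w u v
  proof -
    have "(\<forall>p\<in>?E. heval z w u v p = 0) \<longleftrightarrow> pair z w \<in> zeros (specialize u v ` ?E)"
      by (simp add: zeros_def peval_specialize)
    also have "\<dots> \<longleftrightarrow> z \<in> zeros (sing_ideal X)"
      unfolding extend_z_def zeros_ring_hom_image_span[OF ring_hom_specialize]
      by (simp add: zeros_def peval_specialize heval_in_z)
    finally show ?thesis .
  qed
  have "pair z w \<in> zeros (specialize u v ` hcrit_sing_ideal X) \<longleftrightarrow>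
      (\<forall>p\<in>{a * b |a b. a \<in> ?E \<and> b \<in> star ` ?E}. heval z w u v p = 0)"
    unfolding hcrit_sing_ideal_def ideal_prod_def zeros_ring_hom_image_span[OF ring_hom_specialize]
    by (simp only: zeros_def mem_Collect_eq ball_simps peval_specialize)
  also have "\<dots> \<longleftrightarrow> (\<forall>a\<in>?E. \<forall>b\<in>?E. heval z w u v (a * star b) = 0)" by blast
  also have "\<dots> \<longleftrightarrow> (\<forall>a\<in>?E. \<forall>b\<in>?E. heval z w u v a = 0 \<or> heval z w u v (star b) = 0)"
    by (simp add: ring_hom_mult[OF ring_hom_heval])
  also have "\<dots> \<longleftrightarrow> (\<forall>a\<in>?E. heval z w u v a = 0) \<or>
      (\<forall>b\<in>?E. heval (cvec w) (cvec z) (cvec v) (cvec u) b = 0)"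
    by (auto simp: heval_star)
  finally show ?thesis unfolding E zeros_sing_ideal by simp
qed

lemma subspace_hcrit: "ideal.subspace (specialize u v ` hcrit_sum_ideal X)"
  unfolding hcrit_sum_ideal_eq by (intro subspace_ring_hom_image ring_hom_specialize surj_specialize)

lemma zeros_hermitian_critical_subset:
  "zeros (hermitian_critical_ideal X u v) \<subseteq> zeros (specialize u v ` hcrit_sum_ideal X)"
  using saturation_superset[OF subspace_hcrit]
  unfolding hermitian_critical_ideal_def zeros_def by blast

end

section \<open>Hyperplanes\<close>

definition lin_form :: "complex ^ 'n \<Rightarrow> 'n mpoly" where
  "lin_form a = (\<Sum>k\<in>UNIV. Const (a $ k) * Var k)"

definition hyperplane :: "complex ^ 'n \<Rightarrow> (complex ^ 'n) set" where
  "hyperplane a = {z. (\<Sum>k\<in>UNIV. a $ k * z $ k) = 0}"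

lemma peval_lin_form: "peval z (lin_form a) = (\<Sum>k\<in>UNIV. a $ k * z $ k)"
  by (simp add: lin_form_def)

lemma pderiv_mpoly_sum: "pderiv_mpoly x (\<Sum>i\<in>I. p i) = (\<Sum>i\<in>I. pderiv_mpoly x (p i))"
  by (induction I rule: infinite_finite_induct) (simp_all add: pderiv_mpoly_add)

lemma grad_lin_form: "grad (lin_form a) z = a"
  by (simp add: vec_eq_iff lin_form_def pderiv_mpoly_sum pderiv_mpoly_mult pderiv_mpoly_Var
      if_distrib[of "peval z"] if_distrib[of "\<lambda>x. _ * x"] cong: if_cong)

text \<open>A coordinate with nonzero coefficient is eliminated: the substitution \<open>s\<close>
  maps affine space into the plane, and every polynomial is congruent to its substitution modulo the
  linear form. If it vanishes on the plane, the substitution is zero and the polynomial is a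
  multiple of the form.\<close>

lemma irreducible_hypersurface_hyperplane:
  fixes a :: "complex ^ 'n"
  assumes a: "a \<noteq> 0"
  shows "irreducible_hypersurface (lin_form a) (hyperplane a)"
proof
  show X: "hyperplane a = zeros {lin_form a}"
    by (simp add: hyperplane_def zeros_def peval_lin_form)
  show "lin_form a \<noteq> 0" using a grad_lin_form[of a 0] by (auto simp: vec_eq_iff)
  obtain i where i: "a $ i \<noteq> 0" using a by (auto simp: vec_eq_iff)
  define s where "s = (\<lambda>k. if k = i then - (\<Sum>j\<in>UNIV - {i}. Const (a $ j / a $ i) * Var j) else Var k)"
  let ?S = "mpoly_hom Const s"
  have hom: "ring_hom ?S" by (intro ring_hom_mpoly_hom ring_hom_Const)
  have si: "Var i - s i = Const (1 / a $ i) * lin_form a"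
    by (rule peval_eqI)
      (use i in \<open>simp add: s_def peval_lin_form sum.remove[of UNIV i] sum_distrib_left
        field_simps sum_divide_distrib\<close>)
  have mod: "h - ?S h \<in> ideal.span {lin_form a}" for h
  proof (induction h rule: mpoly_induct)
    case (Const c)
    then show ?case by (simp add: ring_hom_Const ideal.span_zero)
  next
    case (Var k)
    then show ?case
    proof (cases "k = i")
      case True
      then show ?thesis by (simp add: ring_hom_Const si ideal.span_base ideal.span_scale)
    qed (simp add: ring_hom_Const s_def ideal.span_zero)
  next
    case (add p q)
    then have "(p - ?S p) + (q - ?S q) \<in> ideal.span {lin_form a}" by (rule ideal.span_add)
    then show ?case by (simp add: ring_hom_add[OF hom] algebra_simps)
  next
    case (mult p q)
    then have "q * (p - ?S p) + ?S p * (q - ?S q) \<in> ideal.span {lin_form a}"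
      by (intro ideal.span_add ideal.span_scale)
    then show ?case by (simp add: ring_hom_mult[OF hom] algebra_simps)
  qed
  show "vanishing_ideal (hyperplane a) = ideal.span {lin_form a}"
  proof (intro equalityI subsetI)
    fix h assume h: "h \<in> vanishing_ideal (hyperplane a)"
    have "peval z (?S h) = 0" for z
    proof -
      have "peval z (?S h) = peval (\<chi> k. peval z (s k)) h"
        by (induction h rule: mpoly_induct)
          (simp_all add: ring_hom_Const ring_hom_add[OF hom] ring_hom_mult[OF hom])
      moreover have "(\<chi> k. peval z (s k)) \<in> hyperplane a"
        using i by (simp add: hyperplane_def s_def sum.remove[of UNIV i] sum_distrib_left
            sum_negf[symmetric] sum.distrib[symmetric])
      ultimately show ?thesis using h by (simp add: vanishing_ideal_def)
    qed
    then have "?S h = 0" by (rule peval_eq_0_imp)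
    with mod[of h] show "h \<in> ideal.span {lin_form a}" by simp
  next
    fix h assume "h \<in> ideal.span {lin_form a}"
    then show "h \<in> vanishing_ideal (hyperplane a)"
      by (auto simp: ideal.span_singleton vanishing_ideal_def hyperplane_def peval_lin_form)
  qed
  show "irreducible_variety (hyperplane a)"
  proof (rule irreducible_varietyI)
    show "zariski_closed (hyperplane a)" by (simp add: X zariski_closed_zeros)
    have "0 \<in> hyperplane a" by (simp add: hyperplane_def)
    then show "hyperplane a \<noteq> {}" by blast
    fix x y assume xy: "x \<in> hyperplane a" "y \<in> hyperplane a"
    show "\<exists>c. (\<forall>t. (\<chi> k. poly (c k) t) \<in> hyperplane a) \<and>
      (\<exists>t. x = (\<chi> k. poly (c k) t)) \<and> (\<exists>t. y = (\<chi> k. poly (c k) t))"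
    proof (intro exI conjI allI)
      show "x = (\<chi> k. poly [:x $ k, y $ k - x $ k:] 0)"
        and "y = (\<chi> k. poly [:x $ k, y $ k - x $ k:] 1)" by (simp_all add: vec_eq_iff)
      fix t
      have "(\<Sum>k\<in>UNIV. a $ k * poly [:x $ k, y $ k - x $ k:] t) =
          (1 - t) * (\<Sum>k\<in>UNIV. a $ k * x $ k) + t * (\<Sum>k\<in>UNIV. a $ k * y $ k)"
        by (simp add: sum_distrib_left algebra_simps flip: sum.distrib sum_subtractf)
      then show "(\<chi> k. poly [:x $ k, y $ k - x $ k:] t) \<in> hyperplane a"
        using xy by (simp add: hyperplane_def)
    qed
  qed
qed

lemma sum_norm_square_nonzero:
  fixes a :: "complex ^ 'n"
  assumes "a \<noteq> 0" shows "(\<Sum>k\<in>UNIV. a $ k * cnj (a $ k)) \<noteq> 0"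
proof -
  have "(\<Sum>k\<in>UNIV. a $ k * cnj (a $ k)) = of_real (\<Sum>k\<in>UNIV. (cmod (a $ k))\<^sup>2)"
    by (simp only: of_real_sum complex_norm_square)
  moreover have "(\<Sum>k\<in>UNIV. (cmod (a $ k))\<^sup>2) \<noteq> 0"
    using assms by (auto simp: sum_nonneg_eq_0_iff vec_eq_iff)
  ultimately show ?thesis by (simp only: of_real_eq_0_iff not_False_eq_True)
qed

text \<open>The orthogonal projection for the Hermitian product: the plane is cut out by the
  bilinear pairing with \<open>a\<close>, so its Hermitian normal is \<open>cvec a\<close>.\<close>

definition hyperplane_proj :: "complex ^ 'n \<Rightarrow> complex ^ 'n \<Rightarrow> complex ^ 'n" where
  "hyperplane_proj a u = u -
     ((\<Sum>k\<in>UNIV. a $ k * u $ k) / (\<Sum>k\<in>UNIV. a $ k * cnj (a $ k))) *s cvec a"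

lemma hyperplane_proj_iff:
  assumes a: "a \<noteq> 0"
  shows "z \<in> hyperplane a \<and> (\<exists>\<nu>. u - z = \<nu> *s cvec a) \<longleftrightarrow> z = hyperplane_proj a u"
proof -
  let ?n = "\<Sum>k\<in>UNIV. a $ k * cnj (a $ k)"
  have n: "?n \<noteq> 0" using sum_norm_square_nonzero[OF a] .
  have *: "(\<Sum>k\<in>UNIV. a $ k * (u - \<nu> *s cvec a) $ k) = (\<Sum>k\<in>UNIV. a $ k * u $ k) - \<nu> * ?n" for \<nu>
    by (simp add: algebra_simps sum_subtractf sum_distrib_left)
  show ?thesis
  proof
    assume "z \<in> hyperplane a \<and> (\<exists>\<nu>. u - z = \<nu> *s cvec a)"
    then obtain \<nu> where z: "z \<in> hyperplane a" "u - z = \<nu> *s cvec a" by blast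
    then have z_eq: "z = u - \<nu> *s cvec a" by (simp add: algebra_simps)
    then have "\<nu> = (\<Sum>k\<in>UNIV. a $ k * u $ k) / ?n"
      using z(1) n *[of \<nu>] by (simp add: hyperplane_def nonzero_eq_divide_eq)
    then show "z = hyperplane_proj a u" by (simp add: z_eq hyperplane_proj_def)
  next
    let ?c = "(\<Sum>k\<in>UNIV. a $ k * u $ k) / ?n"
    assume "z = hyperplane_proj a u"
    then have z: "z = u - ?c *s cvec a" by (simp add: hyperplane_proj_def)
    have "z \<in> hyperplane a" unfolding hyperplane_def mem_Collect_eq z * using n by simp
    moreover have "u - z = ?c *s cvec a" by (simp add: z)
    ultimately show "z \<in> hyperplane a \<and> (\<exists>\<nu>. u - z = \<nu> *s cvec a)" by blast
  qed
qed

lemma hyperplane_critical_points: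
  assumes a: "a \<noteq> 0"
  shows "critical_points (hyperplane a) u = {hyperplane_proj a u}"
proof -
  interpret irreducible_hypersurface "lin_form a" "hyperplane a"
    by (rule irreducible_hypersurface_hyperplane[OF a])
  have "(\<exists>\<mu>. cvec u - cvec z = \<mu> *s a) \<longleftrightarrow> (\<exists>\<nu>. u - z = \<nu> *s cvec a)" for z
  proof -
    have "cvec u - cvec z = \<mu> *s a \<longleftrightarrow> u - z = cnj \<mu> *s cvec a" for \<mu>
      by (simp add: vec_eq_iff) (metis complex_cnj_cnj complex_cnj_diff complex_cnj_mult)
    then show ?thesis by (metis complex_cnj_cnj)
  qed
  then show ?thesis using a hyperplane_proj_iff[OF a, of _ u]
    by (auto simp: critical_points_eq grad_lin_form)
qed

text \<open>A plane has no singular points, so the saturation keeps all zeros. The starred equations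
  are the projection problem for conjugate data, which gives the second component.\<close>

lemma hyperplane_zeros_hermitian_critical_ideal:
  assumes a: "a \<noteq> 0"
  shows "zeros (hermitian_critical_ideal (hyperplane a) u v) =
    {pair (hyperplane_proj a u) (cvec (hyperplane_proj a (cvec v)))}"
proof -
  interpret irreducible_hypersurface "lin_form a" "hyperplane a"
    by (rule irreducible_hypersurface_hyperplane[OF a])
  have ca: "cvec a \<noteq> 0" using a by (simp add: vec_eq_iff)
  have par: "(\<forall>i j. c $ i * g $ j = c $ j * g $ i) \<longleftrightarrow> (\<exists>\<mu>. c = \<mu> *s g)" if "g \<noteq> 0" for c g :: "complex ^ 'a"
    using parallel_if_minors[OF that, of c] by auto
  have cn: "(\<exists>\<mu>. v - w = \<mu> *s a) \<longleftrightarrow> (\<exists>\<nu>. cvec v - cvec w = \<nu> *s cvec a)" for w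
  proof -
    have "v - w = \<mu> *s a \<longleftrightarrow> cvec v - cvec w = cnj \<mu> *s cvec a" for \<mu>
      by (simp add: vec_eq_iff) (metis complex_cnj_cnj complex_cnj_diff complex_cnj_mult)
    then show ?thesis by (metis complex_cnj_cnj)
  qed
  have "pair z w \<in> zeros (specialize u v ` hcrit_sum_ideal (hyperplane a)) \<longleftrightarrow>
      z = hyperplane_proj a u \<and> cvec w = hyperplane_proj a (cvec v)" for z w
    unfolding pair_in_zeros_hcrit_sum grad_lin_form par[OF a] par[OF ca] cn
    using hyperplane_proj_iff[OF a, of z u] hyperplane_proj_iff[OF a, of "cvec w" "cvec v"] by blast
  moreover have "pair z w \<notin> zeros (specialize u v ` hcrit_sing_ideal (hyperplane a))" for z w
    using a by (simp add: pair_in_zeros_hcrit_sing grad_lin_form)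
  ultimately have iff: "pair z w \<in> zeros (hermitian_critical_ideal (hyperplane a) u v) \<longleftrightarrow>
      z = hyperplane_proj a u \<and> cvec w = hyperplane_proj a (cvec v)" for z w
    using zeros_saturation[of "pair z w"] zeros_hermitian_critical_subset[of u v]
    unfolding hermitian_critical_ideal_def by blast
  have cw: "cvec w = x \<longleftrightarrow> w = cvec x" for w x :: "complex ^ 'a" by auto
  show ?thesis
  proof (intro equalityI subsetI)
    fix x assume x: "x \<in> zeros (hermitian_critical_ideal (hyperplane a) u v)"
    obtain z w where "x = pair z w" using pair_surj by blast
    with x iff[of z w] show "x \<in> {pair (hyperplane_proj a u) (cvec (hyperplane_proj a (cvec v)))}"
      by (simp add: cw)
  qed (simp add: iff)
qed

text \<open>If the count \<open>m\<close> occurs inside every nonempty open set, no other count can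
  be constant on one.\<close>

lemma HDdeg_eqI:
  assumes "\<And>U. open U \<Longrightarrow> U \<noteq> {} \<Longrightarrow> \<exists>u\<in>U. HD_count X u m"
    and "\<And>u. u \<in> V \<Longrightarrow> HD_count X u m" "open V" "V \<noteq> {}"
  shows "HDdeg X = {m}"
proof (intro equalityI subsetI)
  fix n assume "n \<in> HDdeg X"
  then obtain U where "open U" "U \<noteq> {}" "\<forall>u\<in>U. HD_count X u n" by (auto simp: HDdeg_def)
  then obtain u where "HD_count X u n" "HD_count X u m" using assms(1) by blast
  then show "n \<in> {m}" by (simp add: HD_count_def)
qed (use assms in \<open>auto simp: HDdeg_def\<close>)

lemma degrees_hyperplane:
  assumes "a \<noteq> 0"
  shows "vHDdeg (hyperplane a) = 1" "HDdeg (hyperplane a) = {1}"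
proof -
  have comp: "irreducible_components (hyperplane a) = {hyperplane a}"
    by (intro irreducible_components_irreducible
        irreducible_hypersurface.irreducible[OF irreducible_hypersurface_hyperplane] assms)
  have "vHD_count (hyperplane a) u v 1" for u v
    by (simp add: vHD_count_def comp hyperplane_zeros_hermitian_critical_ideal[OF assms])
  then show "vHDdeg (hyperplane a) = 1" by (intro vHDdeg_eqI) (simp del: One_nat_def)
  have "HD_count (hyperplane a) u 1" for u
    by (simp add: HD_count_def comp hyperplane_critical_points[OF assms])
  then show "HDdeg (hyperplane a) = {1}" by (intro HDdeg_eqI[of _ _ UNIV]) auto
qed

lemma degrees_hyperplane_Un:
  fixes a b :: "complex ^ 'n"
  assumes a: "a \<noteq> 0" and b: "b \<noteq> 0"
    and ab: "\<not> hyperplane a \<subseteq> hyperplane b" "\<not> hyperplane b \<subseteq> hyperplane a"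
  shows "vHDdeg (hyperplane a \<union> hyperplane b) = 2" "HDdeg (hyperplane a \<union> hyperplane b) = {2}"
proof -
  let ?X = "hyperplane a \<union> hyperplane b"
  have comp: "irreducible_components ?X = {hyperplane a, hyperplane b}"
    by (intro irreducible_components_Un ab
        irreducible_hypersurface.irreducible[OF irreducible_hypersurface_hyperplane] a b)
  have ne: "hyperplane a \<noteq> hyperplane b" using ab by blast
  have "vHD_count ?X u v 2" for u v
    using ne by (simp add: vHD_count_def comp hyperplane_zeros_hermitian_critical_ideal a b)
  then show "vHDdeg ?X = 2" by (intro vHDdeg_eqI) simp
  have "HD_count ?X u 2" for u
    using ne by (simp add: HD_count_def comp hyperplane_critical_points a b)
  then show "HDdeg ?X = {2}" by (intro HDdeg_eqI[of _ _ UNIV]) auto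
qed

section \<open>Nondegenerate quadrics\<close>

definition qform :: "complex ^ 'n ^ 'n \<Rightarrow> complex ^ 'n \<Rightarrow> complex" where
  "qform A z = (\<Sum>i\<in>UNIV. z $ i * (A *v z) $ i)"

definition quad_poly :: "complex ^ 'n ^ 'n \<Rightarrow> 'n mpoly" where
  "quad_poly A = (\<Sum>i\<in>UNIV. Var i * (\<Sum>j\<in>UNIV. Const (A $ i $ j) * Var j))"

lemma peval_quad_poly: "peval z (quad_poly A) = qform A z"
  by (simp add: quad_poly_def qform_def matrix_vector_mult_def)

lemma qform_scale: "qform A (c *s z) = c\<^sup>2 * qform A z"
  by (simp add: qform_def vector_scalar_commute sum_distrib_left power2_eq_square mult_ac)

lemma grad_quad_poly:
  assumes "transpose A = A"
  shows "grad (quad_poly A) z = 2 *s (A *v z)"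
proof -
  have sym: "A $ i $ j = A $ j $ i" for i j
    using arg_cong[OF assms, of "\<lambda>M. M $ j $ i"] by (simp add: transpose_def)
  have "peval z (pderiv_mpoly k (quad_poly A)) = (\<Sum>i\<in>UNIV. z $ i * A $ i $ k) + (\<Sum>j\<in>UNIV. A $ k $ j * z $ j)" for k
    by (simp add: quad_poly_def pderiv_mpoly_sum pderiv_mpoly_mult pderiv_mpoly_Var sum.distrib
        if_distrib[of "peval z"] if_distrib[of "\<lambda>x. _ * x"] cong: if_cong)
  then show ?thesis
    by (simp add: vec_eq_iff matrix_vector_mult_def sym[of _ "_::'a"] mult.commute)
qed

text \<open>An inverse \<open>B\<close> represents the dual quadric: it vanishes on the normals
  \<open>A *v z\<close> at points of the cone. Hence \<open>qform B v \<noteq> 0\<close> says that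
  \<open>v\<close> is not such a normal.\<close>

lemma qform_inverse:
  assumes "B ** A = mat 1" shows "qform B (A *v z) = qform A z"
  using assms by (simp add: qform_def matrix_vector_mul_assoc mult.commute)

definition crit_pairs :: "complex ^ 'n ^ 'n \<Rightarrow> complex ^ 'n \<Rightarrow> complex ^ 'n \<Rightarrow> ((complex ^ 'n) \<times> (complex ^ 'n)) set" where
  "crit_pairs A u v = {(z, w). z \<noteq> 0 \<and> w \<noteq> 0 \<and> qform A z = 0 \<and> qform A (cvec w) = 0 \<and>
     (\<exists>\<mu>. v - w = \<mu> *s (A *v z)) \<and> (\<exists>\<nu>. u - z = \<nu> *s cvec (A *v cvec w))}"

text \<open>Away from the vertex, the saturation changes nothing. The vertex is removed by
  \<open>(v - w)\<^sup>T A\<^sup>-\<^sup>1 (v - w)\<close>, which lies in the saturated ideal: modulo the minors of \<open>v - w\<close>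
  and \<open>A z\<close>, its product with two entries of \<open>A z\<close> is a multiple of \<open>z\<^sup>T A z\<close>.\<close>

lemma (in irreducible_hypersurface) zeros_hermitian_critical_ideal_quadric:
  fixes A B :: "complex ^ 'n ^ 'n"
  assumes f: "f = quad_poly A" and sym: "transpose A = A" and B: "B ** A = mat 1"
    and u: "qform B (cvec u) \<noteq> 0" and v: "qform B v \<noteq> 0"
  shows "zeros (hermitian_critical_ideal X u v) = (\<lambda>(z, w). pair z w) ` crit_pairs A u v"
proof -
  let ?\<phi> = "specialize u v"
  let ?I = "?\<phi> ` hcrit_sum_ideal X"
  note I = subspace_hcrit[of u v]
  note Icl = ideal.subspace_0[OF I] ideal.subspace_add[OF I] ideal.subspace_scale[OF I]
    ideal.subspace_diff[OF I] ideal.subspace_sum[OF I]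
  have Icl': "x \<in> ?I \<Longrightarrow> x * c \<in> ?I" for x c using Icl(3)[of x c] by (simp add: mult.commute)
  note hom = ring_hom_specialize[of u v] ring_hom_in_z
  note grad = grad_quad_poly[OF sym]
  define F where "F = ?\<phi> (in_z f)"
  \<comment> \<open>\<open>a\<close> and \<open>b\<close> are the entries of A z and v - w as
    polynomials, \<open>m\<close> their minors without the factor 2 of the gradient, and
    \<open>G\<close> is (v - w)^T B (v - w).\<close>
  define a where "a = (\<lambda>k. \<Sum>j\<in>UNIV. Const (A $ k $ j) * Var (Inl j) :: ('n + 'n) mpoly)"
  define b where "b = (\<lambda>k. Const (v $ k) - Var (Inr k) :: ('n + 'n) mpoly)"
  define m where "m = (\<lambda>i k. b i * a k - b k * a i)"
  define G where "G = (\<Sum>i\<in>UNIV. \<Sum>j\<in>UNIV. Const (B $ i $ j) * b i * b j)"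
  have eq_pair: "p = q" if "\<And>z w. peval (pair z w) p = peval (pair z w) q" for p q :: "('n + 'n) mpoly"
  proof (rule peval_eqI)
    fix x
    obtain z w :: "complex ^ 'n" where "x = pair z w" using pair_surj by blast
    with that show "peval x p = peval x q" by simp
  qed
  have pa: "peval (pair z w) (a k) = (A *v z) $ k" for z w k
    by (simp add: a_def matrix_vector_mult_def)
  have pb: "peval (pair z w) (b k) = (v - w) $ k" for z w k by (simp add: b_def)
  have da: "?\<phi> (in_z (pderiv_mpoly k f)) = Const 2 * a k" for k
    using arg_cong[OF grad, of "\<lambda>x. x $ k"]
    by (intro eq_pair) (simp add: peval_specialize heval_in_z pa f)
  have FI: "F \<in> ?I" unfolding F_def hcrit_sum_ideal_eq
    by (auto simp: hcrit_generators_def intro!: imageI ideal.span_base)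
  have mI: "m i k \<in> ?I" for i k
  proof -
    have "?\<phi> (hminor f i k) \<in> ?I" unfolding hcrit_sum_ideal_eq
      by (auto simp: hcrit_generators_def hminors_def intro!: imageI ideal.span_base)
    then have "Const (1 / 2) * ?\<phi> (hminor f i k) \<in> ?I" by (rule Icl(3))
    also have "Const (1 / 2) * ?\<phi> (hminor f i k) = m i k"
    proof -
      have half: "Const (1 / 2) * Const 2 = (1 :: ('n + 'n) mpoly)"
        by (simp add: ring_hom_mult[OF ring_hom_Const, symmetric] ring_hom_1[OF ring_hom_Const])
      have "Const (1 / 2) * (x * (Const 2 * y)) = x * y" for x y :: "('n + 'n) mpoly"
      proof -
        have "Const (1 / 2) * (x * (Const 2 * y)) = (Const (1 / 2) * Const 2) * (x * y)"
          by (simp only: mult_ac)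
        then show ?thesis by (simp only: half mult_1)
      qed
      then show ?thesis
        by (simp add: hminor_def ring_hom_simps[OF hom(1)] da m_def b_def right_diff_distrib)
    qed
    finally show ?thesis .
  qed
  have GI: "G * a k * a l \<in> ?I" for k l
  proof -
    \<comment> \<open>Modulo the minors the indices of \<open>a\<close> and \<open>b\<close> may be
      exchanged. Then \<open>a i * a j\<close> appears, and its sum against the entries of
      \<open>B\<close> is the equation of the cone.\<close>
    have "b i * b j * a k * a l - b k * b l * (a i * a j) = m i k * (b j * a l) + b k * a i * m j l" for i j
      by (simp add: m_def algebra_simps)
    then have *: "Const (B $ i $ j) * (b i * b j * a k * a l - b k * b l * (a i * a j)) \<in> ?I" for i j
      by (simp only:) (intro Icl(2,3) Icl' mI)
    have "F = (\<Sum>i\<in>UNIV. \<Sum>j\<in>UNIV. Const (B $ i $ j) * (a i * a j))"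
    proof (rule eq_pair)
      fix z w
      have "peval (pair z w) (\<Sum>i\<in>UNIV. \<Sum>j\<in>UNIV. Const (B $ i $ j) * (a i * a j)) = qform B (A *v z)"
        by (simp add: pa qform_def matrix_vector_mult_def[of B] sum_distrib_left mult_ac)
      then show "peval (pair z w) F = peval (pair z w) (\<Sum>i\<in>UNIV. \<Sum>j\<in>UNIV. Const (B $ i $ j) * (a i * a j))"
        by (simp only: qform_inverse[OF B] F_def peval_specialize heval_in_z f peval_quad_poly)
    qed
    then have "G * a k * a l = (\<Sum>i\<in>UNIV. \<Sum>j\<in>UNIV. Const (B $ i $ j) *
        (b i * b j * a k * a l - b k * b l * (a i * a j))) + b k * b l * F"
      by (simp add: G_def sum_distrib_left sum_distrib_right sum_subtractf right_diff_distrib mult_ac)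
    then show ?thesis using * FI by (simp only:) (intro Icl(2,3,5) *)
  qed
  define M where "M = ideal.span ({F} \<union> range a)"
  have GM: "G * x * y \<in> ?I" if "x \<in> M" "y \<in> M" for x y
  proof -
    have "M \<subseteq> {y. G * a k * y \<in> ?I}" for k
      unfolding M_def
    proof (rule ideal_span_minimal)
      show "{F} \<union> range a \<subseteq> {y. G * a k * y \<in> ?I}" using GI FI Icl(3) by auto
      fix c y assume "y \<in> {y. G * a k * y \<in> ?I}"
      then have "c * (G * a k * y) \<in> ?I" using Icl(3) by blast
      then show "c * y \<in> {y. G * a k * y \<in> ?I}" by (simp add: mult_ac)
    qed (use Icl in \<open>auto simp: distrib_left\<close>)
    then have ak: "G * a k * y \<in> ?I" for k using that(2) by blast
    have "M \<subseteq> {x. G * x * y \<in> ?I}"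
      unfolding M_def
    proof (rule ideal_span_minimal)
      have "G * F * y \<in> ?I" by (intro Icl' Icl(3) FI)
      then show "{F} \<union> range a \<subseteq> {x. G * x * y \<in> ?I}" using ak by auto
      fix c x assume "x \<in> {x. G * x * y \<in> ?I}"
      then have "c * (G * x * y) \<in> ?I" using Icl(3) by blast
      then show "c * x \<in> {x. G * x * y \<in> ?I}" by (simp add: mult_ac)
    qed (use Icl in \<open>auto simp: distrib_left distrib_right\<close>)
    with that(1) show ?thesis by blast
  qed
  have sing_M: "?\<phi> (in_z s) \<in> M" if "s \<in> sing_ideal X" for s
    using that unfolding sing_ideal_eq M_def
  proof (rule ring_hom_span_subset[OF ring_hom_comp[OF hom], rotated])
    fix s assume "s \<in> {f} \<union> range (\<lambda>i. pderiv_mpoly i f)"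
    then show "?\<phi> (in_z s) \<in> ideal.span ({F} \<union> range a)"
    proof
      assume "s \<in> {f}"
      then show ?thesis by (simp add: F_def ideal.span_base)
    next
      assume "s \<in> range (\<lambda>i. pderiv_mpoly i f)"
      then obtain i where "s = pderiv_mpoly i f" by blast
      then show ?thesis by (simp only: da) (intro ideal.span_scale ideal.span_base, blast)
    qed
  qed
  have ext_M: "?\<phi> x \<in> M" if "x \<in> extend_z (sing_ideal X)" for x
    using that unfolding extend_z_def M_def
    by (rule ring_hom_span_subset[OF hom(1), rotated]) (use sing_M in \<open>auto simp: M_def\<close>)
  have J_M: "?\<phi> x \<in> M" if "x \<in> hcrit_sing_ideal X" for x
    using that unfolding hcrit_sing_ideal_def ideal_prod_def M_def
  proof (rule ring_hom_span_subset[OF hom(1), rotated])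
    fix x assume "x \<in> {a * b |a b. a \<in> extend_z (sing_ideal X) \<and> b \<in> star ` extend_z (sing_ideal X)}"
    then obtain a' b' where a': "a' \<in> extend_z (sing_ideal X)" and x: "x = a' * b'" by blast
    show "?\<phi> x \<in> ideal.span ({F} \<union> range a)"
      unfolding x ring_hom_mult[OF hom(1)] M_def[symmetric]
      using ext_M[OF a'] unfolding M_def by (rule ideal_span_mult_right)
  qed
  have G_sat: "G \<in> hermitian_critical_ideal X u v"
    unfolding hermitian_critical_ideal_def using J_M GM by (intro in_saturationI[OF I]) auto
  have inj: "A *v x = 0 \<longleftrightarrow> x = 0" for x
  proof
    assume "A *v x = 0"
    then have "B *v (A *v x) = 0" by simp
    then show "x = 0" by (simp add: matrix_vector_mul_assoc B)
  qed simp
  have cz: "cvec x = 0 \<longleftrightarrow> x = 0" for x :: "complex ^ 'n" by (simp add: vec_eq_iff)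
  have gz: "grad f x = 0 \<longleftrightarrow> x = 0" for x unfolding f grad by (simp add: inj)
  have Xq: "x \<in> X \<longleftrightarrow> qform A x = 0" for x by (simp add: in_X_iff f peval_quad_poly)
  have par: "(\<forall>i j. c $ i * g $ j = c $ j * g $ i) \<longleftrightarrow> (\<exists>\<mu>. c = \<mu> *s y)"
    if "g = 2 *s y" "y \<noteq> 0" for c g y :: "complex ^ 'n"
  proof -
    have "g \<noteq> 0" using that by simp
    from parallel_if_minors[OF this, of c] show ?thesis
      unfolding that(1) by (auto simp: vector_smult_assoc)
  qed
  have gv: "grad f z = 2 *s (A *v z)" "cvec (grad f (cvec w)) = 2 *s cvec (A *v cvec w)" for z w
    unfolding f grad by (simp_all add: vec_eq_iff)
  have main: "pair z w \<in> zeros (hermitian_critical_ideal X u v) \<longleftrightarrow> (z, w) \<in> crit_pairs A u v" for z w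
  proof (cases "z \<noteq> 0 \<and> w \<noteq> 0")
    case True
    then have nz: "A *v z \<noteq> 0" "cvec (A *v cvec w) \<noteq> 0" by (simp_all add: inj cz)
    have "pair z w \<in> zeros ?I \<longleftrightarrow> (z, w) \<in> crit_pairs A u v"
      unfolding pair_in_zeros_hcrit_sum Xq par[OF gv(1) nz(1)] par[OF gv(2) nz(2)]
      using True by (auto simp: crit_pairs_def)
    moreover have "pair z w \<notin> zeros (?\<phi> ` hcrit_sing_ideal X)"
      using True by (simp add: pair_in_zeros_hcrit_sing gz cz)
    ultimately show ?thesis
      using zeros_saturation[of "pair z w"] zeros_hermitian_critical_subset[of u v]
      unfolding hermitian_critical_ideal_def by blast
  next
    case False
    \<comment> \<open>If only one of \<open>z\<close>, \<open>w\<close> is zero, then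
      \<open>u\<close> or \<open>v\<close> is a multiple of a normal of the cone (for
      \<open>w\<close>, after conjugation), against the assumptions on \<open>B\<close>. If both are
      zero, \<open>G\<close> takes the value \<open>qform B v\<close>, which is nonzero.\<close>
    have "pair z w \<notin> zeros (hermitian_critical_ideal X u v)"
    proof
      assume zw: "pair z w \<in> zeros (hermitian_critical_ideal X u v)"
      have "peval (pair z w) G = 0" using zw G_sat by (auto simp: zeros_def)
      moreover have "peval (pair z w) G = qform B (v - w)"
        by (simp add: G_def pb qform_def matrix_vector_mult_def sum_distrib_left mult_ac)
      ultimately have Gw: "qform B (v - w) = 0" by simp
      have zI: "pair z w \<in> zeros ?I" using zw zeros_hermitian_critical_subset by blast
      have "w = 0"
      proof (rule ccontr)
        assume w: "w \<noteq> 0"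
        with False have "z = 0" by simp
        have nz: "cvec (A *v cvec w) \<noteq> 0" using w by (simp add: inj cz)
        have "qform A (cvec w) = 0" "\<exists>\<nu>. u - z = \<nu> *s cvec (A *v cvec w)"
          using zI unfolding pair_in_zeros_hcrit_sum Xq par[OF gv(2) nz] by blast+
        then obtain \<nu> where \<nu>: "u = \<nu> *s cvec (A *v cvec w)" using \<open>z = 0\<close> by auto
        have "cvec u = cnj \<nu> *s (A *v cvec w)" by (simp add: \<nu> vec_eq_iff)
        then have "qform B (cvec u) = (cnj \<nu>)\<^sup>2 * qform A (cvec w)"
          by (simp add: qform_scale qform_inverse[OF B])
        with u \<open>qform A (cvec w) = 0\<close> show False by simp
      qed
      moreover have "z = 0"
      proof (rule ccontr)
        assume z: "z \<noteq> 0"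
        then have nz: "A *v z \<noteq> 0" by (simp add: inj)
        have "qform A z = 0" "\<exists>\<mu>. v - w = \<mu> *s (A *v z)"
          using zI unfolding pair_in_zeros_hcrit_sum Xq par[OF gv(1) nz] by blast+
        then obtain \<mu> where "v = \<mu> *s (A *v z)" using \<open>w = 0\<close> by auto
        then have "qform B v = \<mu>\<^sup>2 * qform A z" by (simp add: qform_scale qform_inverse[OF B])
        with v \<open>qform A z = 0\<close> show False by simp
      qed
      ultimately show False using Gw v by simp
    qed
    with False show ?thesis by (auto simp: crit_pairs_def)
  qed
  show ?thesis
  proof (intro equalityI subsetI)
    fix x assume x: "x \<in> zeros (hermitian_critical_ideal X u v)"
    obtain z w where "x = pair z w" using pair_surj by blast
    with x main[of z w] show "x \<in> (\<lambda>(z, w). pair z w) ` crit_pairs A u v" by force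
  qed (auto simp: main)
qed

lemma (in irreducible_hypersurface) critical_points_quadric:
  fixes A B :: "complex ^ 'n ^ 'n"
  assumes f: "f = quad_poly A" and sym: "transpose A = A" and B: "B ** A = mat 1"
  shows "critical_points X u =
    {z. z \<noteq> 0 \<and> qform A z = 0 \<and> (\<exists>\<mu>. cvec u - cvec z = \<mu> *s (A *v z))}"
proof -
  have inj: "A *v x = 0 \<longleftrightarrow> x = 0" for x
  proof
    assume "A *v x = 0"
    then have "B *v (A *v x) = 0" by simp
    then show "x = 0" by (simp add: matrix_vector_mul_assoc B)
  qed simp
  have "(\<exists>\<mu>. c = \<mu> *s (2 *s y)) \<longleftrightarrow> (\<exists>\<mu>. c = \<mu> *s y)" for c y :: "complex ^ 'n"
    by (metis vector_smult_assoc mult.commute nonzero_mult_div_cancel_left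
        times_divide_eq_left zero_neq_numeral)
  then show ?thesis
    by (simp add: critical_points_eq f grad_quad_poly[OF sym] in_X_iff peval_quad_poly inj conj_comms
        cong: conj_cong)
qed

section \<open>Nondegenerate conics are irreducible hypersurfaces\<close>

definition linear_subst :: "complex ^ 'n ^ 'n \<Rightarrow> 'n mpoly \<Rightarrow> 'n mpoly" where
  "linear_subst L = mpoly_hom Const (\<lambda>k. \<Sum>j\<in>UNIV. Const (L $ k $ j) * Var j)"

lemma ring_hom_linear_subst: "ring_hom (linear_subst L)"
  unfolding linear_subst_def by (intro ring_hom_mpoly_hom ring_hom_Const)

lemma peval_linear_subst: "peval z (linear_subst L p) = peval (L *v z) p"
proof (induction p rule: mpoly_induct)
  case (Const a)
  show ?case by (simp add: linear_subst_def ring_hom_Const)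
next
  case (Var x)
  show ?case by (simp add: linear_subst_def ring_hom_Const matrix_vector_mult_def)
qed (simp_all add: ring_hom_simps[OF ring_hom_linear_subst])

lemma distinct_3 [simp]: "(1::3) \<noteq> 2" "(1::3) \<noteq> 3" "(2::3) \<noteq> 3" "(2::3) \<noteq> 1" "(3::3) \<noteq> 1" "(3::3) \<noteq> 2"
  by simp_all

text \<open>Every polynomial is congruent to one of degree at most one in the first variable; such a
  polynomial vanishing on the cone has two coefficients that vanish wherever the quadratic equation
  for the first variable has two distinct solutions.\<close>

lemma vanishing_ideal_diagonal_conic:
  fixes \<sigma> :: "3 \<Rightarrow> complex" and F h :: "3 mpoly"
  assumes \<sigma>: "\<And>k. \<sigma> k \<noteq> 0" and F: "\<And>x. peval x F = (\<Sum>k\<in>UNIV. \<sigma> k * (x $ k)\<^sup>2)"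
    and h: "\<And>x. peval x F = 0 \<Longrightarrow> peval x h = 0"
  shows "\<exists>c. h = c * F"
proof -
  \<comment> \<open>\<open>E\<close> sets the first variable to zero, so \<open>E r = r\<close>
    expresses that \<open>r\<close> is free of it.\<close>
  define E where "E = mpoly_hom Const (\<lambda>k. if k = 1 then 0 else Var k :: 3 mpoly)"
  have E: "ring_hom E" unfolding E_def by (intro ring_hom_mpoly_hom ring_hom_Const)
  note Es = ring_hom_simps[OF E]
  have EC: "E (Const a) = Const a" for a by (simp add: E_def ring_hom_Const)
  have EV: "E (Var k) = (if k = 1 then 0 else Var k)" for k by (simp add: E_def ring_hom_Const)
  define R where "R = Const (- (\<sigma> 2 / \<sigma> 1)) * (Var 2)\<^sup>2 + Const (- (\<sigma> 3 / \<sigma> 1)) * (Var (3::3))\<^sup>2"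
  have ER: "E R = R" by (simp add: R_def Es EC EV)
  have sq: "Var 1 * Var 1 = Const (1 / \<sigma> 1) * F + R"
    by (rule peval_eqI) (use \<sigma>[of 1] in \<open>simp add: F R_def sum_3 field_simps power2_eq_square\<close>)
  have nf: "\<exists>r s c. h = r + Var 1 * s + c * F \<and> E r = r \<and> E s = s" for h
  proof (induction h rule: mpoly_induct)
    case (Const a)
    show ?case by (intro exI[of _ "Const a"] exI[of _ 0]) (simp add: EC Es)
  next
    case (Var k)
    show ?case
    proof (cases "k = 1")
      case True
      then show ?thesis by (intro exI[of _ 0] exI[of _ 1] exI[of _ 0]) (simp add: Es)
    next
      case False
      then show ?thesis by (intro exI[of _ "Var k"] exI[of _ 0] exI[of _ 0]) (simp add: Es EV)
    qed
  next
    case (add p q)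
    then obtain r s c r' s' c' where "p = r + Var 1 * s + c * F" "E r = r" "E s = s"
      "q = r' + Var 1 * s' + c' * F" "E r' = r'" "E s' = s'" by blast
    then show ?case
      by (intro exI[of _ "r + r'"] exI[of _ "s + s'"] exI[of _ "c + c'"]) (simp add: Es algebra_simps)
  next
    case (mult p q)
    then obtain r s c r' s' c' where p: "p = r + Var 1 * s + c * F" "E r = r" "E s = s"
      and q: "q = r' + Var 1 * s' + c' * F" "E r' = r'" "E s' = s'" by blast
    have "p * q = r * r' + Var 1 * (r * s' + s * r') + (Var 1 * Var 1) * (s * s') +
        (c * q + c' * (r + Var 1 * s)) * F"
      by (simp add: p(1) q(1) algebra_simps)
    also have "\<dots> = (r * r' + R * (s * s')) + Var 1 * (r * s' + s * r') +
        (c * q + c' * (r + Var 1 * s) + Const (1 / \<sigma> 1) * (s * s')) * F"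
      unfolding sq by (simp add: algebra_simps)
    finally show ?case using p(2,3) q(2,3) ER
      by (intro exI[of _ "r * r' + R * (s * s')"] exI[of _ "r * s' + s * r'"]
          exI[of _ "c * q + c' * (r + Var 1 * s) + Const (1 / \<sigma> 1) * (s * s')"]) (simp add: Es)
  qed
  obtain r s c where h_eq: "h = r + Var 1 * s + c * F" and rs: "E r = r" "E s = s" using nf by blast
  have indep: "peval x p = peval y p" if "E p = p" "x $ 2 = y $ 2" "x $ 3 = y $ 3" for p x y
  proof -
    have "peval x (E p) = peval y (E p)"
    proof (induction p rule: mpoly_induct)
      case (Var k)
      show ?case using that exhaust_3[of k] by (auto simp: EV)
    qed (simp_all add: Es EC)
    then show ?thesis by (simp add: that(1))
  qed
  \<comment> \<open>Where \<open>R\<close> is nonzero its two square roots give r + \<rho> s = r -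
    \<rho> s = 0; where \<open>R\<close> is zero the products vanish anyway. So \<open>R * r\<close>
    and \<open>R * s\<close> vanish everywhere and \<open>R\<close> can be cancelled.\<close>
  have zero: "peval x (R * r) = 0 \<and> peval x (R * s) = 0" for x
  proof (cases "peval x R = 0")
    case False
    define \<rho> where "\<rho> = csqrt (peval x R)"
    have \<rho>: "\<rho>\<^sup>2 = peval x R" "\<rho> \<noteq> 0" using False by (simp_all add: \<rho>_def)
    have "peval x r + \<epsilon> * peval x s = 0" if "\<epsilon>\<^sup>2 = peval x R" for \<epsilon>
    proof -
      let ?y = "vector [\<epsilon>, x $ 2, x $ 3] :: complex ^ 3"
      have "peval ?y F = 0"
      proof -
        have "\<sigma> 1 * \<epsilon>\<^sup>2 = - (\<sigma> 2 * (x $ 2)\<^sup>2) - \<sigma> 3 * (x $ 3)\<^sup>2"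
          using that \<sigma>[of 1] by (simp add: R_def field_simps)
        then show ?thesis by (simp add: F sum_3)
      qed
      then have "peval ?y r + \<epsilon> * peval ?y s = 0" using h[of ?y] by (simp add: h_eq)
      moreover have "peval ?y r = peval x r" "peval ?y s = peval x s"
        by (rule indep[OF rs(1)], simp, simp, rule indep[OF rs(2)], simp, simp)
      ultimately show ?thesis by simp
    qed
    from this[of \<rho>] this[of "- \<rho>"] \<rho> have *: "peval x r + \<rho> * peval x s = 0" "peval x r - \<rho> * peval x s = 0"
      by simp_all
    then have "2 * (\<rho> * peval x s) = 0" by algebra
    with * \<rho>(2) show ?thesis by simp
  qed simp
  have "R \<noteq> 0"
  proof
    assume "R = 0"
    then have "peval (vector [0, 1, 0] :: complex ^ 3) R = 0" by simp
    then show False using \<sigma>[of 1] \<sigma>[of 2] by (simp add: R_def)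
  qed
  moreover have "R * r = 0" "R * s = 0" using zero by (blast intro: peval_eq_0_imp)+
  ultimately have "r = 0" "s = 0" by (simp_all add: mpoly_mult_eq_0_iff)
  then show ?thesis using h_eq by auto
qed

text \<open>With \<open>P = isotropic a b\<close>, the factors of \<open>P\<^sub>1\<^sup>2 + P\<^sub>2\<^sup>2 = - P\<^sub>3\<^sup>2\<close> are \<open>P\<^sub>1 + \<i> P\<^sub>2 = a\<^sup>2\<close> and
  \<open>P\<^sub>1 - \<i> P\<^sub>2 = - b\<^sup>2\<close>.\<close>

definition isotropic :: "complex \<Rightarrow> complex \<Rightarrow> complex ^ 3" where
  "isotropic a b = vector [(a\<^sup>2 - b\<^sup>2) / 2, (a\<^sup>2 + b\<^sup>2) / (2 * \<i>), a * b]"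

lemma isotropic_nth [simp]: "isotropic a b $ 1 = (a\<^sup>2 - b\<^sup>2) / 2"
  "isotropic a b $ 2 = (a\<^sup>2 + b\<^sup>2) / (2 * \<i>)" "isotropic a b $ 3 = a * b"
  by (simp_all add: isotropic_def)

lemma isotropic_surj:
  assumes "(\<Sum>k\<in>UNIV. (P $ k)\<^sup>2) = (0::complex)"
  shows "\<exists>a b. P = isotropic a b"
proof -
  define a where "a = csqrt (P $ 1 + \<i> * P $ 2)"
  define c where "c = csqrt (- (P $ 1 - \<i> * P $ 2))"
  have a2: "a\<^sup>2 = P $ 1 + \<i> * P $ 2" and c2: "c\<^sup>2 = - (P $ 1 - \<i> * P $ 2)"
    by (simp_all add: a_def c_def)
  have "(a * c)\<^sup>2 = (P $ 3)\<^sup>2"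
  proof -
    have "(a * c)\<^sup>2 = (P $ 1 + \<i> * P $ 2) * - (P $ 1 - \<i> * P $ 2)"
      by (simp only: power_mult_distrib a2 c2)
    also have "\<dots> = - ((P $ 1)\<^sup>2 + (P $ 2)\<^sup>2)"
      by (simp add: algebra_simps power2_eq_square)
    also have "\<dots> = (P $ 3)\<^sup>2"
      using assms by (simp only: sum_3) (metis add_eq_0_iff minus_minus)
    finally show ?thesis .
  qed
  \<comment> \<open>The square roots fix the product \<open>a * c\<close> only up to sign; the sign
    is absorbed into the second parameter.\<close>
  then have "P $ 3 = a * c \<or> P $ 3 = a * - c" by (auto simp: power2_eq_iff)
  then obtain b where b: "P $ 3 = a * b" "b\<^sup>2 = c\<^sup>2" by (metis power2_minus)
  have "P = isotropic a b"
    by (simp add: vec_eq_iff forall_3 a2 b c2 field_simps)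
  then show ?thesis by blast
qed

text \<open>The principal vanishing ideal is transported from diagonal coordinates. For
  irreducibility, \<open>par\<close> composes \<open>isotropic\<close> with the coordinate change,
  and the segment between two parameter pairs becomes a polynomial curve on the cone.\<close>

lemma irreducible_hypersurface_conic:
  fixes A U V :: "complex ^ 3 ^ 3" and \<sigma> :: "3 \<Rightarrow> complex"
  assumes \<sigma>: "\<And>k. \<sigma> k \<noteq> 0" and UV: "U ** V = mat 1" "V ** U = mat 1"
    and diag: "\<And>x. qform A (U *v x) = (\<Sum>k\<in>UNIV. \<sigma> k * (x $ k)\<^sup>2)"
  shows "irreducible_hypersurface (quad_poly A) {z. qform A z = 0}"
proof
  let ?X = "{z. qform A z = 0}"
  show X: "?X = zeros {quad_poly A}" by (simp add: zeros_def peval_quad_poly)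
  have UVx: "U *v (V *v x) = x" for x
    by (simp add: matrix_vector_mul_assoc UV)
  have F: "peval x (linear_subst U (quad_poly A)) = (\<Sum>k\<in>UNIV. \<sigma> k * (x $ k)\<^sup>2)" for x
    by (simp add: peval_linear_subst peval_quad_poly diag)
  have VU: "linear_subst V (linear_subst U p) = p" for p
    by (rule peval_eqI) (simp add: peval_linear_subst UVx)
  show "quad_poly A \<noteq> 0"
  proof
    assume "quad_poly A = 0"
    then have "qform A (U *v vector [1, 0, 0]) = 0" by (metis peval_quad_poly peval_simps(1))
    then show False using \<sigma>[of 1] by (simp add: diag sum_3)
  qed
  show "vanishing_ideal ?X = ideal.span {quad_poly A}"
  proof (intro equalityI subsetI)
    fix h assume h: "h \<in> vanishing_ideal ?X"
    have "peval x (linear_subst U h) = 0" if "peval x (linear_subst U (quad_poly A)) = 0" for x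
      using that h by (simp add: peval_linear_subst peval_quad_poly vanishing_ideal_def)
    then obtain c where "linear_subst U h = c * linear_subst U (quad_poly A)"
      using vanishing_ideal_diagonal_conic[OF \<sigma> F] by blast
    then have "linear_subst V (linear_subst U h) = linear_subst V (c * linear_subst U (quad_poly A))"
      by simp
    then have "h = linear_subst V c * quad_poly A"
      by (simp add: VU ring_hom_mult[OF ring_hom_linear_subst])
    then show "h \<in> ideal.span {quad_poly A}" by (simp add: ideal.span_base ideal.span_scale)
  next
    fix h assume "h \<in> ideal.span {quad_poly A}"
    then show "h \<in> vanishing_ideal ?X"
      by (auto simp: ideal.span_singleton vanishing_ideal_def peval_quad_poly)
  qed
  define par where "par = (\<lambda>a b. U *v (\<chi> k. isotropic a b $ k / csqrt (\<sigma> k)))"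
  have par_X: "par a b \<in> ?X" for a b
    using \<sigma> by (simp add: par_def diag sum_3 power_divide) (simp add: field_simps power2_eq_square)
  have par_surj: "\<exists>a b. z = par a b" if "z \<in> ?X" for z
  proof -
    let ?P = "\<chi> k. csqrt (\<sigma> k) * (V *v z) $ k"
    have "(\<Sum>k\<in>UNIV. (?P $ k)\<^sup>2) = qform A (U *v (V *v z))"
      by (simp only: diag) (simp add: power_mult_distrib)
    then have "(\<Sum>k\<in>UNIV. (?P $ k)\<^sup>2) = 0" using that by (simp add: UVx)
    then obtain a b where ab: "?P = isotropic a b" using isotropic_surj by blast
    have "V *v z = (\<chi> k. isotropic a b $ k / csqrt (\<sigma> k))"
      using \<sigma> by (simp add: vec_eq_iff ab[symmetric])
    then have "z = par a b" unfolding par_def by (metis UVx)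
    then show ?thesis by blast
  qed
  show "irreducible_variety ?X"
  proof (rule irreducible_varietyI)
    show "zariski_closed ?X" by (simp add: X zariski_closed_zeros)
    show "?X \<noteq> {}" using par_X by blast
    fix x y assume "x \<in> ?X" "y \<in> ?X"
    then obtain a b a' b' where x: "x = par a b" and y: "y = par a' b'" using par_surj by meson
    define p q where "p = [:a, a' - a:]" and "q = [:b, b' - b:]"
    define P where "P = (vector [smult (1 / 2) (p\<^sup>2 - q\<^sup>2), smult (1 / (2 * \<i>)) (p\<^sup>2 + q\<^sup>2), p * q] :: complex poly ^ 3)"
    define c where "c = (\<lambda>k. \<Sum>j\<in>UNIV. smult (U $ k $ j / csqrt (\<sigma> j)) (P $ j))"
    have P: "poly (P $ j) t = isotropic (poly p t) (poly q t) $ j" for j t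
      using exhaust_3[of j] by (auto simp: P_def poly_power)
    have c: "(\<chi> k. poly (c k) t) = par (poly p t) (poly q t)" for t
      by (simp add: vec_eq_iff c_def par_def matrix_vector_mult_def poly_sum P)
    show "\<exists>c. (\<forall>t. (\<chi> k. poly (c k) t) \<in> ?X) \<and>
        (\<exists>t. x = (\<chi> k. poly (c k) t)) \<and> (\<exists>t. y = (\<chi> k. poly (c k) t))"
    proof (intro exI[of _ c] conjI allI)
      show "(\<chi> k. poly (c k) t) \<in> ?X" for t unfolding c by (rule par_X)
      show "\<exists>t. x = (\<chi> k. poly (c k) t)" unfolding c by (intro exI[of _ 0]) (simp add: x p_def q_def)
      show "\<exists>t. y = (\<chi> k. poly (c k) t)" unfolding c by (intro exI[of _ 1]) (simp add: y p_def q_def)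
    qed
  qed
qed

section \<open>Takagi factorization\<close>

definition bform :: "complex ^ 'n ^ 'n \<Rightarrow> complex ^ 'n \<Rightarrow> complex ^ 'n \<Rightarrow> complex" where
  "bform A x y = (\<Sum>i\<in>UNIV. x $ i * (A *v y) $ i)"

definition hprod :: "complex ^ 'n \<Rightarrow> complex ^ 'n \<Rightarrow> complex" where
  "hprod x y = (\<Sum>i\<in>UNIV. cnj (x $ i) * y $ i)"

lemma qform_eq_bform: "qform A x = bform A x x"
  by (simp add: qform_def bform_def)

lemma bform_linear:
  "bform A (x + y) z = bform A x z + bform A y z" "bform A z (x + y) = bform A z x + bform A z y"
  "bform A (c *s x) z = c * bform A x z" "bform A z (c *s x) = c * bform A z x"
  by (simp_all add: bform_def matrix_vector_right_distrib vector_scalar_commute algebra_simps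
      sum.distrib sum_distrib_left)

lemma bform_sym:
  assumes "transpose A = A" shows "bform A x y = bform A y x"
proof -
  have sym: "A $ i $ j = A $ j $ i" for i j
    using arg_cong[OF assms, of "\<lambda>M. M $ j $ i"] by (simp add: transpose_def)
  have "bform A x y = (\<Sum>i\<in>UNIV. \<Sum>j\<in>UNIV. x $ i * (A $ i $ j * y $ j))"
    by (simp add: bform_def matrix_vector_mult_def sum_distrib_left)
  also have "\<dots> = (\<Sum>j\<in>UNIV. \<Sum>i\<in>UNIV. x $ i * (A $ i $ j * y $ j))" by (rule sum.swap)
  also have "\<dots> = (\<Sum>j\<in>UNIV. \<Sum>i\<in>UNIV. y $ j * (A $ j $ i * x $ i))"
    by (intro sum.cong refl) (simp add: sym mult_ac)
  also have "\<dots> = bform A y x" by (simp add: bform_def matrix_vector_mult_def sum_distrib_left)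
  finally show ?thesis .
qed

lemma hprod_linear:
  "hprod z (x + y) = hprod z x + hprod z y" "hprod z (c *s x) = c * hprod z x"
  by (simp_all add: hprod_def algebra_simps sum.distrib sum_distrib_left)

lemma norm_vec_square: "(norm (x :: complex ^ 'n))\<^sup>2 = (\<Sum>i\<in>UNIV. (cmod (x $ i))\<^sup>2)"
  by (simp add: norm_vec_def L2_set_def sum_nonneg)

lemma hprod_self: "hprod x x = of_real ((norm x)\<^sup>2)"
  unfolding hprod_def norm_vec_square of_real_sum complex_norm_square by (simp add: mult.commute)

lemma norm_add_square:
  "(norm (x + of_real t *s y))\<^sup>2 = (norm x)\<^sup>2 + 2 * t * Re (hprod x y) + t\<^sup>2 * (norm y)\<^sup>2"
proof -
  have *: "(cmod (a + of_real t * b))\<^sup>2 = (cmod a)\<^sup>2 + 2 * t * Re (cnj a * b) + t\<^sup>2 * (cmod b)\<^sup>2" for a b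
    unfolding cmod_power2 by (simp add: algebra_simps power2_eq_square)
  show ?thesis
    unfolding norm_vec_square hprod_def Re_sum sum_distrib_left sum.distrib[symmetric]
      vector_add_component vector_smult_component *
    by (rule refl)
qed

lemma linear_coeff_zero:
  fixes b c :: real
  assumes "\<And>t. 2 * t * b + t\<^sup>2 * c \<le> 0" shows "b = 0"
proof (rule ccontr)
  assume b: "b \<noteq> 0"
  \<comment> \<open>With \<open>s\<close> larger than \<open>\<bar>c\<bar>\<close>, the step
    \<open>t = b / s\<close> is so small that the linear term outweighs the quadratic one.\<close>
  define s where "s = \<bar>c\<bar> + 1"
  have s: "s > 0" "2 * s + c > 0" by (auto simp: s_def)
  have "2 * (b / s) * b + (b / s)\<^sup>2 * c = b\<^sup>2 * (2 * s + c) / s\<^sup>2"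
    using s by (simp add: field_simps power2_eq_square)
  moreover have "b\<^sup>2 * (2 * s + c) / s\<^sup>2 > 0" using b s by simp
  ultimately show False using assms[of "b / s"] by simp
qed

text \<open>The vector \<open>x\<close> maximizes \<open>Re (x\<^sup>T A x)\<close> on the unit sphere of \<open>W\<close>.\<close>

lemma takagi_step:
  fixes A :: "complex ^ 'n ^ 'n"
  assumes sym: "transpose A = A" and W: "closed W" "\<And>c d x y. x \<in> W \<Longrightarrow> y \<in> W \<Longrightarrow> c *s x + d *s y \<in> W"
    and y0: "y0 \<in> W" "y0 \<noteq> 0"
  obtains x s where "x \<in> W" "norm x = 1" "s \<ge> 0" "bform A x x = of_real s"
    "\<And>y. y \<in> W \<Longrightarrow> hprod x y = 0 \<Longrightarrow> bform A x y = 0"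
proof -
  have scale: "c *s x \<in> W" if "x \<in> W" for c x using W(2)[OF that that, of c 0] by simp
  have norm_scale: "norm (c *s x) = cmod c * norm x" for c and x :: "complex ^ 'n"
    unfolding power2_eq_iff_nonneg[OF norm_ge_zero mult_nonneg_nonneg[OF norm_ge_zero norm_ge_zero], symmetric]
    by (simp only: power_mult_distrib norm_vec_square)
      (simp add: norm_mult power_mult_distrib sum_distrib_left)
  let ?K = "W \<inter> sphere 0 1"
  have "compact ?K" by (intro closed_Int_compact W compact_sphere)
  moreover have "of_real (1 / norm y0) *s y0 \<in> ?K"
    using y0 scale by (simp add: norm_scale norm_divide)
  moreover have "continuous_on ?K (\<lambda>x. Re (bform A x x))"
    unfolding bform_def matrix_vector_mult_def by (intro continuous_intros)
  ultimately obtain x where x: "x \<in> ?K" and max: "\<And>y. y \<in> ?K \<Longrightarrow> Re (bform A y y) \<le> Re (bform A x x)"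
    using continuous_attains_sup[of ?K "\<lambda>x. Re (bform A x x)"] by blast
  define s where "s = Re (bform A x x)"
  have xW: "x \<in> W" and nx: "norm x = 1" using x by auto
  have le: "Re (bform A y y) \<le> s * (norm y)\<^sup>2" if "y \<in> W" for y
  proof (cases "y = 0")
    case True
    then show ?thesis by (simp add: bform_def)
  next
    case False
    let ?c = "of_real (1 / norm y) :: complex"
    have "?c *s y \<in> ?K" using False that scale by (simp add: norm_scale norm_divide)
    from max[OF this] have "Re (?c * ?c * bform A y y) \<le> s"
      by (simp only: bform_linear s_def mult.assoc)
    then have "Re (bform A y y) / (norm y)\<^sup>2 \<le> s"
      by (simp add: power2_eq_square field_simps flip: of_real_mult)
    with False show ?thesis by (simp add: field_simps)
  qed
  \<comment> \<open>The bound \<open>le\<close> is an equality at \<open>x\<close>, so along a line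
    through \<open>x\<close> in a real-orthogonal direction the term linear in \<open>t\<close> must
    vanish.\<close>
  have orth: "Re (bform A x y) = 0" if y: "y \<in> W" "Re (hprod x y) = 0" for y
  proof (rule linear_coeff_zero)
    fix t :: real
    have "x + of_real t *s y \<in> W" using W(2)[OF xW y(1), of 1 "of_real t"] by simp
    from le[OF this] have "Re (bform A (x + of_real t *s y) (x + of_real t *s y)) \<le>
        s * (1 + t\<^sup>2 * (norm y)\<^sup>2)"
      unfolding norm_add_square by (simp add: y nx)
    moreover have "Re (bform A (x + of_real t *s y) (x + of_real t *s y)) =
        s + 2 * t * Re (bform A x y) + t\<^sup>2 * Re (bform A y y)"
      by (simp add: bform_linear bform_sym[OF sym, of y x] s_def algebra_simps power2_eq_square)
    ultimately have "s + 2 * t * Re (bform A x y) + t\<^sup>2 * Re (bform A y y) \<le> s * (1 + t\<^sup>2 * (norm y)\<^sup>2)"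
      by simp
    then show "2 * t * Re (bform A x y) + t\<^sup>2 * (Re (bform A y y) - s * (norm y)\<^sup>2) \<le> 0"
      by (simp add: algebra_simps)
  qed
  \<comment> \<open>The direction \<open>\<i> *s x\<close> is real-orthogonal to \<open>x\<close>;
    this kills the imaginary part of the form at \<open>x\<close>.\<close>
  have "Re (bform A x (\<i> *s x)) = 0"
    by (rule orth) (simp_all add: scale xW hprod_linear hprod_self)
  then have "bform A x x = of_real s" by (simp add: bform_linear s_def complex_eq_iff)
  \<comment> \<open>Multiplication by the imaginary unit reverses the sign of the form and keeps the
    norm, so the maximum is not negative.\<close>
  moreover have "s \<ge> 0" using le[OF scale[OF xW, of \<i>]]
    by (simp add: bform_linear norm_scale nx s_def[symmetric])
  moreover have "bform A x y = 0" if "y \<in> W" "hprod x y = 0" for y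
    using orth[OF that(1)] orth[OF scale[OF that(1), of \<i>]] that(2)
    by (simp add: hprod_linear bform_linear complex_eq_iff)
  ultimately show thesis using that xW nx by blast
qed

text \<open>The conjugate turns the bilinear orthogonality of the cross product into Hermitian
  orthogonality. It supplies the nonzero vectors that the second and third maximizations start
  from.\<close>

definition cross_cnj :: "complex ^ 3 \<Rightarrow> complex ^ 3 \<Rightarrow> complex ^ 3" where
  "cross_cnj a b = cvec (vector [a $ 2 * b $ 3 - a $ 3 * b $ 2, a $ 3 * b $ 1 - a $ 1 * b $ 3,
     a $ 1 * b $ 2 - a $ 2 * b $ 1])"

lemma cross_cnj_nth: "cross_cnj a b $ 1 = cnj (a $ 2 * b $ 3 - a $ 3 * b $ 2)"
  "cross_cnj a b $ 2 = cnj (a $ 3 * b $ 1 - a $ 1 * b $ 3)"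
  "cross_cnj a b $ 3 = cnj (a $ 1 * b $ 2 - a $ 2 * b $ 1)"
  by (simp_all add: cross_cnj_def)

lemma hprod_cross_cnj: "hprod a (cross_cnj a b) = 0" "hprod b (cross_cnj a b) = 0"
  by (simp_all add: hprod_def sum_3 cross_cnj_nth algebra_simps)

lemma ex_orthogonal:
  fixes a :: "complex ^ 3"
  assumes "a \<noteq> 0" shows "\<exists>y. y \<noteq> 0 \<and> hprod a y = 0"
proof -
  have "cross_cnj a (vector [1, 0, 0]) \<noteq> 0 \<or> cross_cnj a (vector [0, 1, 0]) \<noteq> 0"
    using assms by (auto simp: vec_eq_iff forall_3 cross_cnj_nth)
  then show ?thesis using hprod_cross_cnj by blast
qed

lemma cross_cnj_nonzero:
  assumes "hprod a a \<noteq> 0" "b \<noteq> 0" "hprod a b = 0" shows "cross_cnj a b \<noteq> 0"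
proof
  assume "cross_cnj a b = 0"
  then have eq: "a $ 2 * b $ 3 = a $ 3 * b $ 2" "a $ 3 * b $ 1 = a $ 1 * b $ 3" "a $ 1 * b $ 2 = a $ 2 * b $ 1"
    by (simp_all add: vec_eq_iff forall_3 cross_cnj_nth del: complex_cnj_diff complex_cnj_mult)
  have "hprod a a * b $ j = a $ j * hprod a b" for j
  proof -
    have *: "a $ i * b $ j = a $ j * b $ i" for i
      using exhaust_3[of i] exhaust_3[of j] eq by auto
    have "hprod a a * b $ j = (\<Sum>i\<in>UNIV. cnj (a $ i) * (a $ i * b $ j))"
      by (simp add: hprod_def sum_distrib_right mult.assoc)
    also have "\<dots> = a $ j * hprod a b"
      unfolding * by (simp add: hprod_def sum_distrib_left mult_ac)
    finally show ?thesis .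
  qed
  with assms show False by (simp add: vec_eq_iff)
qed

definition diag_mult :: "('n \<Rightarrow> 'a::times) \<Rightarrow> 'a ^ 'n \<Rightarrow> 'a ^ 'n" where
  "diag_mult \<sigma> x = (\<chi> k. \<sigma> k * x $ k)"

lemma diag_mult_nth [simp]: "diag_mult \<sigma> x $ k = \<sigma> k * x $ k"
  by (simp add: diag_mult_def)

text \<open>The form is maximized on the whole space, on the orthogonal complement of the first
  maximizer, and on that of the first two. Each maximizer pairs to zero with its complement under
  the bilinear form, so these orthonormal vectors, the columns of \<open>U\<close>, diagonalize
  it.\<close>

lemma takagi:
  fixes A :: "complex ^ 3 ^ 3"
  assumes sym: "transpose A = A"
  obtains U :: "complex ^ 3 ^ 3" and \<sigma> :: "3 \<Rightarrow> real" where "\<And>k. \<sigma> k \<ge> 0"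
    "conj_transpose U ** U = mat 1"
    "\<And>x y. bform A (U *v x) (U *v y) = (\<Sum>k\<in>UNIV. of_real (\<sigma> k) * x $ k * y $ k)"
proof -
  have closed: "closed {y. hprod a y = 0}" for a :: "complex ^ 3"
    unfolding hprod_def by (intro closed_Collect_eq continuous_intros)
  obtain x1 s1 where 1: "norm x1 = 1" "s1 \<ge> 0" "bform A x1 x1 = of_real s1"
    "\<And>y. hprod x1 y = 0 \<Longrightarrow> bform A x1 y = 0"
    by (rule takagi_step[OF sym, of UNIV "vector [1, 0, 0]"]) (auto simp: vec_eq_iff forall_3)
  have h1: "hprod x1 x1 = 1" using 1(1) by (simp add: hprod_self)
  then have "x1 \<noteq> 0" by (auto simp: hprod_def)
  then obtain y1 where y1: "y1 \<noteq> 0" "hprod x1 y1 = 0" using ex_orthogonal by blast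
  obtain x2 s2 where 2: "hprod x1 x2 = 0" "norm x2 = 1" "s2 \<ge> 0" "bform A x2 x2 = of_real s2"
    "\<And>y. hprod x1 y = 0 \<Longrightarrow> hprod x2 y = 0 \<Longrightarrow> bform A x2 y = 0"
    by (rule takagi_step[OF sym closed, of x1 y1]) (use y1 in \<open>auto simp: hprod_linear\<close>)
  have h2: "hprod x2 x2 = 1" using 2(2) by (simp add: hprod_self)
  then have "x2 \<noteq> 0" by (auto simp: hprod_def)
  then have "cross_cnj x1 x2 \<noteq> 0" using cross_cnj_nonzero[of x1 x2] h1 2(1) by simp
  then obtain x3 s3 where 3: "hprod x1 x3 = 0" "hprod x2 x3 = 0" "norm x3 = 1" "s3 \<ge> 0"
    "bform A x3 x3 = of_real s3"
    by (rule takagi_step[OF sym closed_Int[OF closed[of x1] closed[of x2]], of "cross_cnj x1 x2", rotated 2])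
      (auto simp: hprod_linear hprod_cross_cnj)
  have h3: "hprod x3 x3 = 1" using 3(3) by (simp add: hprod_self)
  have hsym: "hprod x y = 0 \<Longrightarrow> hprod y x = 0" for x y :: "complex ^ 3"
  proof -
    have "hprod y x = cnj (hprod x y)" by (simp add: hprod_def mult.commute)
    then show "hprod x y = 0 \<Longrightarrow> hprod y x = 0" by simp
  qed
  have b0: "bform A x1 x2 = 0" "bform A x1 x3 = 0" "bform A x2 x3 = 0"
    using 1(4) 2(1,5) 3(1,2) by auto
  then have b0': "bform A x2 x1 = 0" "bform A x3 x1 = 0" "bform A x3 x2 = 0"
    using bform_sym[OF sym] by metis+
  define X where "X = (\<lambda>k::3. if k = 1 then x1 else if k = 2 then x2 else x3)"
  define \<sigma> where "\<sigma> = (\<lambda>k::3. if k = 1 then s1 else if k = 2 then s2 else s3)"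
  define U :: "complex ^ 3 ^ 3" where "U = (\<chi> i j. X j $ i)"
  have U: "U *v x = x $ 1 *s x1 + x $ 2 *s x2 + x $ 3 *s x3" for x
    by (simp add: vec_eq_iff U_def X_def matrix_vector_mult_def sum_3 mult.commute)
  show thesis
  proof (rule that)
    show "\<sigma> k \<ge> 0" for k using 1 2 3 by (simp add: \<sigma>_def)
    have *: "(conj_transpose U ** U) $ i $ j = hprod (X i) (X j)" for i j
      by (simp add: conj_transpose_def transpose_def matrix_matrix_mult_def map_matrix_def U_def hprod_def)
    have "hprod (X i) (X j) = (if i = j then 1 else 0)" for i j
      using exhaust_3[of i] exhaust_3[of j] h1 h2 h3 2(1) 3(1,2) hsym[OF 2(1)] hsym[OF 3(1)] hsym[OF 3(2)]
      by (auto simp: X_def)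
    with * show "conj_transpose U ** U = mat 1" by (simp add: vec_eq_iff mat_def)
    show "bform A (U *v x) (U *v y) = (\<Sum>k\<in>UNIV. of_real (\<sigma> k) * x $ k * y $ k)" for x y
      by (simp add: U bform_linear b0 b0' 1(3) 2(4) 3(5) sum_3 \<sigma>_def)
  qed
qed

lemmas poly_fun2_intros = poly_fun2_const poly_fun2_fst poly_fun2_snd poly_fun2_add poly_fun2_mult
  poly_fun2_uminus poly_fun2_diff poly_fun2_power poly_fun2_sum poly_fun2_prod

section \<open>Reduction to diagonal form\<close>

definition dform :: "('n \<Rightarrow> 'a::comm_ring_1) \<Rightarrow> 'a ^ 'n \<Rightarrow> 'a ^ 'n \<Rightarrow> 'a" where
  "dform \<sigma> x y = (\<Sum>k\<in>UNIV. \<sigma> k * x $ k * y $ k)"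

text \<open>The system \<open>crit_pairs\<close> in Takagi coordinates. No conjugation remains,
  because the diagonal entries are real there and \<open>v\<close>, \<open>w\<close> are transported
  by the conjugate matrix.\<close>

definition diag_pairs :: "('n \<Rightarrow> complex) \<Rightarrow> complex ^ 'n \<Rightarrow> complex ^ 'n \<Rightarrow> ((complex ^ 'n) \<times> (complex ^ 'n)) set" where
  "diag_pairs \<sigma> u v = {(z, w). z \<noteq> 0 \<and> w \<noteq> 0 \<and> dform \<sigma> z z = 0 \<and> dform \<sigma> w w = 0 \<and>
     (\<exists>\<mu>. v - w = \<mu> *s diag_mult \<sigma> z) \<and> (\<exists>\<nu>. u - z = \<nu> *s diag_mult \<sigma> w)}"

definition diag_critical :: "('n \<Rightarrow> complex) \<Rightarrow> complex ^ 'n \<Rightarrow> (complex ^ 'n) set" where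
  "diag_critical \<sigma> u = {z. z \<noteq> 0 \<and> dform \<sigma> z z = 0 \<and> (\<exists>\<nu>. u - z = \<nu> *s diag_mult \<sigma> (cvec z))}"

lemma cvec_linear: "cvec (x + y) = cvec x + cvec y" "cvec (x - y) = cvec x - cvec y"
  "cvec (c *s x) = cnj c *s cvec x" "cvec 0 = 0"
  by (simp_all add: vec_eq_iff)

lemma cvec_eq_iff [simp]: "cvec x = cvec y \<longleftrightarrow> x = y"
  by (metis cvec_cvec)

lemma cvec_eq_0_iff [simp]: "cvec x = 0 \<longleftrightarrow> x = 0"
  by (simp add: vec_eq_iff)

locale takagi_form =
  fixes A U :: "complex ^ 3 ^ 3" and \<sigma> :: "3 \<Rightarrow> real"
  assumes sym: "transpose A = A" and \<sigma>_nonneg: "\<sigma> k \<ge> 0"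
    and unitary: "conj_transpose U ** U = mat 1"
    and diag: "bform A (U *v x) (U *v y) = dform (\<lambda>k. of_real (\<sigma> k)) x y"
begin

abbreviation cs :: "3 \<Rightarrow> complex" where "cs \<equiv> (\<lambda>k. of_real (\<sigma> k))"

lemma unitary': "U ** conj_transpose U = mat 1"
  using unitary by (simp add: matrix_left_right_inverse)

lemma UH_U [simp]: "conj_transpose U *v (U *v x) = x" and U_UH [simp]: "U *v (conj_transpose U *v x) = x"
  by (simp_all add: matrix_vector_mul_assoc unitary unitary')

lemma U_eq_iff [simp]: "U *v x = U *v y \<longleftrightarrow> x = y"
  by (metis UH_U)

lemma U_eq_0_iff [simp]: "U *v x = 0 \<longleftrightarrow> x = 0"
  using U_eq_iff[of x 0] by simp

text \<open>Since \<open>U\<close> is unitary, U^T A U = D becomes A U = conj(U) D;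
  \<open>cvec (U *v cvec x)\<close> is the conjugate of \<open>U\<close> applied to
  \<open>x\<close>.\<close>

lemma A_U: "A *v (U *v y) = cvec (U *v cvec (diag_mult cs y))"
proof -
  define c where "c = A *v (U *v y)"
  have "transpose U *v c = diag_mult cs y"
  proof (subst vec_eq_iff, intro allI)
    fix k
    have "(U *v axis k 1) $ i = U $ i $ k" for i
      by (simp add: matrix_vector_mult_def axis_def if_distrib[of "\<lambda>x. _ * x"] cong: if_cong)
    moreover have "(transpose U *v c) $ k = (\<Sum>i\<in>UNIV. U $ i $ k * c $ i)"
      by (simp add: matrix_vector_mult_def transpose_def)
    ultimately have "(transpose U *v c) $ k = bform A (U *v axis k 1) (U *v y)"
      by (simp add: bform_def c_def)
    also have "\<dots> = diag_mult cs y $ k"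
      by (simp add: diag dform_def axis_def if_distrib[of "\<lambda>x. _ * x"] if_distrib[of "\<lambda>x. x * _"] cong: if_cong)
    finally show "(transpose U *v c) $ k = diag_mult cs y $ k" .
  qed
  moreover have "conj_transpose U *v cvec c = cvec (transpose U *v c)"
    by (simp add: vec_eq_iff conj_transpose_def map_matrix_def matrix_vector_mult_def transpose_def)
  ultimately have "cvec c = U *v cvec (diag_mult cs y)" by (metis U_UH)
  then show ?thesis unfolding c_def by (metis cvec_cvec)
qed

lemma qform_U: "qform A (U *v x) = dform cs x x"
  by (simp add: qform_eq_bform diag)

lemma cnj_dform: "dform cs (cvec x) (cvec y) = cnj (dform cs x y)"
  by (simp add: dform_def)

lemma cvec_diag_mult: "cvec (diag_mult cs x) = diag_mult cs (cvec x)"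
  by (simp add: vec_eq_iff)

lemma matrix_diff: "U *v (x - y) = U *v x - U *v y"
  by (simp add: matrix_vector_mult_def vec_eq_iff algebra_simps sum_subtractf)

text \<open>\<open>z\<close> and \<open>u\<close> change by \<open>U\<close>, their partners
  \<open>w\<close> and \<open>v\<close> by its conjugate. Both multiplier equations keep their shape
  under this joint change, which is linear in the data and so preserves genericity.\<close>

lemma crit_pairs_iff:
  "(U *v x, cvec (U *v cvec y)) \<in> crit_pairs A (U *v u) (cvec (U *v cvec v)) \<longleftrightarrow>
    (x, y) \<in> diag_pairs cs u v"
proof -
  have "cvec (U *v cvec v) - cvec (U *v cvec y) = \<mu> *s (A *v (U *v x)) \<longleftrightarrow>
      v - y = \<mu> *s diag_mult cs x" for \<mu>
  proof -
    have "cvec (U *v cvec v) - cvec (U *v cvec y) = cvec (U *v cvec (v - y))"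
      by (simp add: cvec_linear matrix_diff)
    moreover have "\<mu> *s (A *v (U *v x)) = cvec (U *v cvec (\<mu> *s diag_mult cs x))"
      by (simp add: A_U cvec_linear vector_scalar_commute)
    ultimately show ?thesis by simp
  qed
  moreover have "U *v u - U *v x = \<nu> *s cvec (A *v (U *v cvec y)) \<longleftrightarrow>
      u - x = \<nu> *s diag_mult cs y" for \<nu>
  proof -
    have "\<nu> *s cvec (A *v (U *v cvec y)) = U *v (\<nu> *s diag_mult cs y)"
      by (simp add: A_U cvec_diag_mult vector_scalar_commute)
    then show ?thesis by (simp flip: matrix_diff)
  qed
  ultimately show ?thesis
    by (simp add: crit_pairs_def diag_pairs_def qform_U cnj_dform)
qed

lemma crit_pairs_eq: "crit_pairs A u v = (\<lambda>(x, y). (U *v x, cvec (U *v cvec y))) `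
    diag_pairs cs (conj_transpose U *v u) (cvec (conj_transpose U *v cvec v))" (is "_ = ?T ` ?D")
proof -
  have iff: "(U *v x, cvec (U *v cvec y)) \<in> crit_pairs A u v \<longleftrightarrow> (x, y) \<in> ?D" for x y
    using crit_pairs_iff[of x y "conj_transpose U *v u" "cvec (conj_transpose U *v cvec v)"] by simp
  show ?thesis
  proof (intro equalityI subsetI)
    fix p assume p: "p \<in> crit_pairs A u v"
    obtain z w where "p = (z, w)" by (cases p)
    then have "p = ?T (conj_transpose U *v z, cvec (conj_transpose U *v cvec w))" by simp
    with p iff show "p \<in> ?T ` ?D" by fast
  qed (use iff in auto)
qed

lemma critical_eq:
  "{z. z \<noteq> 0 \<and> qform A z = 0 \<and> (\<exists>\<mu>. cvec u - cvec z = \<mu> *s (A *v z))} =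
    (\<lambda>x. U *v x) ` diag_critical cs (conj_transpose U *v u)" (is "?L = _ ` ?D")
proof -
  define u' where "u' = conj_transpose U *v u"
  have u: "u = U *v u'" by (simp add: u'_def)
  have "cvec u - cvec (U *v x) = \<mu> *s (A *v (U *v x)) \<longleftrightarrow> u' - x = cnj \<mu> *s diag_mult cs (cvec x)" for \<mu> x
  proof -
    have "cvec u - cvec (U *v x) = cvec (U *v (u' - x))"
      by (simp add: u cvec_linear matrix_diff)
    moreover have "\<mu> *s (A *v (U *v x)) = cvec (U *v (cnj \<mu> *s diag_mult cs (cvec x)))"
      by (simp add: A_U cvec_linear vector_scalar_commute cvec_diag_mult)
    ultimately show ?thesis by simp
  qed
  then have "(\<exists>\<mu>. cvec u - cvec (U *v x) = \<mu> *s (A *v (U *v x))) \<longleftrightarrow>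
      (\<exists>\<nu>. u' - x = \<nu> *s diag_mult cs (cvec x))" for x
    by (metis complex_cnj_cnj)
  then have iff: "U *v x \<in> ?L \<longleftrightarrow> x \<in> diag_critical cs u'" for x
    by (simp add: diag_critical_def qform_U)
  show ?thesis unfolding u'_def[symmetric]
  proof (intro equalityI subsetI)
    fix z assume z: "z \<in> ?L"
    obtain x where x: "z = U *v x" using U_UH[of z] by metis
    then have "x \<in> diag_critical cs u'" using z iff by blast
    then show "z \<in> (\<lambda>x. U *v x) ` diag_critical cs u'" using x by blast
  next
    fix z assume "z \<in> (\<lambda>x. U *v x) ` diag_critical cs u'"
    then obtain x where "z = U *v x" "x \<in> diag_critical cs u'" by blast
    then show "z \<in> ?L" by (simp only: iff)
  qed
qed

lemma conj_transpose_A: "conj_transpose A *v x = cvec (A *v cvec x)"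
  by (simp add: conj_transpose_def sym) (simp add: vec_eq_iff map_matrix_def matrix_vector_mult_def)

text \<open>In Takagi coordinates A^H A acts as D^2, so its eigenvalues are the squares of the
  \<open>\<sigma> k\<close>, and nonnegativity fixes the roots.\<close>

lemma singular_values_eq: "singular_values A = range \<sigma>"
proof -
  have AA: "(conj_transpose A ** A) *v (U *v x) = U *v diag_mult cs (diag_mult cs x)" for x
    by (simp add: conj_transpose_A A_U cvec_diag_mult flip: matrix_vector_mul_assoc)
  have ev: "(conj_transpose A ** A) *v (U *v x) = of_real (s\<^sup>2) *s (U *v x) \<longleftrightarrow>
      (\<forall>k. x $ k = 0 \<or> (\<sigma> k)\<^sup>2 = s\<^sup>2)" for x s
  proof -
    have "(conj_transpose A ** A) *v (U *v x) = of_real (s\<^sup>2) *s (U *v x) \<longleftrightarrow>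
        diag_mult cs (diag_mult cs x) = of_real (s\<^sup>2) *s x"
      unfolding AA vector_scalar_commute[symmetric] by simp
    also have "\<dots> \<longleftrightarrow> (\<forall>k. x $ k = 0 \<or> complex_of_real ((\<sigma> k)\<^sup>2) = of_real (s\<^sup>2))"
      by (auto simp: vec_eq_iff power2_eq_square simp flip: mult.assoc)
    finally show ?thesis by (simp only: of_real_eq_iff)
  qed
  show ?thesis
  proof (intro equalityI subsetI)
    fix s assume "s \<in> singular_values A"
    then obtain x where s: "s \<ge> 0" "x \<noteq> 0" "(conj_transpose A ** A) *v x = of_real (s\<^sup>2) *s x"
      by (auto simp: singular_values_def)
    define y where "y = conj_transpose U *v x"
    have x: "x = U *v y" by (simp add: y_def)
    then obtain k where "y $ k \<noteq> 0" using s(2) by (auto simp: vec_eq_iff[of y 0])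
    then have "(\<sigma> k)\<^sup>2 = s\<^sup>2" using s(3) ev[of y s] x by auto
    then have "s = \<sigma> k" using s(1) \<sigma>_nonneg[of k] by simp
    then show "s \<in> range \<sigma>" by simp
  next
    fix s assume "s \<in> range \<sigma>"
    then obtain k where k: "s = \<sigma> k" by blast
    have "(conj_transpose A ** A) *v (U *v axis k 1) = of_real (s\<^sup>2) *s (U *v axis k 1)"
      unfolding ev k by (simp add: axis_def)
    moreover have "U *v axis k 1 \<noteq> 0" by simp
    ultimately show "s \<in> singular_values A"
      using \<sigma>_nonneg[of k] unfolding singular_values_def k by blast
  qed
qed

lemma det_nonzero_iff: "det A \<noteq> 0 \<longleftrightarrow> (\<forall>k. \<sigma> k \<noteq> 0)"
proof -
  have ker: "A *v (U *v y) = 0 \<longleftrightarrow> diag_mult cs y = 0" for y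
    by (simp add: A_U)
  have "det A \<noteq> 0 \<longleftrightarrow> (\<forall>x. A *v x = 0 \<longrightarrow> x = 0)"
    by (metis invertible_det_nz invertible_left_inverse matrix_left_invertible_ker)
  also have "\<dots> \<longleftrightarrow> (\<forall>y. diag_mult cs y = 0 \<longrightarrow> y = 0)"
    by (metis U_UH U_eq_0_iff ker)
  also have "\<dots> \<longleftrightarrow> (\<forall>k. \<sigma> k \<noteq> 0)"
  proof
    assume *: "\<forall>y. diag_mult cs y = 0 \<longrightarrow> y = 0"
    show "\<forall>k. \<sigma> k \<noteq> 0"
    proof (intro allI notI)
      fix k assume "\<sigma> k = 0"
      then have "diag_mult cs (axis k 1) = 0" by (simp add: vec_eq_iff axis_def)
      then have "axis k (1::complex) = 0" using * by blast
      then show False by simp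
    qed
  qed (auto simp: vec_eq_iff)
  finally show ?thesis .
qed

lemma poly_fun2_matrix: "poly_fun2 (\<lambda>u v. (M *v u) $ k)" "poly_fun2 (\<lambda>u v. cvec (M *v cvec v) $ k)"
  by (simp_all add: matrix_vector_mult_def) (intro poly_fun2_intros)+

lemma hypersurface:
  assumes "\<And>k. \<sigma> k \<noteq> 0"
  shows "irreducible_hypersurface (quad_poly A) {z. qform A z = 0}"
  by (rule irreducible_hypersurface_conic[of cs U "conj_transpose U"])
    (use assms in \<open>auto simp: unitary unitary' qform_U dform_def power2_eq_square mult.assoc\<close>)

lemma vHDdeg_conic:
  assumes nz: "\<And>k. \<sigma> k \<noteq> 0"
    and gen: "generic (\<lambda>u v. finite (diag_pairs cs u v) \<and> card (diag_pairs cs u v) = N)"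
  shows "vHDdeg {z. qform A z = 0} = N"
proof -
  interpret irreducible_hypersurface "quad_poly A" "{z. qform A z = 0}" by (rule hypersurface[OF nz])
  have "det A \<noteq> 0" using nz det_nonzero_iff by simp
  then obtain B where B: "B ** A = mat 1" by (metis invertible_det_nz invertible_def)
  have comp: "irreducible_components {z. qform A z = 0} = {{z. qform A z = 0}}"
    by (rule irreducible_components_irreducible[OF irreducible])
  \<comment> \<open>By \<open>qform_inverse\<close> the dual form takes the nonzero value
    \<open>cs 1\<close> here, so it does not vanish identically.\<close>
  let ?e = "A *v (U *v axis 1 1)"
  have Be: "qform B ?e \<noteq> 0"
    using nz[of 1] by (simp add: qform_inverse[OF B] qform_U dform_def axis_def
        if_distrib[of "\<lambda>x. _ * x"] if_distrib[of "\<lambda>x. x * _"] cong: if_cong)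
  \<comment> \<open>\<open>qform B (cvec u)\<close> is antiholomorphic in \<open>u\<close>; its
    conjugate is polynomial and has the same zeros.\<close>
  have pf: "poly_fun2 (\<lambda>u v. qform B v)" "poly_fun2 (\<lambda>u v. cnj (qform B (cvec u)))"
    by (simp_all add: qform_def matrix_vector_mult_def) (intro poly_fun2_intros)+
  have "generic (\<lambda>u v. qform B v \<noteq> 0)" using genericI[OF pf(1), of ?e] Be by blast
  moreover have "generic (\<lambda>u v. cnj (qform B (cvec u)) \<noteq> 0)"
    using genericI[OF pf(2), of "cvec ?e"] Be by simp
  moreover have "generic (\<lambda>u v. finite (diag_pairs cs (conj_transpose U *v u) (cvec (conj_transpose U *v cvec v))) \<and>
      card (diag_pairs cs (conj_transpose U *v u) (cvec (conj_transpose U *v cvec v))) = N)"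
  proof (rule generic_compose[OF gen poly_fun2_matrix])
    show "\<exists>u v. conj_transpose U *v u = a \<and> cvec (conj_transpose U *v cvec v) = b" for a b
      by (intro exI[of _ "U *v a"] exI[of _ "cvec (U *v cvec b)"]) simp
  qed
  ultimately have "generic (\<lambda>u v. qform B v \<noteq> 0 \<and> cnj (qform B (cvec u)) \<noteq> 0 \<and>
      finite (diag_pairs cs (conj_transpose U *v u) (cvec (conj_transpose U *v cvec v))) \<and>
      card (diag_pairs cs (conj_transpose U *v u) (cvec (conj_transpose U *v cvec v))) = N)"
    by (rule generic_conj[OF _ generic_conj])
  then have "generic (\<lambda>u v. vHD_count {z. qform A z = 0} u v N)"
  proof (rule generic_mono)
    fix u v assume *: "qform B v \<noteq> 0 \<and> cnj (qform B (cvec u)) \<noteq> 0 \<and>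
      finite (diag_pairs cs (conj_transpose U *v u) (cvec (conj_transpose U *v cvec v))) \<and>
      card (diag_pairs cs (conj_transpose U *v u) (cvec (conj_transpose U *v cvec v))) = N"
    then have "zeros (hermitian_critical_ideal {z. qform A z = 0} u v) = (\<lambda>(z, w). pair z w) ` crit_pairs A u v"
      by (intro zeros_hermitian_critical_ideal_quadric[OF refl sym B]) auto
    moreover have "inj_on (\<lambda>(z, w). pair z w) S" for S :: "((complex ^ 3) \<times> (complex ^ 3)) set"
      by (auto simp: inj_on_def)
    moreover have "inj_on (\<lambda>(x, y). (U *v x, cvec (U *v cvec y))) S" for S
      by (auto simp: inj_on_def)
    ultimately show "vHD_count {z. qform A z = 0} u v N"
      using * by (simp add: vHD_count_def comp crit_pairs_eq card_image)
  qed
  then show ?thesis by (rule vHDdeg_eqI)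
qed

lemma HD_count_conic:
  assumes nz: "\<And>k. \<sigma> k \<noteq> 0"
    and "finite (diag_critical cs (conj_transpose U *v u))"
      "card (diag_critical cs (conj_transpose U *v u)) = m"
  shows "HD_count {z. qform A z = 0} u m"
proof -
  interpret irreducible_hypersurface "quad_poly A" "{z. qform A z = 0}" by (rule hypersurface[OF nz])
  have "det A \<noteq> 0" using nz det_nonzero_iff by simp
  then obtain B where B: "B ** A = mat 1" by (metis invertible_det_nz invertible_def)
  have comp: "irreducible_components {z. qform A z = 0} = {{z. qform A z = 0}}"
    by (rule irreducible_components_irreducible[OF irreducible])
  have "inj_on (\<lambda>x. U *v x) S" for S by (auto simp: inj_on_def)
  with assms(2,3) show ?thesis
    by (simp add: HD_count_def comp critical_points_quadric[OF refl sym B] critical_eq card_image)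
qed

end

section \<open>One singular value\<close>

definition cdot :: "complex ^ 'n \<Rightarrow> complex ^ 'n \<Rightarrow> complex" where
  "cdot x y = (\<Sum>k\<in>UNIV. x $ k * y $ k)"

lemma cdot_sym: "cdot x y = cdot y x"
  by (simp add: cdot_def mult.commute)

lemma cdot_linear:
  "cdot (x + y) z = cdot x z + cdot y z" "cdot (x - y) z = cdot x z - cdot y z"
  "cdot z (x + y) = cdot z x + cdot z y" "cdot z (x - y) = cdot z x - cdot z y"
  "cdot (c *s x) z = c * cdot x z" "cdot z (c *s x) = c * cdot z x"
  by (simp_all add: cdot_def algebra_simps sum.distrib sum_subtractf sum_distrib_left)

lemma cdot_cvec: "cdot (cvec x) (cvec y) = cnj (cdot x y)"
  by (simp add: cdot_def)

text \<open>Solving u = z + n w, v = w + m z gives z = (u - n v) / (1 - n m) and w = (v - m u) / (1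
  - n m). With N = u.v, p = u.u, q = v.v the isotropy conditions become q n^2 - 2 N n + p = 0 and p
  m^2 - 2 N m + q = 0, both with reduced discriminant N^2 - p q.\<close>

definition scalar_pair :: "complex ^ 'n \<Rightarrow> complex ^ 'n \<Rightarrow> complex \<Rightarrow> (complex ^ 'n) \<times> (complex ^ 'n)" where
  "scalar_pair u v r = (let n = (cdot u v + r) / cdot v v; m = (cdot u v + r) / cdot u u
     in ((1 / (1 - n * m)) *s (u - n *s v), (1 / (1 - n * m)) *s (v - m *s u)))"

lemma diag_pairs_scalar:
  fixes u v :: "complex ^ 'n" and c r :: complex
  assumes c: "c \<noteq> 0" and nz: "cdot u u \<noteq> 0" "cdot v v \<noteq> 0" "r \<noteq> 0"
    and r: "r\<^sup>2 = (cdot u v)\<^sup>2 - cdot u u * cdot v v"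
  shows "diag_pairs (\<lambda>_. c) u v = {scalar_pair u v r, scalar_pair u v (- r)}"
    and "scalar_pair u v r \<noteq> scalar_pair u v (- r)"
proof -
  define N where "N = cdot u v"
  define p where "p = cdot u u"
  define q where "q = cdot v v"
  have pq: "p \<noteq> 0" "q \<noteq> 0" "r\<^sup>2 = N\<^sup>2 - p * q" using nz r by (simp_all add: p_def q_def N_def)
  have diag: "diag_mult (\<lambda>_. c) x = c *s x" and df: "dform (\<lambda>_. c) x x = 0 \<longleftrightarrow> cdot x x = 0" for x :: "complex ^ 'n"
    using c by (auto simp: vec_eq_iff dform_def cdot_def mult.assoc simp flip: sum_distrib_left)
  have not_par: "u - n *s v \<noteq> 0" for n
  proof
    assume "u - n *s v = 0"
    then have u: "u = n *s v" by simp
    have "r\<^sup>2 = 0" unfolding r by (simp add: u cdot_linear power2_eq_square)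
    with nz(3) show False by simp
  qed
  have not_par': "v - m *s u \<noteq> 0" for m
  proof
    assume "v - m *s u = 0"
    then have v: "v = m *s u" by simp
    have "r\<^sup>2 = 0" unfolding r by (simp add: v cdot_linear power2_eq_square)
    with nz(3) show False by simp
  qed
  \<comment> \<open>The denominator of \<open>scalar_pair\<close> cannot vanish: otherwise
    \<open>N + e\<close> squares to \<open>p * q\<close>, and the equation for \<open>e\<close>
    forces \<open>e * (N + e) = 0\<close>.\<close>
  have nm: "((N + e) / q) * ((N + e) / p) \<noteq> 1" if e: "e = r \<or> e = - r" for e
  proof
    assume "((N + e) / q) * ((N + e) / p) = 1"
    then have "(N + e)\<^sup>2 = p * q" using pq by (simp add: field_simps power2_eq_square)
    moreover have "e\<^sup>2 = N\<^sup>2 - p * q" using e pq(3) by auto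
    ultimately have "2 * e * (N + e) = 0" by algebra
    then have "N + e = 0" using e nz(3) by auto
    with \<open>(N + e)\<^sup>2 = p * q\<close> pq show False by simp
  qed
  have sp: "scalar_pair u v e = (let n = (N + e) / q; m = (N + e) / p
     in ((1 / (1 - n * m)) *s (u - n *s v), (1 / (1 - n * m)) *s (v - m *s u)))" for e
    by (simp add: scalar_pair_def N_def p_def q_def)
  have sol: "\<exists>n m. scalar_pair u v e = (z, w) \<longrightarrow> n = (N + e) / q \<and> z \<noteq> 0 \<and> w \<noteq> 0 \<and> cdot z z = 0 \<and> cdot w w = 0 \<and>
      v - w = m *s z \<and> u - z = n *s w" if e: "e = r \<or> e = - r" for e z w
  proof (intro exI impI)
    define n where "n = (N + e) / q"
    define m where "m = (N + e) / p"
    assume "scalar_pair u v e = (z, w)"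
    then have z: "z = (1 / (1 - n * m)) *s (u - n *s v)" and w: "w = (1 / (1 - n * m)) *s (v - m *s u)"
      by (simp_all only: sp Let_def n_def m_def prod.inject)
    have k: "1 - n * m \<noteq> 0" using nm[OF e] by (simp add: n_def m_def)
    have e2: "e\<^sup>2 = N\<^sup>2 - p * q" using e pq(3) by auto
    have "q * (p - 2 * n * N + n\<^sup>2 * q) = p * q - 2 * (N + e) * N + (N + e)\<^sup>2"
      using pq by (simp add: n_def power2_eq_square field_simps)
    also have "\<dots> = 0" using e2 by algebra
    finally have n0: "p - 2 * n * N + n\<^sup>2 * q = 0" using pq by simp
    have "p * (q - 2 * m * N + m\<^sup>2 * p) = p * q - 2 * (N + e) * N + (N + e)\<^sup>2"
      using pq by (simp add: m_def power2_eq_square field_simps)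
    also have "\<dots> = 0" using e2 by algebra
    finally have m0: "q - 2 * m * N + m\<^sup>2 * p = 0" using pq by simp
    have "cdot (u - n *s v) (u - n *s v) = p - 2 * n * N + n\<^sup>2 * q"
      "cdot (v - m *s u) (v - m *s u) = q - 2 * m * N + m\<^sup>2 * p"
      by (simp_all add: cdot_linear p_def q_def N_def cdot_sym[of v u] algebra_simps power2_eq_square)
    then have "cdot z z = 0" "cdot w w = 0" unfolding z w cdot_linear(5,6) by (simp_all only: n0 m0 mult_zero_right)
    moreover have "z \<noteq> 0" "w \<noteq> 0" unfolding z w vector_mul_eq_0 using k not_par not_par' by simp_all
    moreover have "(v - w) $ i = (m *s z) $ i" "(u - z) $ i = (n *s w) $ i" for i
      using k by (simp_all add: z w field_simps)
    ultimately show "(N + e) / q = (N + e) / q \<and> z \<noteq> 0 \<and> w \<noteq> 0 \<and> cdot z z = 0 \<and> cdot w w = 0 \<and>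
      v - w = m *s z \<and> u - z = ((N + e) / q) *s w"
      unfolding n_def by (simp add: vec_eq_iff)
  qed
  show "diag_pairs (\<lambda>_. c) u v = {scalar_pair u v r, scalar_pair u v (- r)}"
  proof (intro equalityI subsetI)
    fix x assume x: "x \<in> diag_pairs (\<lambda>_. c) u v"
    obtain z w where zw: "x = (z, w)" by (cases x)
    from x obtain \<mu> \<nu> where *: "z \<noteq> 0" "w \<noteq> 0" "cdot z z = 0" "cdot w w = 0"
      "v - w = \<mu> *s (c *s z)" "u - z = \<nu> *s (c *s w)"
      by (auto simp: zw diag_pairs_def df diag)
    define m where "m = \<mu> * c"
    define n where "n = \<nu> * c"
    have vw: "v = w + m *s z" and uz: "u = z + n *s w"
      using *(5,6) by (simp_all add: m_def n_def vector_smult_assoc algebra_simps)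
    have N: "N = (1 + m * n) * cdot z w" and p: "p = 2 * n * cdot z w" and q: "q = 2 * m * cdot z w"
      unfolding N_def p_def q_def vw uz using *(3,4)
      by (simp_all add: cdot_linear cdot_sym[of w z] algebra_simps)
    have k: "1 - n * m \<noteq> 0"
    proof
      assume "1 - n * m = 0"
      then have "n * m = 1" by simp
      then have "u - n *s v = 0" by (simp add: vec_eq_iff vw uz algebra_simps)
      with not_par show False by blast
    qed
    \<comment> \<open>The square root of the discriminant selected by the given pair. The identity
      \<open>N + e = 2 * (m * n) * cdot z w\<close> shows that \<open>n\<close> and \<open>m\<close>
      use the same sign.\<close>
    define e where "e = m * n * cdot z w - cdot z w"
    have "r\<^sup>2 = e\<^sup>2" unfolding pq(3) N p q e_def by (simp add: algebra_simps power2_eq_square)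
    then have e: "e = r \<or> e = - r" by (metis power2_eq_iff)
    have Ne: "N + e = 2 * (m * n) * cdot z w" unfolding N e_def by (simp add: algebra_simps)
    have "(N + e) / q = n" "(N + e) / p = m" using pq(1,2) unfolding Ne by (auto simp: p q)
    then have "scalar_pair u v e = ((1 / (1 - n * m)) *s (u - n *s v), (1 / (1 - n * m)) *s (v - m *s u))"
      by (simp add: sp)
    also have "\<dots> = (z, w)"
    proof -
      have "u - n *s v = (1 - n * m) *s z" "v - m *s u = (1 - n * m) *s w"
        by (simp_all add: vec_eq_iff vw uz algebra_simps)
      then show ?thesis using k by (simp only: vector_smult_assoc) simp
    qed
    finally show "x \<in> {scalar_pair u v r, scalar_pair u v (- r)}" using e zw by auto
  next
    fix x assume "x \<in> {scalar_pair u v r, scalar_pair u v (- r)}"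
    then obtain e where e: "e = r \<or> e = - r" and x: "x = scalar_pair u v e" by auto
    obtain z w where zw: "scalar_pair u v e = (z, w)" by (cases "scalar_pair u v e")
    from sol[OF e, of z w] zw obtain n m where *: "z \<noteq> 0" "w \<noteq> 0" "cdot z z = 0" "cdot w w = 0"
      "v - w = m *s z" "u - z = n *s w" by auto
    have "v - w = (m / c) *s (c *s z)" "u - z = (n / c) *s (c *s w)"
      using * c by (simp_all add: vector_smult_assoc)
    then have "\<exists>\<mu>. v - w = \<mu> *s (c *s z)" "\<exists>\<nu>. u - z = \<nu> *s (c *s w)" by blast+
    then show "x \<in> diag_pairs (\<lambda>_. c) u v"
      unfolding x zw diag_pairs_def mem_Collect_eq prod.case df diag using *(1-4) by blast
  qed
  show "scalar_pair u v r \<noteq> scalar_pair u v (- r)"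
  proof
    assume eq: "scalar_pair u v r = scalar_pair u v (- r)"
    obtain z w where zw: "scalar_pair u v r = (z, w)" by (cases "scalar_pair u v r")
    have "u - z = ((N + r) / q) *s w" "w \<noteq> 0" using sol[of r z w] zw by auto
    moreover have "u - z = ((N + - r) / q) *s w" using sol[of "- r" z w] zw eq by auto
    ultimately have "((N + r) / q - (N + - r) / q) *s w = 0" "w \<noteq> 0"
      by (simp_all add: vector_sub_rdistrib)
    then have "(N + r) / q = (N + - r) / q" by simp
    then show False using pq nz(3) by (simp add: field_simps)
  qed
qed

lemma generic_diag_pairs_scalar:
  assumes c: "c \<noteq> 0"
  shows "generic (\<lambda>u v :: complex ^ 3. finite (diag_pairs (\<lambda>_. c) u v) \<and> card (diag_pairs (\<lambda>_. c) u v) = 2)"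
proof (rule generic_mono)
  let ?F = "\<lambda>u v :: complex ^ 3. cdot u u * cdot v v * ((cdot u v)\<^sup>2 - cdot u u * cdot v v)"
  have "poly_fun2 ?F" unfolding cdot_def by (intro poly_fun2_intros)
  moreover have "?F (vector [1, 0, 0]) (vector [1, 1, 0]) \<noteq> 0" by (simp add: cdot_def sum_3)
  ultimately show "generic (\<lambda>u v. ?F u v \<noteq> 0)" by (rule genericI)
  fix u v :: "complex ^ 3" assume F: "?F u v \<noteq> 0"
  define r where "r = csqrt ((cdot u v)\<^sup>2 - cdot u u * cdot v v)"
  have "r\<^sup>2 = (cdot u v)\<^sup>2 - cdot u u * cdot v v" "r \<noteq> 0" using F by (simp_all add: r_def)
  with diag_pairs_scalar[OF c, of u v r] F
  show "finite (diag_pairs (\<lambda>_. c) u v) \<and> card (diag_pairs (\<lambda>_. c) u v) = 2" by simp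
qed

text \<open>For v = conj u the discriminant is N^2 - |u.u|^2 with N the squared norm of
  \<open>u\<close>, and |u.u| is at most N. Its root \<open>r\<close> is therefore real, conjugation
  exchanges the two components of \<open>scalar_pair\<close>, and both critical pairs come from
  critical points.\<close>

lemma card_diag_critical_scalar:
  fixes u :: "complex ^ 'n" and s :: real
  assumes s: "s \<noteq> 0" and F: "cdot u u * ((cdot u (cvec u))\<^sup>2 - cdot u u * cdot (cvec u) (cvec u)) \<noteq> 0"
  shows "finite (diag_critical (\<lambda>_. of_real s) u)" "card (diag_critical (\<lambda>_. of_real s) u) = 2"
proof -
  define N where "N = (\<Sum>k\<in>UNIV. (cmod (u $ k))\<^sup>2)"
  have N: "cdot u (cvec u) = of_real N"
    unfolding N_def cdot_def of_real_sum complex_norm_square by simp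
  have q: "cdot u u * cdot (cvec u) (cvec u) = of_real ((cmod (cdot u u))\<^sup>2)"
    by (simp only: cdot_cvec complex_norm_square)
  have le: "cmod (cdot u u) \<le> N"
    unfolding cdot_def N_def by (rule order_trans[OF norm_sum]) (simp add: norm_mult power2_eq_square)
  define r where "r = sqrt (N\<^sup>2 - (cmod (cdot u u))\<^sup>2)"
  have ge: "N\<^sup>2 - (cmod (cdot u u))\<^sup>2 \<ge> 0" using power_mono[OF le, of 2] by simp
  have r: "(of_real r)\<^sup>2 = (cdot u (cvec u))\<^sup>2 - cdot u u * cdot (cvec u) (cvec u)"
    unfolding N q using ge by (simp add: r_def flip: of_real_power of_real_diff)
  have nz: "cdot u u \<noteq> 0" "cdot (cvec u) (cvec u) \<noteq> 0" "complex_of_real r \<noteq> 0"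
    using F r by (auto simp: cdot_cvec)
  let ?c = "\<lambda>_. complex_of_real s"
  have s': "complex_of_real s \<noteq> 0" using s by simp
  note pairs = diag_pairs_scalar[OF s' nz r]
  have snd: "snd (scalar_pair u (cvec u) (of_real e)) = cvec (fst (scalar_pair u (cvec u) (of_real e)))" for e
    by (simp add: scalar_pair_def Let_def cvec_linear cdot_cvec N mult.commute)
  have iff: "z \<in> diag_critical ?c u \<longleftrightarrow> (z, cvec z) \<in> diag_pairs ?c u (cvec u)" for z
  proof -
    have df: "dform ?c (cvec z) (cvec z) = cnj (dform ?c z z)" by (simp add: dform_def)
    have "cvec u - cvec z = \<mu> *s diag_mult ?c z \<longleftrightarrow> u - z = cnj \<mu> *s diag_mult ?c (cvec z)" for \<mu>
    proof -
      have "cvec u - cvec z = \<mu> *s diag_mult ?c z \<longleftrightarrow>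
          cvec (cvec u - cvec z) = cvec (\<mu> *s diag_mult ?c z)" by simp
      moreover have "cvec (diag_mult ?c z) = diag_mult ?c (cvec z)" by (simp add: vec_eq_iff)
      ultimately show ?thesis by (simp add: cvec_linear)
    qed
    then have "(\<exists>\<nu>. u - z = \<nu> *s diag_mult ?c (cvec z)) \<Longrightarrow> (\<exists>\<mu>. cvec u - cvec z = \<mu> *s diag_mult ?c z)"
      by (metis complex_cnj_cnj)
    then show ?thesis by (auto simp: diag_critical_def diag_pairs_def df)
  qed
  let ?z = "\<lambda>e. fst (scalar_pair u (cvec u) (of_real e))"
  have sp: "scalar_pair u (cvec u) (of_real e) = (?z e, cvec (?z e))" for e
    by (metis prod.collapse snd)
  define a where "a = ?z r"
  define b where "b = ?z (- r)"
  have ab: "scalar_pair u (cvec u) (of_real r) = (a, cvec a)"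
    "scalar_pair u (cvec u) (- of_real r) = (b, cvec b)"
    unfolding a_def b_def using sp[of r] sp[of "- r"] by simp_all
  have "diag_critical ?c u = {a, b}" using pairs(1) unfolding ab by (auto simp: iff)
  moreover have "a \<noteq> b" using pairs(2) unfolding ab by auto
  ultimately show "finite (diag_critical ?c u)" "card (diag_critical ?c u) = 2" by simp_all
qed

section \<open>Real data inside the space of pairs\<close>

lemma poly_fun2_line:
  assumes "poly_fun2 F"
  shows "\<exists>Q. \<forall>t. poly Q t = F (a + t *s b) (c + t *s d)"
proof -
  obtain p where p: "\<And>u v. F u v = peval (pair u v) p" using assms by (auto simp: poly_fun2_def)
  let ?c = "\<lambda>k. [: pair a c $ k, pair b d $ k :]"
  have "(\<chi> k. poly (?c k) t) = pair (a + t *s b) (c + t *s d)" for t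
  proof (subst vec_eq_iff, intro allI)
    fix k show "(\<chi> k. poly (?c k) t) $ k = pair (a + t *s b) (c + t *s d) $ k"
      by (cases k) simp_all
  qed
  then show ?thesis by (intro exI[of _ "mpoly_hom (\<lambda>a. [:a:]) ?c p"]) (simp add: poly_mpoly_hom p)
qed

text \<open>Along a line with real parameter, conjugation is polynomial.\<close>

lemma poly_fun2_conj_dense:
  fixes U :: "(complex ^ 'n) set"
  assumes F: "poly_fun2 F" "F u1 (cvec u1) \<noteq> 0" and U: "open U" "U \<noteq> {}"
  shows "\<exists>u\<in>U. F u (cvec u) \<noteq> 0"
proof -
  obtain u0 where u0: "u0 \<in> U" using U by blast
  define d where "d = u1 - u0"
  obtain Q where Q: "\<And>t. poly Q t = F (u0 + t *s d) (cvec u0 + t *s cvec d)"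
    using poly_fun2_line[OF F(1)] by blast
  have cv: "cvec u0 + of_real t *s cvec d = cvec (u0 + of_real t *s d)" for t by (simp add: cvec_linear)
  \<comment> \<open>Parameter 1 is the point \<open>u1\<close>, so \<open>Q\<close> is nonzero.
    Parameters near 0 lead into \<open>U\<close>, and infinitely many of them are real.\<close>
  have "poly Q 1 \<noteq> 0" unfolding Q using F(2) cv[of 1] by (simp add: d_def)
  then have "Q \<noteq> 0" by auto
  then have fin: "finite {t. poly Q t = 0}" by (rule poly_roots_finite)
  have "continuous_on UNIV (\<lambda>t :: real. u0 + of_real t *s d)"
    unfolding vector_scalar_mult_def by (intro continuous_intros)
  then have "open ((\<lambda>t :: real. u0 + of_real t *s d) -` U)" using U(1) by (rule open_vimage[rotated])
  moreover have "0 \<in> (\<lambda>t :: real. u0 + of_real t *s d) -` U" using u0 by simp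
  ultimately obtain e where e: "e > 0" "ball 0 e \<subseteq> (\<lambda>t :: real. u0 + of_real t *s d) -` U"
    using open_contains_ball by blast
  have "{0<..<e} \<subseteq> ball 0 e" by auto
  then have "infinite ((\<lambda>t :: real. u0 + of_real t *s d) -` U)"
    using e infinite_Ioo[OF e(1)] by (meson finite_subset order_trans)
  then have "infinite (complex_of_real ` ((\<lambda>t :: real. u0 + of_real t *s d) -` U))"
    by (simp add: finite_image_iff inj_on_def)
  then have "\<not> complex_of_real ` ((\<lambda>t :: real. u0 + of_real t *s d) -` U) \<subseteq> {t. poly Q t = 0}"
    using fin finite_subset by blast
  then obtain t :: real where "u0 + of_real t *s d \<in> U" "poly Q (of_real t) \<noteq> 0" by auto
  then show ?thesis unfolding Q cv by blast
qed

lemma poly_fun2_conj_open: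
  assumes "poly_fun2 F" shows "open {u. F u (cvec u) \<noteq> 0}"
proof -
  obtain p where p: "\<And>u v. F u v = peval (pair u v) p" using assms by (auto simp: poly_fun2_def)
  have "continuous_on UNIV (\<lambda>u. peval (pair u (cvec u)) p)"
  proof (induction p rule: mpoly_induct)
    case (Var k)
    then show ?case by (cases k) (auto intro!: continuous_intros)
  qed (auto intro!: continuous_intros)
  then show ?thesis unfolding p by (intro open_Collect_neq continuous_intros) auto
qed

lemma (in takagi_form) degrees_conic_scalar:
  assumes "\<And>k. \<sigma> k = s" "s \<noteq> 0"
  shows "vHDdeg {z. qform A z = 0} = 2" "HDdeg {z. qform A z = 0} = {2}"
proof -
  have cs: "cs = (\<lambda>_. of_real s)" using assms(1) by auto
  have nz: "\<sigma> k \<noteq> 0" for k using assms by simp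
  show "vHDdeg {z. qform A z = 0} = 2"
    by (rule vHDdeg_conic[OF nz]) (use assms(2) in \<open>simp add: cs generic_diag_pairs_scalar\<close>)
  define F where "F = (\<lambda>u v :: complex ^ 3. cdot u u * ((cdot u v)\<^sup>2 - cdot u u * cdot v v))"
  define G where "G = (\<lambda>u v. F (conj_transpose U *v u) (cvec (conj_transpose U *v cvec v)))"
  have "poly_fun2 F" unfolding F_def cdot_def by (intro poly_fun2_intros)
  then have G: "poly_fun2 G" unfolding G_def by (rule poly_fun2_compose) (rule poly_fun2_matrix)+
  \<comment> \<open>Here \<open>cdot u u\<close> is 3/4 and \<open>cdot u (cvec u)\<close> is 5/4,
    so the discriminant is 1; a real vector would give 0.\<close>
  have "F (vector [1, \<i> / 2, 0]) (cvec (vector [1, \<i> / 2, 0])) \<noteq> 0"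
    by (simp add: F_def cdot_def sum_3 power2_eq_square)
  then have G1: "G (U *v vector [1, \<i> / 2, 0]) (cvec (U *v vector [1, \<i> / 2, 0])) \<noteq> 0"
    by (simp add: G_def)
  have count: "HD_count {z. qform A z = 0} u 2" if "G u (cvec u) \<noteq> 0" for u
    using that card_diag_critical_scalar[OF assms(2), of "conj_transpose U *v u"]
    by (intro HD_count_conic[OF nz]) (simp_all add: cs G_def F_def)
  show "HDdeg {z. qform A z = 0} = {2}"
  proof (rule HDdeg_eqI[of _ _ "{u. G u (cvec u) \<noteq> 0}"])
    fix V :: "(complex ^ 3) set" assume "open V" "V \<noteq> {}"
    then show "\<exists>u\<in>V. HD_count {z. qform A z = 0} u 2"
      using poly_fun2_conj_dense[of G, OF G G1] count by blast
  qed (use count poly_fun2_conj_open[OF G] G1 in auto)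
qed

section \<open>Simple roots\<close>

definition simple_roots :: "complex poly \<Rightarrow> bool" where
  "simple_roots p \<longleftrightarrow> (\<forall>x. poly p x = 0 \<longrightarrow> poly (pderiv p) x \<noteq> 0)"

lemma card_simple_roots:
  assumes "simple_roots p" "p \<noteq> 0"
  shows "card {x. poly p x = 0} = degree p"
proof -
  have "rsquarefree p" using assms by (auto simp: rsquarefree_roots simple_roots_def)
  from complex_poly_decompose_rsquarefree[OF this]
  have "degree p = degree (smult (lead_coeff p) (\<Prod>z | poly p z = 0. [:- z, 1:]))" by simp
  also have "\<dots> = card {x. poly p x = 0}" using assms(2) by (simp add: degree_prod_sum_eq)
  finally show ?thesis by simp
qed

lemma simple_roots_if_card:
  assumes p: "p \<noteq> 0" "degree p \<le> card {x. poly p x = 0}"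
  shows "simple_roots p"
  unfolding simple_roots_def
proof (intro allI impI notI)
  fix a assume a: "poly p a = 0" "poly (pderiv p) a = 0"
  obtain h where h: "p = [:- a, 1:] * h" using a(1) by (auto simp: poly_eq_0_iff_dvd)
  have "poly (pderiv p) a = poly h a" unfolding h by (simp only: pderiv_mult) (simp add: pderiv_pCons)
  with a(2) obtain g where g: "h = [:- a, 1:] * g" by (auto simp: poly_eq_0_iff_dvd)
  have g0: "g \<noteq> 0" "h \<noteq> 0" using p(1) by (auto simp: h g)
  then have deg: "degree p = Suc (Suc (degree g))" unfolding h g by (simp add: degree_mult_eq del: mult_pCons_left)
  have "{x. poly p x = 0} = insert a {x. poly g x = 0}" by (auto simp: h g)
  then have "card {x. poly p x = 0} \<le> Suc (card {x. poly g x = 0})" by (simp add: card_insert_le_m1 card_insert_if poly_roots_finite[OF g0(1)])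
  also have "\<dots> \<le> Suc (degree g)" using card_poly_roots_bound[OF g0(1)] by simp
  finally show False using p(2) deg by simp
qed

text \<open>A multiple root of p + \<delta> q is a zero of the Wronskian p q' - p' q, and it
  determines \<delta> as - p / q there. A nonzero Wronskian thus leaves finitely many bad
  members.\<close>

lemma pencil_simple_roots:
  fixes p q :: "complex poly"
  assumes common: "\<And>x. poly p x = 0 \<Longrightarrow> poly q x \<noteq> 0" and q: "degree q \<noteq> 0"
  shows "finite {\<delta>. \<not> simple_roots (p + smult \<delta> q)}"
proof -
  define W where "W = p * pderiv q - pderiv p * q"
  have q': "q \<noteq> 0" "pderiv q \<noteq> 0" using q by (auto simp: pderiv_eq_0_iff)
  have "\<not> constant (poly q)" using q by (simp add: constant_degree)
  then obtain r where r: "poly q r = 0" using fundamental_theorem_of_algebra by blast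
  then have pr: "poly p r \<noteq> 0" using common by blast
  have "W \<noteq> 0"
  proof
    assume "W = 0"
    then have eq: "p * pderiv q = pderiv p * q" by (simp add: W_def)
    have "p * pderiv q \<noteq> 0" using pr q' by auto
    then have nz: "p * pderiv q \<noteq> 0" "pderiv p * q \<noteq> 0" using eq by auto
    \<comment> \<open>At a root of \<open>q\<close> differentiation lowers the order of
      \<open>q\<close> by one, so the first product has smaller order there than the second and the
      two cannot cancel.\<close>
    have "order r (p * pderiv q) = order r (pderiv q)"
      unfolding order_mult[OF nz(1)] using pr by (simp add: order_0I)
    moreover have "order r (pderiv p * q) = order r (pderiv p) + Suc (order r (pderiv q))"
      unfolding order_mult[OF nz(2)] using order_pderiv[OF q'(1), of r] r q' by (simp add: order_root)
    ultimately show False using eq by simp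
  qed
  then have fin: "finite ((\<lambda>x. - poly p x / poly q x) ` {x. poly W x = 0})"
    by (intro finite_imageI poly_roots_finite)
  have "{\<delta>. \<not> simple_roots (p + smult \<delta> q)} \<subseteq> (\<lambda>x. - poly p x / poly q x) ` {x. poly W x = 0}"
  proof
    fix \<delta> assume "\<delta> \<in> {\<delta>. \<not> simple_roots (p + smult \<delta> q)}"
    then obtain x where x: "poly p x + \<delta> * poly q x = 0" "poly (pderiv p) x + \<delta> * poly (pderiv q) x = 0"
      by (auto simp: simple_roots_def pderiv_add pderiv_smult)
    then have p: "poly p x = - \<delta> * poly q x" "poly (pderiv p) x = - \<delta> * poly (pderiv q) x"
      by (simp_all add: add_eq_0_iff2)
    have "poly q x \<noteq> 0" using common[of x] p(1) by auto
    moreover have "poly W x = 0" by (simp add: W_def p)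
    ultimately show "\<delta> \<in> (\<lambda>x. - poly p x / poly q x) ` {x. poly W x = 0}"
      using p(1) by (intro image_eqI[of _ _ x]) auto
  qed
  with fin show ?thesis by (rule finite_subset[rotated])
qed

section \<open>Univariate polynomials with coefficients polynomial in the data\<close>

definition poly_family :: "(complex ^ 'n \<Rightarrow> complex ^ 'n \<Rightarrow> complex poly) \<Rightarrow> bool" where
  "poly_family E \<longleftrightarrow> (\<forall>i. poly_fun2 (\<lambda>u v. coeff (E u v) i))"

lemma poly_family_const: "poly_family (\<lambda>u v. p)"
  by (auto simp: poly_family_def)

lemma poly_family_coeff: "poly_fun2 F \<Longrightarrow> poly_family (\<lambda>u v. [:F u v:])"
  unfolding poly_family_def
proof
  fix i assume "poly_fun2 F"
  then show "poly_fun2 (\<lambda>u v. coeff [:F u v:] i)" by (cases i) auto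
qed

lemma poly_family_add: "poly_family E \<Longrightarrow> poly_family F \<Longrightarrow> poly_family (\<lambda>u v. E u v + F u v)"
  unfolding poly_family_def coeff_add by (intro allI poly_fun2_intros) auto

lemma poly_family_diff: "poly_family E \<Longrightarrow> poly_family F \<Longrightarrow> poly_family (\<lambda>u v. E u v - F u v)"
  unfolding poly_family_def coeff_diff by (intro allI poly_fun2_intros) auto

lemma poly_family_mult: "poly_family E \<Longrightarrow> poly_family F \<Longrightarrow> poly_family (\<lambda>u v. E u v * F u v)"
  unfolding poly_family_def coeff_mult by (intro allI poly_fun2_intros) auto

lemma poly_family_power: "poly_family E \<Longrightarrow> poly_family (\<lambda>u v. E u v ^ n)"
  by (induction n) (auto intro: poly_family_const poly_family_mult)

lemma poly_family_pderiv: "poly_family E \<Longrightarrow> poly_family (\<lambda>u v. pderiv (E u v))"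
  unfolding poly_family_def coeff_pderiv by (intro allI poly_fun2_intros) auto

lemmas poly_family_intros = poly_family_const poly_family_coeff poly_family_add poly_family_diff
  poly_family_mult poly_family_power

lemma poly_sum_degree: "degree (p :: complex poly) < n \<Longrightarrow> poly p x = (\<Sum>i<n. coeff p i * x ^ i)"
  unfolding poly_altdef by (rule sum.mono_neutral_left) (auto simp: coeff_eq_0)

text \<open>The matrix is the Sylvester matrix of \<open>E\<close> and its derivative; a common root yields a left
  kernel vector of powers, and the right kernel is trivial when there are \<open>d\<close> distinct roots. The
  type \<open>'m\<close> only provides an index set of size \<open>2 d - 1\<close>.\<close>

lemma generic_simple_roots:
  fixes E :: "complex ^ 'n \<Rightarrow> complex ^ 'n \<Rightarrow> complex poly"
  assumes fam: "poly_family E" and deg: "\<And>u v. degree (E u v) \<le> d" and d: "d \<ge> 1"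
    and m: "CARD('m::finite) = 2 * d - 1"
    and w: "E u0 v0 \<noteq> 0" "card {x. poly (E u0 v0) x = 0} \<ge> d"
  shows "generic (\<lambda>u v. degree (E u v) = d \<and> simple_roots (E u v))"
proof -
  obtain e :: "'m \<Rightarrow> nat" where e: "bij_betw e UNIV {..<2 * d - 1}"
    using ex_bij_betw_finite_nat[of "UNIV :: 'm set"] m by (auto simp: atLeast0LessThan)
  then have e_inj: "e i = e j \<longleftrightarrow> i = j" for i j by (auto simp: bij_betw_def inj_on_def)
  have e_lt: "e i < 2 * d - 1" for i using e by (auto simp: bij_betw_def)
  have e_surj: "\<exists>i. e i = k" if "k < 2 * d - 1" for k
  proof -
    have "k \<in> range e" using e that by (simp add: bij_betw_def)
    then show ?thesis by auto
  qed
  \<comment> \<open>There are \<open>d - 1\<close> columns of shifts of \<open>E\<close> and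
    \<open>d\<close> columns of shifts of its derivative; all have degree below
    \<open>2 * d - 1\<close>.\<close>
  define col where "col = (\<lambda>u v j. if e j < d - 1 then monom 1 (e j) * E u v
    else monom 1 (e j - (d - 1)) * pderiv (E u v))"
  define M :: "complex ^ 'n \<Rightarrow> complex ^ 'n \<Rightarrow> complex ^ 'm ^ 'm" where
    "M = (\<lambda>u v. \<chi> i j. coeff (col u v j) (e i))"
  have col_deg: "degree (col u v j) < 2 * d - 1" for u v j
  proof (cases "e j < d - 1")
    case True
    have "degree (monom 1 (e j) * E u v) \<le> e j + d"
      by (rule order_trans[OF degree_mult_le]) (intro add_mono degree_monom_le deg)
    with True d show ?thesis by (simp add: col_def)
  next
    case False
    have "degree (monom 1 (e j - (d - 1)) * pderiv (E u v)) \<le> (e j - (d - 1)) + (d - 1)"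
      by (rule order_trans[OF degree_mult_le])
        (intro add_mono degree_monom_le, use deg[of u v] in \<open>simp add: degree_pderiv\<close>)
    with False e_lt[of j] show ?thesis by (simp add: col_def)
  qed
  have col_fam: "poly_family (\<lambda>u v. col u v j)" for j
    unfolding col_def by (cases "e j < d - 1") (simp_all add: poly_family_mult poly_family_const poly_family_pderiv fam)
  have "poly_fun2 (\<lambda>u v. M u v $ i $ j)" for i j
    using col_fam[of j] by (simp add: M_def poly_family_def)
  then have det_fun: "poly_fun2 (\<lambda>u v. det (M u v))" unfolding det_def by (intro poly_fun2_intros)
  have deg0: "degree (E u0 v0) = d"
    using card_poly_roots_bound[OF w(1)] w(2) deg[of u0 v0] by simp
  have simple0: "simple_roots (E u0 v0)" using simple_roots_if_card[OF w(1)] w(2) deg0 by simp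
  have "det (M u0 v0) \<noteq> 0"
  proof -
    have "x = 0" if x: "M u0 v0 *v x = 0" for x
    proof -
      define a where "a = (\<Sum>j\<in>{j. e j < d - 1}. monom (x $ j) (e j))"
      define b where "b = (\<Sum>j\<in>- {j. e j < d - 1}. monom (x $ j) (e j - (d - 1)))"
      define P where "P = (\<Sum>j\<in>UNIV. smult (x $ j) (col u0 v0 j))"
      have "P = (\<Sum>j\<in>{j. e j < d - 1}. smult (x $ j) (col u0 v0 j)) + (\<Sum>j\<in>- {j. e j < d - 1}. smult (x $ j) (col u0 v0 j))"
        unfolding P_def by (subst sum.union_disjoint[symmetric]) (auto simp: Compl_partition)
      also have "(\<Sum>j\<in>{j. e j < d - 1}. smult (x $ j) (col u0 v0 j)) = a * E u0 v0"
        unfolding a_def sum_distrib_right by (intro sum.cong refl) (simp add: col_def smult_monom flip: mult_smult_left)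
      also have "(\<Sum>j\<in>- {j. e j < d - 1}. smult (x $ j) (col u0 v0 j)) = b * pderiv (E u0 v0)"
        unfolding b_def sum_distrib_right by (intro sum.cong refl) (simp add: col_def smult_monom flip: mult_smult_left)
      finally have P: "P = a * E u0 v0 + b * pderiv (E u0 v0)" .
      have "coeff P k = 0" for k
      proof (cases "k < 2 * d - 1")
        case True
        then obtain i where i: "e i = k" using e_surj by blast
        have "coeff P k = (M u0 v0 *v x) $ i"
          by (simp add: P_def coeff_sum M_def matrix_vector_mult_def i mult.commute)
        then show ?thesis by (simp add: x)
      next
        case False
        have "coeff (col u0 v0 j) k = 0" for j using col_deg[of u0 v0 j] False by (intro coeff_eq_0) linarith
        then show ?thesis by (simp add: P_def coeff_sum)
      qed
      then have P0: "a * E u0 v0 + b * pderiv (E u0 v0) = 0" unfolding P[symmetric] by (intro poly_eqI) simp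
      have b_roots: "poly b r = 0" if "poly (E u0 v0) r = 0" for r
      proof -
        have "poly (a * E u0 v0 + b * pderiv (E u0 v0)) r = 0" unfolding P0 by simp
        then show ?thesis using that simple0 by (simp add: simple_roots_def)
      qed
      \<comment> \<open>\<open>b\<close> has degree at most \<open>d - 1\<close> but vanishes at the
        \<open>d\<close> distinct roots of \<open>E u0 v0\<close>.\<close>
      have "b = 0"
      proof (rule ccontr)
        assume b: "b \<noteq> 0"
        have "degree b \<le> d - 1" unfolding b_def
        proof (intro degree_sum_le order_trans[OF degree_monom_le])
          show "e j - (d - 1) \<le> d - 1" for j using e_lt[of j] by linarith
        qed simp
        moreover have "card {r. poly (E u0 v0) r = 0} \<le> card {r. poly b r = 0}"
          using b_roots by (intro card_mono poly_roots_finite b) auto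
        ultimately show False using card_poly_roots_bound[OF b] w(2) d by linarith
      qed
      then have "a = 0" using P0 w(1) by simp
      have "x $ j = 0" for j
      proof (cases "e j < d - 1")
        case True
        have "coeff a (e j) = x $ j" using True by (simp add: a_def coeff_sum e_inj)
        with \<open>a = 0\<close> show ?thesis by simp
      next
        case False
        have "coeff b (e j - (d - 1)) = (\<Sum>k\<in>- {j. e j < d - 1}. if k = j then x $ k else 0)"
          unfolding b_def coeff_sum
          by (intro sum.cong refl) (use False in \<open>auto simp: e_inj[symmetric]\<close>)
        also have "\<dots> = x $ j" using False by simp
        finally show ?thesis using \<open>b = 0\<close> by simp
      qed
      then show "x = 0" by (simp add: vec_eq_iff)
    qed
    then show ?thesis
      by (metis invertible_det_nz invertible_left_inverse matrix_left_invertible_ker)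
  qed
  then have "generic (\<lambda>u v. det (M u v) \<noteq> 0)" by (rule genericI[OF det_fun])
  moreover have "generic (\<lambda>u v. coeff (E u v) d \<noteq> 0)"
    by (rule genericI[of _ u0 v0]) (use fam w(1) deg0 in \<open>auto simp: poly_family_def\<close>)
  ultimately have "generic (\<lambda>u v. det (M u v) \<noteq> 0 \<and> coeff (E u v) d \<noteq> 0)" by (rule generic_conj)
  then show ?thesis
  proof (rule generic_mono)
    fix u v assume *: "det (M u v) \<noteq> 0 \<and> coeff (E u v) d \<noteq> 0"
    have "degree (E u v) = d" using * deg[of u v] le_degree[of "E u v" d] by simp
    moreover have "simple_roots (E u v)"
      unfolding simple_roots_def
    proof (intro allI impI notI)
      fix t assume t: "poly (E u v) t = 0" "poly (pderiv (E u v)) t = 0"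
      \<comment> \<open>The powers of the common root, annihilated by every column; the vector is
        nonzero even for \<open>t = 0\<close> because its entry of exponent 0 is 1.\<close>
      define y :: "complex ^ 'm" where "y = (\<chi> i. t ^ e i)"
      have "(transpose (M u v) *v y) $ j = 0" for j
      proof -
        have "(transpose (M u v) *v y) $ j = (\<Sum>i\<in>UNIV. coeff (col u v j) (e i) * t ^ e i)"
          by (simp add: matrix_vector_mult_def transpose_def M_def y_def)
        also have "\<dots> = (\<Sum>k<2 * d - 1. coeff (col u v j) k * t ^ k)"
          by (rule sum.reindex_bij_betw[OF e])
        also have "\<dots> = poly (col u v j) t" by (rule poly_sum_degree[OF col_deg, symmetric])
        also have "\<dots> = 0" by (simp add: col_def t)
        finally show ?thesis .
      qed
      then have "transpose (M u v) *v y = 0" by (simp add: vec_eq_iff)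
      moreover have "det (transpose (M u v)) \<noteq> 0" using * by (simp add: det_transpose)
      ultimately have "y = 0"
        by (metis invertible_det_nz invertible_left_inverse matrix_left_invertible_ker)
      moreover obtain i where "e i = 0" using e_surj[of 0] d by auto
      then have "y $ i = 1" by (simp add: y_def)
      ultimately show False by simp
    qed
    ultimately show "degree (E u v) = d \<and> simple_roots (E u v)" by simp
  qed
qed

section \<open>Critical pairs as roots of an eliminant\<close>

definition det3 :: "'a::comm_ring_1 ^ 3 \<Rightarrow> 'a ^ 3 \<Rightarrow> 'a ^ 3 \<Rightarrow> 'a" where
  "det3 a b c = a $ 1 * (b $ 2 * c $ 3 - b $ 3 * c $ 2) - a $ 2 * (b $ 1 * c $ 3 - b $ 3 * c $ 1) +
     a $ 3 * (b $ 1 * c $ 2 - b $ 2 * c $ 1)"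

definition alpha :: "(3 \<Rightarrow> 'a::comm_ring_1) \<Rightarrow> 'a ^ 3 \<Rightarrow> 'a ^ 3 \<Rightarrow> 'a" where
  "alpha \<sigma> u z = det3 u z (diag_mult \<sigma> (diag_mult \<sigma> z))"

definition beta :: "(3 \<Rightarrow> 'a::comm_ring_1) \<Rightarrow> 'a ^ 3 \<Rightarrow> 'a ^ 3 \<Rightarrow> 'a ^ 3 \<Rightarrow> 'a" where
  "beta \<sigma> u v z = det3 u z (diag_mult \<sigma> v)"

text \<open>If \<open>u = z + \<nu> D w\<close> and \<open>v = w + \<mu> D z\<close>, then \<open>beta = \<mu> alpha\<close>, so \<open>w\<close> is proportional to
  \<open>alpha v - beta D z\<close>. The eliminant is the value of the quadratic form at this vector.\<close>

definition eliminant :: "(3 \<Rightarrow> 'a::comm_ring_1) \<Rightarrow> 'a ^ 3 \<Rightarrow> 'a ^ 3 \<Rightarrow> 'a ^ 3 \<Rightarrow> 'a" where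
  "eliminant \<sigma> u v z = (alpha \<sigma> u z)\<^sup>2 * dform \<sigma> v v -
     2 * alpha \<sigma> u z * beta \<sigma> u v z * dform \<sigma> v (diag_mult \<sigma> z) +
     (beta \<sigma> u v z)\<^sup>2 * dform \<sigma> z (diag_mult \<sigma> (diag_mult \<sigma> z))"

text \<open>The affine chart of the projective parametrization: second parameter 1, rescaled from
  the standard conic to D. The chart misses only \<open>conic_infinity\<close>, where the second
  parameter is 0.\<close>

definition conic_point :: "(3 \<Rightarrow> complex) \<Rightarrow> complex \<Rightarrow> complex ^ 3" where
  "conic_point \<sigma> x = (\<chi> k. isotropic x 1 $ k / csqrt (\<sigma> k))"

definition conic_infinity :: "(3 \<Rightarrow> complex) \<Rightarrow> complex ^ 3" where
  "conic_infinity \<sigma> = (\<chi> k. isotropic 1 0 $ k / csqrt (\<sigma> k))"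

abbreviation dinv :: "(3 \<Rightarrow> complex) \<Rightarrow> complex ^ 3 \<Rightarrow> complex ^ 3" where
  "dinv \<sigma> \<equiv> diag_mult (\<lambda>k. 1 / \<sigma> k)"

lemma det3_combination: "det3 (c *s a + d *s b) a b = 0"
  by (simp add: det3_def algebra_simps)

lemma cramer3:
  fixes a1 a2 a3 b1 b2 b3 u1 u2 u3 :: complex
  assumes "u1 * (a2 * b3 - a3 * b2) - u2 * (a1 * b3 - a3 * b1) + u3 * (a1 * b2 - a2 * b1) = 0"
    and "a1 * b2 - a2 * b1 \<noteq> 0"
  shows "\<exists>k l. u1 = k * a1 + l * b1 \<and> u2 = k * a2 + l * b2 \<and> u3 = k * a3 + l * b3"
proof -
  define n where "n = a1 * b2 - a2 * b1"
  define k where "k = (u1 * b2 - u2 * b1) / n"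
  define l where "l = (a1 * u2 - a2 * u1) / n"
  have kl: "n * k = u1 * b2 - u2 * b1" "n * l = a1 * u2 - a2 * u1" and n: "n \<noteq> 0"
    using assms(2) by (simp_all add: k_def l_def n_def)
  have "n * u1 = n * k * a1 + n * l * b1" "n * u2 = n * k * a2 + n * l * b2"
    unfolding kl by (simp_all add: n_def algebra_simps)
  moreover have "n * u3 = n * k * a3 + n * l * b3"
    unfolding kl unfolding n_def using assms(1) by algebra
  ultimately have "n * u1 = n * (k * a1 + l * b1)" "n * u2 = n * (k * a2 + l * b2)"
    "n * u3 = n * (k * a3 + l * b3)" by (simp_all add: algebra_simps)
  then show ?thesis using n by (metis mult_left_cancel)
qed

lemma det3_dependent:
  fixes u a b :: "complex ^ 3"
  assumes "det3 u a b = 0" "a \<noteq> 0" "\<nexists>c. b = c *s a"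
  shows "\<exists>k l. u = k *s a + l *s b"
proof -
  have "\<not> (\<forall>i j. b $ i * a $ j = b $ j * a $ i)" using parallel_if_minors[OF assms(2), of b] assms(3) by blast
  then have "a $ 1 * b $ 2 - a $ 2 * b $ 1 \<noteq> 0 \<or> a $ 1 * b $ 3 - a $ 3 * b $ 1 \<noteq> 0 \<or>
      a $ 2 * b $ 3 - a $ 3 * b $ 2 \<noteq> 0"
    by (auto simp: forall_3 mult.commute)
  then have "\<exists>k l. u $ 1 = k * a $ 1 + l * b $ 1 \<and> u $ 2 = k * a $ 2 + l * b $ 2 \<and> u $ 3 = k * a $ 3 + l * b $ 3"
  proof (elim disjE)
    assume *: "a $ 1 * b $ 2 - a $ 2 * b $ 1 \<noteq> 0"
    show ?thesis by (rule cramer3[OF _ *]) (use assms(1) in \<open>simp add: det3_def\<close>)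
  next
    assume *: "a $ 1 * b $ 3 - a $ 3 * b $ 1 \<noteq> 0"
    have "u $ 1 * (a $ 3 * b $ 2 - a $ 2 * b $ 3) - u $ 3 * (a $ 1 * b $ 2 - a $ 2 * b $ 1) +
        u $ 2 * (a $ 1 * b $ 3 - a $ 3 * b $ 1) = - det3 u a b" by (simp add: det3_def algebra_simps)
    then show ?thesis using cramer3[OF _ *, where ?u1.0 = "u $ 1" and ?a3.0 = "a $ 2" and ?b3.0 = "b $ 2" and ?u2.0 = "u $ 3" and ?u3.0 = "u $ 2"] assms(1) by auto
  next
    assume *: "a $ 2 * b $ 3 - a $ 3 * b $ 2 \<noteq> 0"
    have "u $ 2 * (a $ 3 * b $ 1 - a $ 1 * b $ 3) - u $ 3 * (a $ 2 * b $ 1 - a $ 1 * b $ 2) +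
        u $ 1 * (a $ 2 * b $ 3 - a $ 3 * b $ 2) = det3 u a b" by (simp add: det3_def algebra_simps)
    then show ?thesis using cramer3[OF _ *, where ?u1.0 = "u $ 2" and ?a3.0 = "a $ 1" and ?b3.0 = "b $ 1" and ?u2.0 = "u $ 3" and ?u3.0 = "u $ 1"] assms(1) by auto
  qed
  then show ?thesis by (simp add: vec_eq_iff forall_3)
qed

text \<open>In the rescaled coordinates \<open>P\<close>, minus \<open>B\<close> is the square of
  the second parameter of \<open>isotropic\<close>, up to the scale of \<open>z\<close>. So
  \<open>B = 0\<close> is the point at infinity, and otherwise dividing the third coordinate by
  \<open>- B\<close> recovers \<open>x\<close>.\<close>

lemma conic_point_cases:
  assumes \<sigma>: "\<And>k. \<sigma> k \<noteq> 0" and z: "z \<noteq> 0" "dform \<sigma> z z = 0"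
  obtains c where "c \<noteq> 0" "z = c *s conic_infinity \<sigma>" | c x where "c \<noteq> 0" "z = c *s conic_point \<sigma> x"
proof -
  define P where "P = (\<lambda>k. csqrt (\<sigma> k) * z $ k)"
  have P: "P 1 * P 1 + P 2 * P 2 + P 3 * P 3 = 0"
  proof -
    have "P k * P k = \<sigma> k * z $ k * z $ k" for k
      using power2_csqrt[of "\<sigma> k"] by (simp add: P_def power2_eq_square mult_ac)
    then show ?thesis using z(2) by (simp add: dform_def sum_3)
  qed
  have zP: "z $ k = P k / csqrt (\<sigma> k)" for k using \<sigma>[of k] by (simp add: P_def)
  define B where "B = P 1 - \<i> * P 2"
  define C where "C = P 1 + \<i> * P 2"
  have "B * C = P 1 * P 1 + P 2 * P 2" by (simp add: B_def C_def algebra_simps)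
  then have BC: "B * C = - (P 3 * P 3)" using P by (simp add: eq_neg_iff_add_eq_0)
  have P1: "P 1 = (C + B) / 2" and P2: "P 2 = (C - B) / (2 * \<i>)" by (simp_all add: B_def C_def field_simps)
  show thesis
  proof (cases "B = 0")
    case True
    then have P3: "P 3 = 0" using BC by simp
    have "z = C *s conic_infinity \<sigma>"
      using True P3 by (simp add: vec_eq_iff forall_3 conic_infinity_def zP P1 P2)
    moreover have "C \<noteq> 0" using calculation z(1) by auto
    ultimately show ?thesis using that(1) by blast
  next
    case False
    define x where "x = P 3 / - B"
    have C: "C = - B * x\<^sup>2" using BC False by (simp add: x_def field_simps power2_eq_square)
    have "P k = - B * isotropic x 1 $ k" for k
      using exhaust_3[of k] False by (auto simp: P1 P2 C) (simp_all add: x_def field_simps)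
    then have "z = (- B) *s conic_point \<sigma> x"
      by (simp add: vec_eq_iff conic_point_def zP)
    then show ?thesis using that(2)[of "- B"] False by simp
  qed
qed

lemma conic_point_inj:
  assumes \<sigma>: "\<And>k. \<sigma> k \<noteq> 0" and eq: "c *s conic_point \<sigma> x = d *s conic_point \<sigma> y" and c: "c \<noteq> 0"
  shows "x = y"
proof -
  have "c * isotropic x 1 $ k = d * isotropic y 1 $ k" for k
    using arg_cong[OF eq, of "\<lambda>z. z $ k"] \<sigma>[of k] by (simp add: conic_point_def)
  from this[of 1] this[of 2] this[of 3]
  have e: "c * (x\<^sup>2 - 1) = d * (y\<^sup>2 - 1)" "c * (x\<^sup>2 + 1) = d * (y\<^sup>2 + 1)" "c * x = d * y" by simp_all
  have "2 * c = 2 * d" using e(1,2) by algebra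
  then show ?thesis using e(3) c by simp
qed

lemma dform_conic_point:
  assumes \<sigma>: "\<And>k. \<sigma> k \<noteq> 0"
  shows "dform \<sigma> (conic_point \<sigma> x) (conic_point \<sigma> x) = 0" "conic_point \<sigma> x \<noteq> 0"
    "dform \<sigma> (conic_infinity \<sigma>) (conic_infinity \<sigma>) = 0"
proof -
  have *: "\<sigma> k * (a / csqrt (\<sigma> k)) * (b / csqrt (\<sigma> k)) = a * b" for k a b
    using \<sigma>[of k] power2_csqrt[of "\<sigma> k"] by (simp add: field_simps power2_eq_square)
  show "dform \<sigma> (conic_point \<sigma> x) (conic_point \<sigma> x) = 0"
    "dform \<sigma> (conic_infinity \<sigma>) (conic_infinity \<sigma>) = 0"
    unfolding dform_def conic_point_def conic_infinity_def vec_lambda_beta * sum_3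
    by (simp_all add: field_simps power2_eq_square)
  show "conic_point \<sigma> x \<noteq> 0"
  proof
    assume "conic_point \<sigma> x = 0"
    then have "isotropic x 1 $ k = 0" for k
      using \<sigma>[of k] by (metis (mono_tags) conic_point_def csqrt_eq_0 divide_eq_0_iff vec_lambda_beta zero_index)
    from this[of 1] this[of 2] have "x\<^sup>2 - 1 = 0" "x\<^sup>2 + 1 = 0" by simp_all
    then have "(2::complex) = 0" by algebra
    then show False by simp
  qed
qed

lemma diag_mult_linear:
  fixes x y :: "complex ^ 'n"
  shows "diag_mult \<sigma> (x + y) = diag_mult \<sigma> x + diag_mult \<sigma> y"
    "diag_mult \<sigma> (x - y) = diag_mult \<sigma> x - diag_mult \<sigma> y"
    "diag_mult \<sigma> (c *s x) = c *s diag_mult \<sigma> x"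
  by (simp_all add: vec_eq_iff algebra_simps)

lemma dform_linear:
  fixes x y :: "complex ^ 'n"
  shows "dform \<sigma> (c *s x) y = c * dform \<sigma> x y" "dform \<sigma> x (c *s y) = c * dform \<sigma> x y"
  by (simp_all add: dform_def sum_distrib_left mult_ac)

lemma dform_mult_dinv:
  fixes \<sigma> :: "'n::finite \<Rightarrow> complex"
  assumes "\<And>k. \<sigma> k \<noteq> 0"
  shows "dform (\<lambda>k. 1 / \<sigma> k) (diag_mult \<sigma> x) (diag_mult \<sigma> x) = dform \<sigma> x x"
  unfolding dform_def by (intro sum.cong refl) (simp add: assms field_simps)

lemma alpha_beta_scale:
  fixes u v z :: "complex ^ 3"
  shows "alpha \<sigma> u (c *s z) = c\<^sup>2 * alpha \<sigma> u z" "beta \<sigma> u v (c *s z) = c * beta \<sigma> u v z"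
  by (simp_all add: alpha_def beta_def det3_def algebra_simps power2_eq_square)

text \<open>The origin of \<open>alpha\<close> and \<open>beta\<close>: the equation for
  \<open>u\<close> makes u, z, D w dependent, and for w = v - m D z the determinant is affine in
  \<open>m\<close>.\<close>

lemma det3_eq_beta_alpha:
  fixes u v z :: "complex ^ 3"
  shows "det3 u z (diag_mult \<sigma> (v - m *s diag_mult \<sigma> z)) = beta \<sigma> u v z - m * alpha \<sigma> u z"
  by (simp add: alpha_def beta_def det3_def algebra_simps)

lemma alpha_square_dform:
  fixes u v z :: "complex ^ 3"
  assumes "beta \<sigma> u v z = m * alpha \<sigma> u z"
  shows "(alpha \<sigma> u z)\<^sup>2 * dform \<sigma> (v - m *s diag_mult \<sigma> z) (v - m *s diag_mult \<sigma> z) = eliminant \<sigma> u v z"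
proof -
  have *: "dform \<sigma> (v - m *s diag_mult \<sigma> z) (v - m *s diag_mult \<sigma> z) =
      dform \<sigma> v v - 2 * m * dform \<sigma> v (diag_mult \<sigma> z) + m\<^sup>2 * dform \<sigma> z (diag_mult \<sigma> (diag_mult \<sigma> z))"
    by (simp add: dform_def sum_3 algebra_simps power2_eq_square)
  show ?thesis unfolding * eliminant_def assms by (simp add: algebra_simps power2_eq_square)
qed

lemma eliminant_scale:
  fixes u v z :: "complex ^ 3"
  shows "eliminant \<sigma> u v (c *s z) = c ^ 4 * eliminant \<sigma> u v z"
  by (simp add: eliminant_def alpha_beta_scale diag_mult_linear dform_linear algebra_simps power2_eq_square
      power4_eq_xxxx)

text \<open>A parameter x in \<open>R\<close> corresponds to the pair (k p, W) with p the conic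
  point, W = v - m D p and m = beta / alpha. Data off the dual conic give
  \<open>k \<noteq> 0\<close> and \<open>W \<noteq> 0\<close>; the disjunction in the condition on
  \<open>R\<close> makes p and D W independent, so that k is unique. The last condition on
  \<open>R\<close> asks only for roots that admit a multiplier, which leaves room to discard
  spurious ones.\<close>

lemma card_diag_pairs:
  fixes u v :: "complex ^ 3"
  assumes \<sigma>: "\<And>k. \<sigma> k \<noteq> 0"
    and inf: "eliminant \<sigma> u v (conic_infinity \<sigma>) \<noteq> 0"
    and u: "dform (\<lambda>k. 1 / \<sigma> k) u u \<noteq> 0" and v: "dform (\<lambda>k. 1 / \<sigma> k) v v \<noteq> 0"
    and R: "\<And>x. x \<in> R \<Longrightarrow> eliminant \<sigma> u v (conic_point \<sigma> x) = 0 \<and> alpha \<sigma> u (conic_point \<sigma> x) \<noteq> 0 \<and>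
      (dform (\<lambda>k. 1 / \<sigma> k) (conic_point \<sigma> x) (conic_point \<sigma> x) \<noteq> 0 \<or>
       det3 v (dinv \<sigma> (conic_point \<sigma> x)) (diag_mult \<sigma> (conic_point \<sigma> x)) \<noteq> 0)"
    and R': "\<And>x m. eliminant \<sigma> u v (conic_point \<sigma> x) = 0 \<Longrightarrow>
      beta \<sigma> u v (conic_point \<sigma> x) = m * alpha \<sigma> u (conic_point \<sigma> x) \<Longrightarrow> x \<in> R"
    and fin: "finite R"
  shows "finite (diag_pairs \<sigma> u v) \<and> card (diag_pairs \<sigma> u v) = card R"
proof -
  let ?p = "conic_point \<sigma>"
  let ?D = "diag_mult \<sigma>"
  define m where "m = (\<lambda>x. beta \<sigma> u v (?p x) / alpha \<sigma> u (?p x))"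
  define W where "W = (\<lambda>x. v - m x *s ?D (?p x))"
  have mx: "beta \<sigma> u v (?p x) = m x * alpha \<sigma> u (?p x)" if "x \<in> R" for x
    using R[OF that] by (simp add: m_def)
  have W0: "dform \<sigma> (W x) (W x) = 0" if "x \<in> R" for x
    using alpha_square_dform[OF mx[OF that]] R[OF that] by (simp add: W_def)
  have Dinv: "x = c *s dinv \<sigma> y" if "?D x = c *s y" for x y c
    using arg_cong[OF that, of "\<lambda>x. x $ k" for k] \<sigma> by (simp add: vec_eq_iff field_simps)
  have Wnz: "W x \<noteq> 0" for x
  proof
    assume "W x = 0"
    then have "v = m x *s ?D (?p x)" by (simp add: W_def)
    then have "dform (\<lambda>k. 1 / \<sigma> k) v v = (m x)\<^sup>2 * dform \<sigma> (?p x) (?p x)"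
      by (simp add: dform_linear dform_mult_dinv[OF \<sigma>] power2_eq_square)
    with v show False by (simp add: dform_conic_point[OF \<sigma>])
  qed
  \<comment> \<open>If D W = c p, isotropy of W makes the dual form vanish at p, while v = c D^-1 p
    + m D p makes the determinant vanish; both together are excluded on \<open>R\<close>.\<close>
  have indep: "\<nexists>c. ?D (W x) = c *s ?p x" if x: "x \<in> R" for x
  proof
    assume "\<exists>c. ?D (W x) = c *s ?p x"
    then obtain c where c: "?D (W x) = c *s ?p x" by blast
    have w: "W x = c *s dinv \<sigma> (?p x)" by (rule Dinv[OF c])
    then have "c \<noteq> 0" using Wnz[of x] by auto
    have "dform (\<lambda>k. 1 / \<sigma> k) (?D (W x)) (?D (W x)) = 0" by (simp add: dform_mult_dinv[OF \<sigma>] W0[OF x])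
    then have "dform (\<lambda>k. 1 / \<sigma> k) (?p x) (?p x) = 0" using \<open>c \<noteq> 0\<close> by (simp add: c dform_linear)
    then have det: "det3 v (dinv \<sigma> (?p x)) (?D (?p x)) \<noteq> 0" using R[OF x] by simp
    have "v = c *s dinv \<sigma> (?p x) + m x *s ?D (?p x)" using w by (simp add: W_def algebra_simps)
    then have "det3 v (dinv \<sigma> (?p x)) (?D (?p x)) = 0" by (metis det3_combination)
    with det show False by simp
  qed
  have ex: "\<exists>k. k \<noteq> 0 \<and> (k *s ?p x, W x) \<in> diag_pairs \<sigma> u v" if x: "x \<in> R" for x
  proof -
    have "det3 u (?p x) (?D (W x)) = 0" by (simp add: W_def det3_eq_beta_alpha mx[OF x])
    from det3_dependent[OF this dform_conic_point(2)[OF \<sigma>] indep[OF x]]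
    obtain k l where kl: "u = k *s ?p x + l *s ?D (W x)" by blast
    have k: "k \<noteq> 0"
    proof
      assume "k = 0"
      then have "dform (\<lambda>k. 1 / \<sigma> k) u u = l\<^sup>2 * dform \<sigma> (W x) (W x)"
        by (simp add: kl dform_linear dform_mult_dinv[OF \<sigma>] power2_eq_square)
      with u show False by (simp add: W0[OF x])
    qed
    have "u - k *s ?p x = l *s ?D (W x)" by (simp add: kl)
    moreover have "v - W x = (m x / k) *s ?D (k *s ?p x)"
      using k by (simp add: W_def diag_mult_linear)
    ultimately show ?thesis
      using k Wnz[of x] W0[OF x] dform_conic_point[OF \<sigma>]
      by (intro exI[of _ k]) (auto simp: diag_pairs_def dform_linear)
  qed
  define rel where "rel = (\<lambda>x (s :: (complex ^ 3) \<times> (complex ^ 3)). \<exists>k. k \<noteq> 0 \<and> fst s = k *s ?p x)"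
  have on_R: "\<exists>x\<in>R. rel x s \<and> snd s = W x" if s: "s \<in> diag_pairs \<sigma> u v" for s
  proof -
    obtain z w where zw: "s = (z, w)" by (cases s)
    with s obtain \<mu> \<nu> where *: "z \<noteq> 0" "w \<noteq> 0" "dform \<sigma> z z = 0" "dform \<sigma> w w = 0"
      "v - w = \<mu> *s ?D z" "u - z = \<nu> *s ?D w" by (auto simp: diag_pairs_def)
    have w: "w = v - \<mu> *s ?D z" using *(5) by (simp add: algebra_simps)
    have uz: "u = z + \<nu> *s ?D w" using *(6) by (simp add: algebra_simps)
    have "det3 u z (?D w) = 0" unfolding uz using det3_combination[of 1 z \<nu>] by simp
    then have ba: "beta \<sigma> u v z = \<mu> * alpha \<sigma> u z" by (simp add: w det3_eq_beta_alpha)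
    have E: "eliminant \<sigma> u v z = 0" using alpha_square_dform[OF ba] *(4) by (simp add: w)
    from \<sigma> *(1,3) show ?thesis
    proof (rule conic_point_cases)
      fix c assume "c \<noteq> 0" "z = c *s conic_infinity \<sigma>"
      with E inf show ?thesis by (simp add: eliminant_scale)
    next
      fix c x assume c: "c \<noteq> 0" and z: "z = c *s ?p x"
      have "beta \<sigma> u v (?p x) = (\<mu> * c) * alpha \<sigma> u (?p x)"
        using ba c by (simp add: z alpha_beta_scale power2_eq_square)
      moreover have "eliminant \<sigma> u v (?p x) = 0" using E c by (simp add: z eliminant_scale)
      ultimately have x: "x \<in> R" by (rule R'[rotated])
      have "\<mu> * c = m x" using \<open>beta \<sigma> u v (?p x) = (\<mu> * c) * alpha \<sigma> u (?p x)\<close> R[OF x] by (simp add: m_def)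
      then have "w = W x" by (simp add: w W_def z diag_mult_linear vector_smult_assoc)
      with x c z show ?thesis by (auto simp: rel_def zw)
    qed
  qed
  have rel_fun: "x = y" if "rel x s" "rel y s" for x y s
  proof -
    obtain k where k: "k \<noteq> 0" "fst s = k *s ?p x"
      using \<open>rel x s\<close> unfolding rel_def by blast
    obtain l where l: "fst s = l *s ?p y"
      using \<open>rel y s\<close> unfolding rel_def by blast
    show ?thesis by (rule conic_point_inj[OF \<sigma> trans[OF k(2)[symmetric] l] k(1)])
  qed
  have unique: "s = t" if s: "s \<in> diag_pairs \<sigma> u v" "rel x s" and t: "t \<in> diag_pairs \<sigma> u v" "rel x t" for x s t
  proof -
    have x: "x \<in> R" and W: "snd s = W x" "snd t = W x"
      using on_R[OF s(1)] on_R[OF t(1)] rel_fun s(2) t(2) by blast+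
    obtain k l where kl: "fst s = k *s ?p x" "fst t = l *s ?p x" using s(2) t(2) by (auto simp: rel_def)
    have "\<exists>n. u - fst r = n *s ?D (snd r)" if "r \<in> diag_pairs \<sigma> u v" for r
      using that unfolding diag_pairs_def by force
    then obtain n n' where "u - fst s = n *s ?D (snd s)" "u - fst t = n' *s ?D (snd t)"
      using s(1) t(1) by blast
    then have "k *s ?p x + n *s ?D (W x) = l *s ?p x + n' *s ?D (W x)"
      unfolding kl W by (simp add: algebra_simps)
    then have *: "(n - n') *s ?D (W x) = (l - k) *s ?p x"
      by (simp add: algebra_simps)
    have "n = n'"
    proof (rule ccontr)
      assume "n \<noteq> n'"
      then have "?D (W x) = ((l - k) / (n - n')) *s ?p x"
        using arg_cong[OF *, of "\<lambda>y. (1 / (n - n')) *s y"] by (simp only: vector_smult_assoc) simp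
      with indep[OF x] show False by blast
    qed
    with * have "k = l" using dform_conic_point(2)[of \<sigma> x, OF \<sigma>] by simp
    with kl W show "s = t" by (simp add: prod_eq_iff)
  qed
  have "\<forall>x\<in>R. \<exists>s. s \<in> diag_pairs \<sigma> u v \<and> rel x s"
  proof
    fix x assume "x \<in> R"
    from ex[OF this] obtain k where "k \<noteq> 0" "(k *s ?p x, W x) \<in> diag_pairs \<sigma> u v" by blast
    then show "\<exists>s. s \<in> diag_pairs \<sigma> u v \<and> rel x s"
      by (intro exI[of _ "(k *s ?p x, W x)"]) (auto simp: rel_def)
  qed
  then obtain g where g: "\<And>x. x \<in> R \<Longrightarrow> g x \<in> diag_pairs \<sigma> u v \<and> rel x (g x)" by metis
  have "bij_betw g R (diag_pairs \<sigma> u v)"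
    unfolding bij_betw_def
  proof
    show "inj_on g R" using g rel_fun by (intro inj_onI) metis
    show "g ` R = diag_pairs \<sigma> u v"
    proof (intro equalityI subsetI)
      fix s assume s: "s \<in> diag_pairs \<sigma> u v"
      then obtain x where x: "x \<in> R" "rel x s" using on_R by blast
      then have "s = g x" using unique[OF s] g by blast
      with x show "s \<in> g ` R" by blast
    qed (use g in auto)
  qed
  then show ?thesis using fin by (metis bij_betw_finite bij_betw_same_card)
qed

section \<open>Special data with the full number of roots\<close>

lemma infinite_complex_avoid:
  assumes "finite (B :: complex set)" shows "\<exists>\<epsilon>. \<epsilon>\<^sup>2 \<notin> B"
proof -
  obtain d where "d \<notin> B" using ex_new_if_finite[OF infinite_UNIV_char_0 assms] by blast
  then show ?thesis by (intro exI[of _ "csqrt d"]) simp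
qed

lemma eliminant_special_aux:
  fixes a b c x y z e :: complex
  assumes "a * x\<^sup>2 + b * y\<^sup>2 + c * z\<^sup>2 = 0"
  shows "(z * (y * (c\<^sup>2 - b\<^sup>2) - e * x * (c\<^sup>2 - a\<^sup>2)))\<^sup>2 * c -
      2 * (z * (y * (c\<^sup>2 - b\<^sup>2) - e * x * (c\<^sup>2 - a\<^sup>2))) * (c * (y - e * x)) * (c\<^sup>2 * z) +
      (c * (y - e * x))\<^sup>2 * (a ^ 3 * x\<^sup>2 + b ^ 3 * y\<^sup>2 + c ^ 3 * z\<^sup>2) =
    c\<^sup>2 * (y - e * x)\<^sup>2 * (a ^ 3 * x\<^sup>2 + b ^ 3 * y\<^sup>2) - (a * x\<^sup>2 + b * y\<^sup>2) * (a\<^sup>2 * e * x - b\<^sup>2 * y)\<^sup>2"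
proof -
  \<comment> \<open>On the conic c z^2 = - k, and the terms containing \<open>k\<close> complete to
    the square - k (l - c^2 m)^2.\<close>
  define k where "k = a * x\<^sup>2 + b * y\<^sup>2"
  define l where "l = y * (c\<^sup>2 - b\<^sup>2) - e * x * (c\<^sup>2 - a\<^sup>2)"
  define m where "m = y - e * x"
  have k: "c * z\<^sup>2 = - k" using assms unfolding k_def by algebra
  have n: "a\<^sup>2 * e * x - b\<^sup>2 * y = l - c\<^sup>2 * m" by (simp add: l_def m_def algebra_simps)
  have c3: "c ^ 3 * z\<^sup>2 = c\<^sup>2 * (c * z\<^sup>2)" by (simp add: power2_eq_square power3_eq_cube)
  have "(z * l)\<^sup>2 * c - 2 * (z * l) * (c * m) * (c\<^sup>2 * z) + (c * m)\<^sup>2 * (a ^ 3 * x\<^sup>2 + b ^ 3 * y\<^sup>2 + c\<^sup>2 * (c * z\<^sup>2)) =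
      (c * z\<^sup>2) * l\<^sup>2 - 2 * c\<^sup>2 * l * m * (c * z\<^sup>2) + c\<^sup>2 * m\<^sup>2 * (a ^ 3 * x\<^sup>2 + b ^ 3 * y\<^sup>2 + c\<^sup>2 * (c * z\<^sup>2))"
    by (simp add: algebra_simps power2_eq_square)
  also have "\<dots> = c\<^sup>2 * m\<^sup>2 * (a ^ 3 * x\<^sup>2 + b ^ 3 * y\<^sup>2) - k * (l - c\<^sup>2 * m)\<^sup>2"
    unfolding k by (simp add: algebra_simps power2_eq_square)
  finally show ?thesis unfolding c3 n by (simp add: l_def m_def k_def)
qed

text \<open>With \<open>v\<close> a coordinate vector and \<open>u\<close> in the opposite
  coordinate plane, the third coordinate enters only through its square, which the conic eliminates.
  A binary form in the first two coordinates remains; each of its zeros lies under two points of the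
  conic, exchanged by the sign of the third coordinate.\<close>

lemma eliminant_special:
  fixes z :: "complex ^ 3"
  assumes "dform \<sigma> z z = 0"
  shows "eliminant \<sigma> (vector [1, \<epsilon>, 0]) (vector [0, 0, 1]) z =
    (\<sigma> 3)\<^sup>2 * (z $ 2 - \<epsilon> * z $ 1)\<^sup>2 * ((\<sigma> 1) ^ 3 * (z $ 1)\<^sup>2 + (\<sigma> 2) ^ 3 * (z $ 2)\<^sup>2) -
    (\<sigma> 1 * (z $ 1)\<^sup>2 + \<sigma> 2 * (z $ 2)\<^sup>2) * ((\<sigma> 1)\<^sup>2 * \<epsilon> * z $ 1 - (\<sigma> 2)\<^sup>2 * z $ 2)\<^sup>2"
proof -
  have a: "alpha \<sigma> (vector [1, \<epsilon>, 0]) z =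
      z $ 3 * (z $ 2 * ((\<sigma> 3)\<^sup>2 - (\<sigma> 2)\<^sup>2) - \<epsilon> * z $ 1 * ((\<sigma> 3)\<^sup>2 - (\<sigma> 1)\<^sup>2))"
    by (simp add: alpha_def det3_def algebra_simps power2_eq_square)
  have b: "beta \<sigma> (vector [1, \<epsilon>, 0]) (vector [0, 0, 1]) z = \<sigma> 3 * (z $ 2 - \<epsilon> * z $ 1)"
    by (simp add: beta_def det3_def algebra_simps)
  have c: "dform \<sigma> (vector [0, 0, 1]) (vector [0, 0, 1]) = \<sigma> 3"
    "dform \<sigma> (vector [0, 0, 1]) (diag_mult \<sigma> z) = (\<sigma> 3)\<^sup>2 * z $ 3"
    "dform \<sigma> z (diag_mult \<sigma> (diag_mult \<sigma> z)) =
      (\<sigma> 1) ^ 3 * (z $ 1)\<^sup>2 + (\<sigma> 2) ^ 3 * (z $ 2)\<^sup>2 + (\<sigma> 3) ^ 3 * (z $ 3)\<^sup>2"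
    by (simp_all add: dform_def sum_3 power2_eq_square power3_eq_cube mult_ac)
  have "\<sigma> 1 * (z $ 1)\<^sup>2 + \<sigma> 2 * (z $ 2)\<^sup>2 + \<sigma> 3 * (z $ 3)\<^sup>2 = 0"
    using assms by (simp add: dform_def sum_3 power2_eq_square mult_ac)
  from eliminant_special_aux[OF this, of \<epsilon>] show ?thesis unfolding eliminant_def a b c .
qed

lemma conic_point_nth:
  "conic_point \<sigma> x $ 1 = (x\<^sup>2 - 1) / 2 / csqrt (\<sigma> 1)"
  "conic_point \<sigma> x $ 2 = (x\<^sup>2 + 1) / (2 * \<i>) / csqrt (\<sigma> 2)"
  "conic_point \<sigma> x $ 3 = x / csqrt (\<sigma> 3)"
  by (simp_all add: conic_point_def)

text \<open>For \<open>u = (1, \<epsilon>, 0)\<close> and \<open>v = (0, 0, 1)\<close> the eliminant is even in the third coordinate. In the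
  coordinate \<open>t = z\<^sub>2 / (\<epsilon> z\<^sub>1)\<close> it becomes a pencil with parameter \<open>\<epsilon>\<^sup>2\<close>.\<close>

lemma eliminant_special_roots:
  fixes \<sigma> :: "3 \<Rightarrow> complex"
  assumes \<sigma>: "\<And>k. \<sigma> k \<noteq> 0" and ne: "(\<sigma> 1)\<^sup>2 \<noteq> (\<sigma> 2)\<^sup>2" "(\<sigma> 1)\<^sup>2 \<noteq> (\<sigma> 3)\<^sup>2"
    and d: "d = 4 \<and> (\<sigma> 2)\<^sup>2 \<noteq> (\<sigma> 3)\<^sup>2 \<or> d = 3 \<and> \<sigma> 2 = \<sigma> 3"
  shows "\<exists>\<epsilon> S. \<epsilon> \<noteq> 0 \<and> finite S \<and> card S \<ge> 2 * d \<and>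
    (\<forall>x\<in>S. x\<^sup>2 \<noteq> 1 \<and> eliminant \<sigma> (vector [1, \<epsilon>, 0]) (vector [0, 0, 1]) (conic_point \<sigma> x) = 0)"
proof -
  define a b c where "a = \<sigma> 1" and "b = \<sigma> 2" and "c = \<sigma> 3"
  have abc: "a \<noteq> 0" "b \<noteq> 0" "c \<noteq> 0" using \<sigma> by (simp_all add: a_def b_def c_def)
  have ne': "a\<^sup>2 \<noteq> b\<^sup>2" "a\<^sup>2 \<noteq> c\<^sup>2" using ne by (simp_all add: a_def b_def c_def)
  \<comment> \<open>Substituting z2 = \<epsilon> t z1, the two linear factors become \<epsilon> z1
    \<open>T\<close> and \<epsilon> z1 \<open>N\<close>, and the eliminant becomes z1^4 \<epsilon>^2
    times Q0 + \<epsilon>^2 Q1.\<close>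
  define T N H Q0 Q1 where "T = [:-1, 1 :: complex:]" and "N = [:a\<^sup>2, - b\<^sup>2:]"
    and "H = [:c\<^sup>2 * b\<^sup>2:] * T\<^sup>2 - N\<^sup>2" and "Q0 = [:a:] * ([:c\<^sup>2 * a\<^sup>2:] * T\<^sup>2 - N\<^sup>2)"
    and "Q1 = [:0, 0, b:] * H"
  have pQ0: "poly Q0 t = a * (c\<^sup>2 * a\<^sup>2 * (t - 1)\<^sup>2 - (a\<^sup>2 - b\<^sup>2 * t)\<^sup>2)" for t
    by (simp add: Q0_def T_def N_def algebra_simps)
  have pH: "poly H t = c\<^sup>2 * b\<^sup>2 * (t - 1)\<^sup>2 - (a\<^sup>2 - b\<^sup>2 * t)\<^sup>2" for t
    by (simp add: H_def T_def N_def algebra_simps)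
  have pQ1: "poly Q1 t = b * t\<^sup>2 * poly H t" for t
    by (simp add: Q1_def algebra_simps power2_eq_square)
  have "H \<noteq> 0"
  proof
    assume "H = 0"
    then have "poly H 1 = 0" by simp
    then show False using ne' by (simp add: pH)
  qed
  then have "degree Q1 \<noteq> 0" using abc by (simp add: Q1_def degree_mult_eq del: mult_pCons_left)
  \<comment> \<open>The pencil has no base point: Q0 / a - H equals c^2 (a^2 - b^2) (t - 1)^2, so a
    common zero with \<open>H\<close> has t = 1, where \<open>H\<close> is nonzero. The zero t = 0
    of \<open>Q1\<close> is checked directly.\<close>
  moreover have "poly Q1 t \<noteq> 0" if t: "poly Q0 t = 0" for t
  proof
    assume "poly Q1 t = 0"
    then consider "t = 0" | "poly H t = 0" using abc by (auto simp: pQ1)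
    then show False
    proof cases
      case 1
      then have "a * (a\<^sup>2 * (c\<^sup>2 - a\<^sup>2)) = 0" using t by (simp add: pQ0 algebra_simps power2_eq_square)
      then show False using abc ne' by simp
    next
      case 2
      have "c\<^sup>2 * a\<^sup>2 * (t - 1)\<^sup>2 - (a\<^sup>2 - b\<^sup>2 * t)\<^sup>2 = 0" using t abc by (simp add: pQ0)
      with 2 have "c\<^sup>2 * (a\<^sup>2 - b\<^sup>2) * (t - 1)\<^sup>2 = 0" unfolding pH by algebra
      then have "t = 1" using abc ne' by simp
      with 2 ne' show False by (simp add: pH)
    qed
  qed
  ultimately have "finite {\<delta>. \<not> simple_roots (Q0 + smult \<delta> Q1)}" by (intro pencil_simple_roots) auto
  \<comment> \<open>The value \<open>- a / b\<close> is avoided because t = 1 would then belong to a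
    conic point with zero third coordinate, where the two points over \<open>t\<close>
    coincide.\<close>
  then obtain \<epsilon> where "\<epsilon>\<^sup>2 \<notin> {\<delta>. \<not> simple_roots (Q0 + smult \<delta> Q1)} \<union> {0, - a / b}"
    using infinite_complex_avoid[of "{\<delta>. \<not> simple_roots (Q0 + smult \<delta> Q1)} \<union> {0, - a / b}"] by auto
  then have simple: "simple_roots (Q0 + smult (\<epsilon>\<^sup>2) Q1)" and \<epsilon>: "\<epsilon> \<noteq> 0" "\<epsilon>\<^sup>2 \<noteq> - a / b" by auto
  define Q where "Q = Q0 + smult (\<epsilon>\<^sup>2) Q1"
  have pQ: "poly Q t = poly Q0 t + \<epsilon>\<^sup>2 * (b * t\<^sup>2 * poly H t)" for t by (simp add: Q_def pQ1)
  have Q00: "poly Q 0 \<noteq> 0"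
  proof
    assume "poly Q 0 = 0"
    then have "a * (a\<^sup>2 * (c\<^sup>2 - a\<^sup>2)) = 0" by (simp add: pQ pQ0 algebra_simps power2_eq_square)
    then show False using abc ne' by simp
  qed
  then have Q0: "Q \<noteq> 0" by auto
  \<comment> \<open>The leading coefficient contains c^2 - b^2. When b = c the degree drops to 3,
    which corresponds to losing the zero z1 = 0 at t = infinity.\<close>
  have "coeff Q 4 = \<epsilon>\<^sup>2 * b * (b\<^sup>2 * (c\<^sup>2 - b\<^sup>2))"
    by (simp add: Q_def Q0_def Q1_def H_def T_def N_def power2_eq_square eval_nat_numeral algebra_simps)
  moreover have "coeff Q 3 = \<epsilon>\<^sup>2 * b * (2 * b\<^sup>2 * (a\<^sup>2 - c\<^sup>2))"
    by (simp add: Q_def Q0_def Q1_def H_def T_def N_def power2_eq_square eval_nat_numeral algebra_simps)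
  ultimately have "coeff Q d \<noteq> 0" using d abc ne' \<epsilon>(1) by (auto simp: b_def c_def)
  then have dQ: "d \<le> degree Q" by (rule le_degree)
  define T0 where "T0 = {t. poly Q t = 0}"
  have T0: "finite T0" "d \<le> card T0"
    using card_simple_roots[OF simple] Q0 dQ poly_roots_finite[OF Q0] by (simp_all add: T0_def Q_def)
  \<comment> \<open>In the conic parameter, z2 = \<epsilon> t z1 reads x^2 + 1 = \<tau> (x^2 - 1).
    So x^2 is \<open>X t\<close> below, and each \<open>t\<close> gives two values of x.\<close>
  define \<tau> where "\<tau> = (\<lambda>t. \<i> * \<epsilon> * t * csqrt b / csqrt a)"
  have sq: "(csqrt a)\<^sup>2 = a" "(csqrt b)\<^sup>2 = b" by simp_all
  have \<tau>2: "a * (\<tau> t)\<^sup>2 = - (\<epsilon>\<^sup>2 * t\<^sup>2 * b)" for t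
    using abc(1) by (simp add: \<tau>_def power_divide power_mult_distrib)
  have \<tau>1: "(\<tau> t)\<^sup>2 \<noteq> 1" if t: "t \<in> T0" for t
  proof
    assume "(\<tau> t)\<^sup>2 = 1"
    then have k: "\<epsilon>\<^sup>2 * t\<^sup>2 * b = - a" using \<tau>2[of t] by simp
    have "poly Q t = c\<^sup>2 * (t - 1)\<^sup>2 * (a ^ 3 + b\<^sup>2 * (\<epsilon>\<^sup>2 * t\<^sup>2 * b)) - (a + \<epsilon>\<^sup>2 * t\<^sup>2 * b) * (a\<^sup>2 - b\<^sup>2 * t)\<^sup>2"
      by (simp add: pQ pQ0 pH algebra_simps power2_eq_square power3_eq_cube)
    then have "c\<^sup>2 * (t - 1)\<^sup>2 * (a * (a\<^sup>2 - b\<^sup>2)) = 0"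
      using t unfolding k T0_def by (simp add: algebra_simps power2_eq_square power3_eq_cube)
    then have "t = 1" using abc ne' by simp
    then have "\<epsilon>\<^sup>2 = - a / b" using k abc by (simp add: field_simps)
    with \<epsilon>(2) show False by simp
  qed
  define X where "X = (\<lambda>t. (\<tau> t + 1) / (\<tau> t - 1))"
  have \<tau>_ne: "\<tau> t - 1 \<noteq> 0" "\<tau> t + 1 \<noteq> 0" if "t \<in> T0" for t
    using \<tau>1[OF that] by (auto simp: eq_neg_iff_add_eq_0[symmetric])
  have X: "X t + 1 = \<tau> t * (X t - 1)" "X t \<noteq> 0" "X t \<noteq> 1" if "t \<in> T0" for t
    using \<tau>_ne[OF that] by (auto simp: X_def field_simps)
  have X_inj: "t = t'" if "t \<in> T0" "t' \<in> T0" "X t = X t'" for t t'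
  proof -
    have "\<tau> t * (X t - 1) = \<tau> t' * (X t - 1)" by (metis X(1) that)
    then have "\<tau> t = \<tau> t'" using X(3)[OF that(1)] by auto
    then show ?thesis using \<epsilon>(1) abc by (simp add: \<tau>_def)
  qed
  define g where "g = (\<lambda>(t, e :: complex). e * csqrt (X t))"
  have g2: "(g (t, e))\<^sup>2 = X t" if "e \<in> {1, - 1}" for t e
    using that by (auto simp: g_def power_mult_distrib)
  have "inj_on g (T0 \<times> {1, - 1})"
  proof (rule inj_onI)
    fix x y assume x: "x \<in> T0 \<times> {1, - 1}" and y: "y \<in> T0 \<times> {1, - 1}" and eq: "g x = g y"
    obtain t e t' e' where te: "x = (t, e)" "y = (t', e')" by (cases x, cases y)
    have "X t = X t'" using g2[of e t] g2[of e' t'] x y eq by (auto simp: te)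
    then have t: "t = t'" using X_inj x y by (auto simp: te)
    moreover have "csqrt (X t) \<noteq> 0" using X(2)[of t] x by (simp add: te)
    ultimately have "e = e'" using eq by (simp add: te g_def)
    with t te show "x = y" by simp
  qed
  then have "card (g ` (T0 \<times> {1, - 1})) = card T0 * 2" by (simp add: card_image card_cartesian_product)
  moreover have "x\<^sup>2 \<noteq> 1 \<and> eliminant \<sigma> (vector [1, \<epsilon>, 0]) (vector [0, 0, 1]) (conic_point \<sigma> x) = 0"
    if x: "x \<in> g ` (T0 \<times> {1, - 1})" for x
  proof -
    obtain t where t: "t \<in> T0" and x2: "x\<^sup>2 = X t" using x g2 by blast
    define z where "z = conic_point \<sigma> x"
    have z2: "z $ 2 = \<epsilon> * t * z $ 1"
      unfolding z_def conic_point_nth x2 X(1)[OF t] \<tau>_def a_def[symmetric] b_def[symmetric]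
      using abc by (simp add: field_simps)
    have "dform \<sigma> z z = 0" unfolding z_def by (rule dform_conic_point(1)[OF \<sigma>])
    from eliminant_special[OF this, of \<epsilon>]
    have "eliminant \<sigma> (vector [1, \<epsilon>, 0]) (vector [0, 0, 1]) z = (z $ 1) ^ 4 * \<epsilon>\<^sup>2 * poly Q t"
      unfolding z2 a_def[symmetric] b_def[symmetric] c_def[symmetric] pQ pQ0 pH
      by (simp add: algebra_simps power2_eq_square power3_eq_cube power4_eq_xxxx)
    then show ?thesis using t X(3)[OF t] x2 by (simp add: T0_def z_def)
  qed
  ultimately show ?thesis using T0 \<epsilon>(1)
    by (intro exI[of _ \<epsilon>] exI[of _ "g ` (T0 \<times> {1, - 1})"]) auto
qed

section \<open>The eliminant as a polynomial in the parameter of the conic\<close>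

definition const_vec :: "complex ^ 3 \<Rightarrow> complex poly ^ 3" where
  "const_vec u = (\<chi> k. [:u $ k:])"

definition conic_poly :: "(3 \<Rightarrow> complex) \<Rightarrow> complex poly ^ 3" where
  "conic_poly \<sigma> = vector [smult (1 / csqrt (\<sigma> 1)) [:- 1 / 2, 0, 1 / 2:],
     smult (1 / csqrt (\<sigma> 2)) [:1 / (2 * \<i>), 0, 1 / (2 * \<i>):], smult (1 / csqrt (\<sigma> 3)) [:0, 1:]]"

abbreviation poly_eval :: "complex \<Rightarrow> complex poly ^ 'n \<Rightarrow> complex ^ 'n" where
  "poly_eval x P \<equiv> (\<chi> k. poly (P $ k) x)"

lemma poly_eval_conic_poly: "poly_eval x (conic_poly \<sigma>) = conic_point \<sigma> x"
  by (simp add: vec_eq_iff forall_3 conic_point_nth conic_poly_def)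
    (simp add: field_simps power2_eq_square add_divide_distrib diff_divide_distrib)

lemma poly_eval_const_vec: "poly_eval x (const_vec u) = u"
  by (simp add: vec_eq_iff const_vec_def)

lemma poly_det3: "poly (det3 a b c) x = det3 (poly_eval x a) (poly_eval x b) (poly_eval x c)"
  by (simp add: det3_def)

lemma poly_dform: "poly (dform (\<lambda>k. [:\<sigma> k:]) a b) x = dform \<sigma> (poly_eval x a) (poly_eval x b)"
  by (simp add: dform_def poly_sum mult.assoc)

lemma poly_diag_mult: "poly_eval x (diag_mult (\<lambda>k. [:\<sigma> k:]) a) = diag_mult \<sigma> (poly_eval x a)"
  by (simp add: vec_eq_iff)

lemma degree_mult_le': "degree p \<le> m \<Longrightarrow> degree q \<le> n \<Longrightarrow> degree (p * q) \<le> m + n"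
  by (meson add_mono degree_mult_le order_trans)

lemma degree_det3:
  fixes a b c :: "complex poly ^ 3"
  assumes "\<And>k. degree (a $ k) \<le> l" "\<And>k. degree (b $ k) \<le> m" "\<And>k. degree (c $ k) \<le> n"
  shows "degree (det3 a b c) \<le> l + (m + n)"
  unfolding det3_def by (intro degree_add_le degree_diff_le degree_mult_le' assms)

lemma degree_diag_mult:
  fixes b :: "complex poly ^ 'n"
  assumes "\<And>k. degree (b $ k) \<le> m"
  shows "degree (diag_mult (\<lambda>k. [:\<sigma> k:]) b $ k) \<le> m"
  using assms[of k] degree_smult_le[of "\<sigma> k" "b $ k"] by simp

lemma degree_dform:
  fixes a b :: "complex poly ^ 'n"
  assumes "\<And>k. degree (a $ k) \<le> m" "\<And>k. degree (b $ k) \<le> n"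
  shows "degree (dform (\<lambda>k. [:\<sigma> k:]) a b) \<le> m + n"
  unfolding dform_def
  using degree_diag_mult[OF assms(1), of \<sigma>] assms(2) by (intro degree_sum_le degree_mult_le') auto

lemma degree_conic_poly: "degree (conic_poly \<sigma> $ k) \<le> 2"
  using exhaust_3[of k] by (auto simp: conic_poly_def)

lemma degree_const_vec: "degree (const_vec u $ k) \<le> 0"
  by (simp add: const_vec_def)

text \<open>\<open>eliminant\<close> makes sense over any commutative ring; read over polynomials
  and applied to the parametrized conic, the same formula gives a univariate polynomial.\<close>

definition eliminant_poly :: "(3 \<Rightarrow> complex) \<Rightarrow> complex ^ 3 \<Rightarrow> complex ^ 3 \<Rightarrow> complex poly" where
  "eliminant_poly \<sigma> u v = eliminant (\<lambda>k. [:\<sigma> k:]) (const_vec u) (const_vec v) (conic_poly \<sigma>)"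

lemma poly_eliminant_poly: "poly (eliminant_poly \<sigma> u v) x = eliminant \<sigma> u v (conic_point \<sigma> x)"
  by (simp only: eliminant_poly_def eliminant_def alpha_def beta_def poly_add poly_diff poly_mult
      poly_power poly_numeral poly_det3 poly_dform poly_diag_mult poly_eval_conic_poly poly_eval_const_vec)

lemma degree_alpha_beta:
  "degree (alpha (\<lambda>k. [:\<sigma> k:]) (const_vec u) (conic_poly \<sigma>)) \<le> 4"
  "degree (beta (\<lambda>k. [:\<sigma> k:]) (const_vec u) (const_vec v) (conic_poly \<sigma>)) \<le> 2"
  unfolding alpha_def beta_def
  by (rule order_trans[OF degree_det3[OF degree_const_vec degree_conic_poly
        degree_diag_mult[OF degree_diag_mult[OF degree_conic_poly]]]], simp)
    (rule order_trans[OF degree_det3[OF degree_const_vec degree_conic_poly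
        degree_diag_mult[OF degree_const_vec]]], simp)

lemma degree_mult3_le: "degree p \<le> l \<Longrightarrow> degree q \<le> m \<Longrightarrow> degree r \<le> n \<Longrightarrow> l + m + n \<le> d \<Longrightarrow>
    degree (p * q * r) \<le> d"
  by (meson degree_mult_le' order_trans)

text \<open>In the parameter, \<open>alpha\<close> has degree at most 4, \<open>beta\<close> 2, and
  the three values of the form 0, 2 and 4; every summand adds up to 8.\<close>

lemma degree_eliminant_poly: "degree (eliminant_poly \<sigma> u v) \<le> 8"
proof -
  note d = degree_alpha_beta[of \<sigma> u] degree_alpha_beta(2)[of \<sigma> u v]
    degree_dform[OF degree_const_vec degree_const_vec, of \<sigma> v v]
    degree_dform[OF degree_const_vec degree_diag_mult[OF degree_conic_poly], of \<sigma> v \<sigma> \<sigma>]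
    degree_dform[OF degree_conic_poly degree_diag_mult[OF degree_diag_mult[OF degree_conic_poly]], of \<sigma> \<sigma> \<sigma> \<sigma> \<sigma>]
  show ?thesis
    unfolding eliminant_poly_def eliminant_def power2_eq_square mult.assoc[of 2]
    by (intro degree_add_le degree_diff_le degree_mult3_le[of _ 4 _ 4 _ 0] degree_mult3_le[of _ 2 _ 2 _ 4]
        order_trans[OF degree_mult_le'[of 2 0 _ 8]] degree_mult3_le[of _ 4 _ 2 _ 2])
      (use d in \<open>simp_all add: mult.assoc[symmetric]\<close>)
qed

lemma poly_family_eliminant: "poly_family (\<lambda>u v. eliminant_poly \<sigma> u v)"
  unfolding eliminant_poly_def eliminant_def alpha_def beta_def det3_def dform_def sum_3
    diag_mult_nth const_vec_def vec_lambda_beta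
  by (intro poly_family_intros poly_fun2_intros)

lemma poly_fun2_eliminant: "poly_fun2 (\<lambda>u v. eliminant \<sigma> u v z)"
  unfolding eliminant_def alpha_def beta_def det3_def dform_def sum_3 diag_mult_nth
  by (intro poly_fun2_intros)

lemma det3_zero_minors:
  fixes b c :: "complex ^ 3"
  assumes "\<And>u. det3 u b c = 0"
  shows "b $ 2 * c $ 3 = b $ 3 * c $ 2" "b $ 1 * c $ 3 = b $ 3 * c $ 1" "b $ 1 * c $ 2 = b $ 2 * c $ 1"
  using assms[of "vector [1, 0, 0]"] assms[of "vector [0, 1, 0]"] assms[of "vector [0, 0, 1]"]
  by (simp_all add: det3_def)

lemma generic_det3:
  fixes b c :: "complex ^ 3"
  assumes "\<not> (b $ 2 * c $ 3 = b $ 3 * c $ 2 \<and> b $ 1 * c $ 3 = b $ 3 * c $ 1 \<and> b $ 1 * c $ 2 = b $ 2 * c $ 1)"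
  shows "generic (\<lambda>u v. det3 u b c \<noteq> 0)" "generic (\<lambda>u v. det3 v b c \<noteq> 0)"
proof -
  obtain u where u: "det3 u b c \<noteq> 0" using det3_zero_minors[of b c] assms by blast
  have "poly_fun2 (\<lambda>u v. det3 u b c)" "poly_fun2 (\<lambda>u v. det3 v b c)"
    unfolding det3_def by (intro poly_fun2_intros)+
  with u show "generic (\<lambda>u v. det3 u b c \<noteq> 0)" "generic (\<lambda>u v. det3 v b c \<noteq> 0)"
    by (auto intro: genericI)
qed

lemma generic_dform:
  assumes "\<tau> 1 \<noteq> (0::complex)"
  shows "generic (\<lambda>u v :: complex ^ 3. dform \<tau> u u \<noteq> 0)" "generic (\<lambda>u v :: complex ^ 3. dform \<tau> v v \<noteq> 0)"
proof -
  have "poly_fun2 (\<lambda>u v :: complex ^ 3. dform \<tau> u u)" "poly_fun2 (\<lambda>u v :: complex ^ 3. dform \<tau> v v)"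
    unfolding dform_def by (intro poly_fun2_intros)+
  moreover have "dform \<tau> (vector [1, 0, 0]) (vector [1, 0, 0] :: complex ^ 3) \<noteq> 0"
    using assms by (simp add: dform_def sum_3)
  ultimately show "generic (\<lambda>u v :: complex ^ 3. dform \<tau> u u \<noteq> 0)" "generic (\<lambda>u v :: complex ^ 3. dform \<tau> v v \<noteq> 0)"
    by (auto intro: genericI)
qed

text \<open>At the point at infinity the third coordinate is zero, hence so is \<sigma>1 z1^2 +
  \<sigma>2 z2^2. In the special formula with \<epsilon> = 0 only the first summand remains, with
  the factor \<sigma>1^2 - \<sigma>2^2.\<close>

lemma generic_eliminant_infinity:
  fixes \<sigma> :: "3 \<Rightarrow> complex"
  assumes \<sigma>: "\<And>k. \<sigma> k \<noteq> 0" and ne: "(\<sigma> 1)\<^sup>2 \<noteq> (\<sigma> 2)\<^sup>2"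
  shows "generic (\<lambda>u v. eliminant \<sigma> u v (conic_infinity \<sigma>) \<noteq> 0)"
proof (rule genericI[OF poly_fun2_eliminant])
  have sq: "\<sigma> k * (a / csqrt (\<sigma> k))\<^sup>2 = a\<^sup>2" for k a using \<sigma>[of k] by (simp add: power_divide)
  have z: "conic_infinity \<sigma> $ 1 = (1 / 2) / csqrt (\<sigma> 1)" "conic_infinity \<sigma> $ 2 = (1 / (2 * \<i>)) / csqrt (\<sigma> 2)"
    by (simp_all add: conic_infinity_def)
  have p1: "\<sigma> 1 * (conic_infinity \<sigma> $ 1)\<^sup>2 = 1 / 4" "\<sigma> 2 * (conic_infinity \<sigma> $ 2)\<^sup>2 = - 1 / 4"
    unfolding z sq by (simp_all add: power_divide power_mult_distrib)
  have "(\<sigma> 1) ^ 3 * (conic_infinity \<sigma> $ 1)\<^sup>2 = (\<sigma> 1)\<^sup>2 * (\<sigma> 1 * (conic_infinity \<sigma> $ 1)\<^sup>2)"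
    "(\<sigma> 2) ^ 3 * (conic_infinity \<sigma> $ 2)\<^sup>2 = (\<sigma> 2)\<^sup>2 * (\<sigma> 2 * (conic_infinity \<sigma> $ 2)\<^sup>2)"
    by (simp_all add: power2_eq_square power3_eq_cube)
  then have p3: "(\<sigma> 1) ^ 3 * (conic_infinity \<sigma> $ 1)\<^sup>2 + (\<sigma> 2) ^ 3 * (conic_infinity \<sigma> $ 2)\<^sup>2 =
      ((\<sigma> 1)\<^sup>2 - (\<sigma> 2)\<^sup>2) / 4" unfolding p1 by (simp add: field_simps)
  have "conic_infinity \<sigma> $ 2 \<noteq> 0" using \<sigma> by (simp add: z)
  then show "eliminant \<sigma> (vector [1, 0, 0]) (vector [0, 0, 1]) (conic_infinity \<sigma>) \<noteq> 0"
    unfolding eliminant_special[OF dform_conic_point(3)[OF \<sigma>]] p1 p3 using \<sigma> ne by simp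
qed

text \<open>The expression lies in the square of the ideal of \<open>A\<close> and \<open>B\<close>,
  so a common zero is a multiple root. At a simple root of the eliminant, \<open>alpha\<close> and
  \<open>beta\<close> therefore do not vanish together.\<close>

lemma alpha_beta_zero_not_simple:
  fixes a b c A B :: "complex poly"
  assumes "poly A x = 0" "poly B x = 0"
  shows "\<not> simple_roots (A\<^sup>2 * a - 2 * A * B * b + B\<^sup>2 * c)"
  unfolding simple_roots_def
  using assms by (auto intro!: exI[of _ x] simp: pderiv_mult pderiv_add pderiv_diff power2_eq_square)

text \<open>Index types for the Sylvester matrices in degrees 8 and 6.\<close>

lemma card_sylvester_index: "CARD(15) = 2 * 8 - 1" "CARD(11) = 2 * 6 - 1"
  by simp_all

section \<open>Three singular values\<close>

text \<open>At a simple root with \<open>alpha\<close> zero, \<open>beta\<close> is nonzero, so the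
  coefficient \<gamma> = z^T D^3 z of beta^2 vanishes. The zeros of \<gamma>, and those of the dual
  form \<gamma>', are finitely many points independent of the data; a generic \<open>u\<close> keeps
  \<open>alpha\<close> nonzero at the former, and a generic \<open>v\<close> keeps the determinant
  of \<open>card_diag_pairs\<close> nonzero at the latter.\<close>

lemma generic_card_diag_pairs_3:
  fixes \<sigma> :: "3 \<Rightarrow> complex"
  assumes \<sigma>: "\<And>k. \<sigma> k \<noteq> 0"
    and ne: "(\<sigma> 1)\<^sup>2 \<noteq> (\<sigma> 2)\<^sup>2" "(\<sigma> 1)\<^sup>2 \<noteq> (\<sigma> 3)\<^sup>2" "(\<sigma> 2)\<^sup>2 \<noteq> (\<sigma> 3)\<^sup>2"
  shows "generic (\<lambda>u v. finite (diag_pairs \<sigma> u v) \<and> card (diag_pairs \<sigma> u v) = 8)"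
proof -
  let ?p = "conic_point \<sigma>"
  let ?D = "diag_mult \<sigma>"
  have s0: "csqrt (\<sigma> k) \<noteq> 0" for k using \<sigma> by simp
  \<comment> \<open>A point of the cone with two zero coordinates would be zero, because all
    \<open>\<sigma> k\<close> are nonzero.\<close>
  have p_two: "\<not> (?p x $ 1 * ?p x $ 2 = 0 \<and> ?p x $ 1 * ?p x $ 3 = 0 \<and> ?p x $ 2 * ?p x $ 3 = 0)" for x
  proof
    assume *: "?p x $ 1 * ?p x $ 2 = 0 \<and> ?p x $ 1 * ?p x $ 3 = 0 \<and> ?p x $ 2 * ?p x $ 3 = 0"
    have "dform \<sigma> (?p x) (?p x) = 0" by (rule dform_conic_point(1)[OF \<sigma>])
    then have "\<sigma> 1 * ?p x $ 1 * ?p x $ 1 + \<sigma> 2 * ?p x $ 2 * ?p x $ 2 + \<sigma> 3 * ?p x $ 3 * ?p x $ 3 = 0"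
      by (simp add: dform_def sum_3)
    with * have "?p x $ 1 = 0 \<and> ?p x $ 2 = 0 \<and> ?p x $ 3 = 0" using \<sigma> by auto
    then have "?p x = 0" by (simp add: vec_eq_iff forall_3)
    then show False using dform_conic_point(2)[OF \<sigma>, where x = x] by simp
  qed
  have simple: "generic (\<lambda>u v. degree (eliminant_poly \<sigma> u v) = 8 \<and> simple_roots (eliminant_poly \<sigma> u v))"
  proof -
    obtain \<epsilon> S where S: "\<epsilon> \<noteq> 0" "finite S" "card S \<ge> 8"
      "\<And>x. x \<in> S \<Longrightarrow> eliminant \<sigma> (vector [1, \<epsilon>, 0]) (vector [0, 0, 1]) (?p x) = 0"
      using eliminant_special_roots[OF \<sigma> ne(1,2), of 4] ne(3) by auto
    let ?E = "eliminant_poly \<sigma> (vector [1, \<epsilon>, 0]) (vector [0, 0, 1])"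
    have nz: "poly ?E 1 \<noteq> 0"
    proof -
      have z1: "?p 1 $ 1 = 0" and z2: "?p 1 $ 2 \<noteq> 0" using s0 by (simp_all add: conic_point_nth)
      have "poly ?E 1 = (?p 1 $ 2) ^ 4 * (\<sigma> 2) ^ 3 * ((\<sigma> 3)\<^sup>2 - (\<sigma> 2)\<^sup>2)"
        unfolding poly_eliminant_poly eliminant_special[OF dform_conic_point(1)[OF \<sigma>]] z1
        by (simp add: algebra_simps power2_eq_square power3_eq_cube power4_eq_xxxx)
      then show ?thesis using z2 \<sigma> ne(3) by simp
    qed
    then have E0: "?E \<noteq> 0" by auto
    have "card S \<le> card {x. poly ?E x = 0}"
      using S(4) by (intro card_mono poly_roots_finite[OF E0]) (auto simp: poly_eliminant_poly)
    with S(3) have "8 \<le> card {x. poly ?E x = 0}" by simp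
    from generic_simple_roots[OF poly_family_eliminant degree_eliminant_poly _ card_sylvester_index(1) E0 this]
    show ?thesis by simp
  qed
  define \<gamma> where "\<gamma> = dform (\<lambda>k. [:\<sigma> k:]) (conic_poly \<sigma>) (diag_mult (\<lambda>k. [:\<sigma> k:]) (diag_mult (\<lambda>k. [:\<sigma> k:]) (conic_poly \<sigma>)))"
  have \<gamma>: "poly \<gamma> x = dform \<sigma> (?p x) (?D (?D (?p x)))" for x
    by (simp only: \<gamma>_def poly_dform poly_diag_mult poly_eval_conic_poly)
  define \<gamma>' where "\<gamma>' = dform (\<lambda>k. [:1 / \<sigma> k:]) (conic_poly \<sigma>) (conic_poly \<sigma>)"
  have \<gamma>': "poly \<gamma>' x = dform (\<lambda>k. 1 / \<sigma> k) (?p x) (?p x)" for x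
    by (simp only: \<gamma>'_def poly_dform poly_eval_conic_poly)
  have sq: "\<sigma> k * ((1 / csqrt (\<sigma> k)) * (1 / csqrt (\<sigma> k))) = 1" for k
    using \<sigma>[of k] power2_csqrt[of "\<sigma> k"] by (simp add: power2_eq_square)
  \<comment> \<open>At parameter 1 the first coordinate is zero, and both \<gamma> and \<gamma>' are
    nonzero multiples of \<sigma>3^2 - \<sigma>2^2. Hence neither is the zero polynomial.\<close>
  have p1: "?p 1 $ 1 = 0" "\<sigma> 2 * (?p 1 $ 2 * ?p 1 $ 2) = - 1" "\<sigma> 3 * (?p 1 $ 3 * ?p 1 $ 3) = 1"
    using sq[of 2] sq[of 3] by (simp_all add: conic_point_nth field_simps)
  have "poly \<gamma> 1 = (\<sigma> 2)\<^sup>2 * (\<sigma> 2 * (?p 1 $ 2 * ?p 1 $ 2)) + (\<sigma> 3)\<^sup>2 * (\<sigma> 3 * (?p 1 $ 3 * ?p 1 $ 3))"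
    by (simp add: \<gamma> dform_def sum_3 p1(1) power2_eq_square mult_ac)
  then have "poly \<gamma> 1 \<noteq> 0" using ne(3) unfolding p1 by simp
  then have \<gamma>_fin: "finite {x. poly \<gamma> x = 0}" by (intro poly_roots_finite) auto
  have "(\<sigma> 2)\<^sup>2 * (\<sigma> 3)\<^sup>2 * poly \<gamma>' 1 =
      (\<sigma> 3)\<^sup>2 * (\<sigma> 2 * (?p 1 $ 2 * ?p 1 $ 2)) + (\<sigma> 2)\<^sup>2 * (\<sigma> 3 * (?p 1 $ 3 * ?p 1 $ 3))"
    using \<sigma>[of 2] \<sigma>[of 3] by (simp add: \<gamma>' dform_def sum_3 p1(1) power2_eq_square field_simps)
  then have "(\<sigma> 2)\<^sup>2 * (\<sigma> 3)\<^sup>2 * poly \<gamma>' 1 \<noteq> 0" using ne(3) unfolding p1 by simp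
  then have "poly \<gamma>' 1 \<noteq> 0" by simp
  then have \<gamma>'_fin: "finite {x. poly \<gamma>' x = 0}" by (intro poly_roots_finite) auto
  \<comment> \<open>At a fixed point \<open>alpha\<close> is a linear form in \<open>u\<close>. It
    is not zero: z has two nonzero coordinates and D^2 distinct entries, so z and D^2 z are not
    parallel.\<close>
  have g1: "generic (\<lambda>u v. \<forall>x\<in>{x. poly \<gamma> x = 0}. alpha \<sigma> u (?p x) \<noteq> 0)"
    unfolding alpha_def
  proof (intro generic_ball \<gamma>_fin generic_det3(1) notI)
    fix x
    let ?c = "?D (?D (?p x))"
    assume "?p x $ 2 * ?c $ 3 = ?p x $ 3 * ?c $ 2 \<and> ?p x $ 1 * ?c $ 3 = ?p x $ 3 * ?c $ 1 \<and>
      ?p x $ 1 * ?c $ 2 = ?p x $ 2 * ?c $ 1"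
    then have "(?p x $ 2 * ?p x $ 3) * ((\<sigma> 3)\<^sup>2 - (\<sigma> 2)\<^sup>2) = 0" "(?p x $ 1 * ?p x $ 3) * ((\<sigma> 3)\<^sup>2 - (\<sigma> 1)\<^sup>2) = 0"
      "(?p x $ 1 * ?p x $ 2) * ((\<sigma> 2)\<^sup>2 - (\<sigma> 1)\<^sup>2) = 0"
      by (simp_all add: algebra_simps power2_eq_square)
    then show False using p_two[of x] ne by auto
  qed
  have g2: "generic (\<lambda>u v. \<forall>x\<in>{x. poly \<gamma>' x = 0}. det3 v (dinv \<sigma> (?p x)) (?D (?p x)) \<noteq> 0)"
  proof (intro generic_ball \<gamma>'_fin generic_det3(2) notI)
    fix x
    let ?b = "dinv \<sigma> (?p x)" and ?c = "?D (?p x)"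
    assume *: "?b $ 2 * ?c $ 3 = ?b $ 3 * ?c $ 2 \<and> ?b $ 1 * ?c $ 3 = ?b $ 3 * ?c $ 1 \<and>
      ?b $ 1 * ?c $ 2 = ?b $ 2 * ?c $ 1"
    have "?p x $ i * ?p x $ j = 0" if ij: "?b $ i * ?c $ j = ?b $ j * ?c $ i" "(\<sigma> i)\<^sup>2 \<noteq> (\<sigma> j)\<^sup>2" for i j
    proof -
      have e: "\<sigma> i * \<sigma> j * (?b $ i * ?c $ j) = (\<sigma> j)\<^sup>2 * (?p x $ i * ?p x $ j)"
        "\<sigma> i * \<sigma> j * (?b $ j * ?c $ i) = (\<sigma> i)\<^sup>2 * (?p x $ i * ?p x $ j)"
        using \<sigma>[of i] \<sigma>[of j] by (simp_all add: power2_eq_square)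
      have "(\<sigma> j)\<^sup>2 * (?p x $ i * ?p x $ j) = (\<sigma> i)\<^sup>2 * (?p x $ i * ?p x $ j)"
        by (simp only: e[symmetric] ij(1))
      with ij(2) show ?thesis by auto
    qed
    then show False using p_two[of x] * ne by blast
  qed
  have "generic (\<lambda>u v. (degree (eliminant_poly \<sigma> u v) = 8 \<and> simple_roots (eliminant_poly \<sigma> u v)) \<and>
      eliminant \<sigma> u v (conic_infinity \<sigma>) \<noteq> 0 \<and> dform (\<lambda>k. 1 / \<sigma> k) u u \<noteq> 0 \<and> dform (\<lambda>k. 1 / \<sigma> k) v v \<noteq> 0 \<and>
      (\<forall>x\<in>{x. poly \<gamma> x = 0}. alpha \<sigma> u (?p x) \<noteq> 0) \<and>
      (\<forall>x\<in>{x. poly \<gamma>' x = 0}. det3 v (dinv \<sigma> (?p x)) (?D (?p x)) \<noteq> 0))"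
    by (rule generic_conj[OF simple generic_conj[OF generic_eliminant_infinity[OF \<sigma> ne(1)]
          generic_conj[OF generic_dform(1) generic_conj[OF generic_dform(2) generic_conj[OF g1 g2]]]]])
      (simp_all add: \<sigma>)
  then show ?thesis
  proof (rule generic_mono)
    fix u v
    assume H: "(degree (eliminant_poly \<sigma> u v) = 8 \<and> simple_roots (eliminant_poly \<sigma> u v)) \<and>
      eliminant \<sigma> u v (conic_infinity \<sigma>) \<noteq> 0 \<and> dform (\<lambda>k. 1 / \<sigma> k) u u \<noteq> 0 \<and> dform (\<lambda>k. 1 / \<sigma> k) v v \<noteq> 0 \<and>
      (\<forall>x\<in>{x. poly \<gamma> x = 0}. alpha \<sigma> u (?p x) \<noteq> 0) \<and>
      (\<forall>x\<in>{x. poly \<gamma>' x = 0}. det3 v (dinv \<sigma> (?p x)) (?D (?p x)) \<noteq> 0)"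
    let ?E = "eliminant_poly \<sigma> u v"
    let ?R = "{x. poly ?E x = 0}"
    have E0: "?E \<noteq> 0" using H by auto
    have alpha: "alpha \<sigma> u (?p x) \<noteq> 0" if x: "x \<in> ?R" for x
    proof
      assume a: "alpha \<sigma> u (?p x) = 0"
      have "beta \<sigma> u v (?p x) \<noteq> 0"
      proof
        assume b: "beta \<sigma> u v (?p x) = 0"
        let ?A = "alpha (\<lambda>k. [:\<sigma> k:]) (const_vec u) (conic_poly \<sigma>)"
        let ?B = "beta (\<lambda>k. [:\<sigma> k:]) (const_vec u) (const_vec v) (conic_poly \<sigma>)"
        have "poly ?A x = alpha \<sigma> u (?p x)" "poly ?B x = beta \<sigma> u v (?p x)"
          by (simp_all only: alpha_def beta_def poly_det3 poly_diag_mult poly_eval_conic_poly poly_eval_const_vec)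
        with a b have "\<not> simple_roots ?E"
          unfolding eliminant_poly_def eliminant_def by (intro alpha_beta_zero_not_simple) auto
        with H show False by simp
      qed
      moreover have "eliminant \<sigma> u v (?p x) = 0" using x by (simp add: poly_eliminant_poly)
      ultimately have "poly \<gamma> x = 0" by (simp add: eliminant_def a \<gamma>)
      with H a show False by auto
    qed
    have "finite (diag_pairs \<sigma> u v) \<and> card (diag_pairs \<sigma> u v) = card ?R"
    proof (rule card_diag_pairs[OF \<sigma>])
      fix x assume x: "x \<in> ?R"
      show "eliminant \<sigma> u v (?p x) = 0 \<and> alpha \<sigma> u (?p x) \<noteq> 0 \<and>
        (dform (\<lambda>k. 1 / \<sigma> k) (?p x) (?p x) \<noteq> 0 \<or> det3 v (dinv \<sigma> (?p x)) (?D (?p x)) \<noteq> 0)"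
        using x alpha[OF x] H by (auto simp: poly_eliminant_poly \<gamma>')
    qed (use H poly_roots_finite[OF E0] in \<open>auto simp: poly_eliminant_poly\<close>)
    then show "finite (diag_pairs \<sigma> u v) \<and> card (diag_pairs \<sigma> u v) = 8"
      using H card_simple_roots[of ?E] E0 by simp
  qed
qed

section \<open>Two singular values\<close>

text \<open>For \<sigma>2 = \<sigma>3 one has D^2 z = \<sigma>2^2 z + (\<sigma>1^2 - \<sigma>2^2) z1
  e1, so \<open>alpha\<close> is divisible by z1; on the conic z^T D^3 z = (\<sigma>1^2 -
  \<sigma>2^2) \<sigma>1 z1^2. This is the cofactor of (\<sigma>1^2 - \<sigma>2^2) z1 in the
  eliminant.\<close>

definition cubic :: "(3 \<Rightarrow> 'a::comm_ring_1) \<Rightarrow> 'a ^ 3 \<Rightarrow> 'a ^ 3 \<Rightarrow> 'a ^ 3 \<Rightarrow> 'a" where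
  "cubic \<sigma> u v z = (det3 u z (vector [1, 0, 0]))\<^sup>2 * (((\<sigma> 1)\<^sup>2 - (\<sigma> 2)\<^sup>2) * z $ 1 * dform \<sigma> v v) -
     2 * det3 u z (vector [1, 0, 0]) * beta \<sigma> u v z * dform \<sigma> v (diag_mult \<sigma> z) +
     (beta \<sigma> u v z)\<^sup>2 * (\<sigma> 1 * z $ 1)"

definition cubic_poly :: "(3 \<Rightarrow> complex) \<Rightarrow> complex ^ 3 \<Rightarrow> complex ^ 3 \<Rightarrow> complex poly" where
  "cubic_poly \<sigma> u v = cubic (\<lambda>k. [:\<sigma> k:]) (const_vec u) (const_vec v) (conic_poly \<sigma>)"

lemma poly_eval_e1: "poly_eval x (vector [1, 0, 0] :: complex poly ^ 3) = vector [1, 0, 0]"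
  by (simp add: vec_eq_iff forall_3)

lemma poly_cubic_poly: "poly (cubic_poly \<sigma> u v) x = cubic \<sigma> u v (conic_point \<sigma> x)"
proof -
  have z1: "poly (conic_poly \<sigma> $ 1) x = conic_point \<sigma> x $ 1"
    by (simp flip: poly_eval_conic_poly)
  have c: "poly [:c:] x = c" for c :: complex by simp
  show ?thesis
    by (simp only: cubic_poly_def cubic_def beta_def poly_add poly_diff poly_mult poly_power poly_numeral
        poly_det3 poly_dform poly_diag_mult poly_eval_conic_poly poly_eval_const_vec poly_eval_e1 z1 c)
qed

lemma degree_cubic_poly: "degree (cubic_poly \<sigma> u v) \<le> 6"
proof -
  have e1: "degree ((vector [1, 0, 0] :: complex poly ^ 3) $ k) \<le> 0" for k
    using exhaust_3[of k] by auto
  have d: "degree (det3 (const_vec u) (conic_poly \<sigma>) (vector [1, 0, 0])) \<le> 2"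
    by (rule order_trans[OF degree_det3[OF degree_const_vec degree_conic_poly e1]]) simp
  have v: "degree (dform (\<lambda>k. [:\<sigma> k:]) (const_vec v) (const_vec v)) \<le> 0"
    by (rule order_trans[OF degree_dform[OF degree_const_vec degree_const_vec]]) simp
  have vz: "degree (dform (\<lambda>k. [:\<sigma> k:]) (const_vec v) (diag_mult (\<lambda>k. [:\<sigma> k:]) (conic_poly \<sigma>))) \<le> 2"
    by (rule order_trans[OF degree_dform[OF degree_const_vec degree_diag_mult[OF degree_conic_poly]]]) simp
  have c: "degree ([:c:] * conic_poly \<sigma> $ 1) \<le> 2" for c
    using degree_smult_le[of c "conic_poly \<sigma> $ 1"] degree_conic_poly[of \<sigma> 1] by simp
  have k: "[:a:]\<^sup>2 - [:b:]\<^sup>2 = [:a\<^sup>2 - b\<^sup>2:]" for a b :: complex by (simp add: power2_eq_square)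
  have a: "degree (([:a:]\<^sup>2 - [:b:]\<^sup>2) * conic_poly \<sigma> $ 1 * dform (\<lambda>k. [:\<sigma> k:]) (const_vec v) (const_vec v)) \<le> 2" for a b
    unfolding k by (rule order_trans[OF degree_mult_le'[OF c v]]) simp
  have two: "degree (2 * p) \<le> n" if "degree p \<le> n" for p :: "complex poly" and n
    using degree_mult_le'[OF _ that, of 2 0] by simp
  show ?thesis
    unfolding cubic_poly_def cubic_def power2_eq_square[of "det3 _ _ _"] power2_eq_square[of "beta _ _ _ _"]
    by (intro degree_add_le degree_diff_le degree_mult3_le[OF d d a] degree_mult3_le[OF two[OF d] degree_alpha_beta(2) vz]
        degree_mult3_le[OF degree_alpha_beta(2) degree_alpha_beta(2) c]) simp_all
qed

lemma poly_family_cubic: "poly_family (\<lambda>u v. cubic_poly \<sigma> u v)"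
  unfolding cubic_poly_def cubic_def beta_def det3_def dform_def sum_3
    diag_mult_nth const_vec_def vec_lambda_beta
  by (intro poly_family_intros poly_fun2_intros)

lemma poly_fun2_cubic: "poly_fun2 (\<lambda>u v. cubic \<sigma> u v z)"
  unfolding cubic_def beta_def det3_def dform_def sum_3 diag_mult_nth
  by (intro poly_fun2_intros)

lemma alpha_two_equal:
  fixes z :: "complex ^ 3"
  assumes "\<sigma> 3 = \<sigma> 2"
  shows "alpha \<sigma> u z = ((\<sigma> 1)\<^sup>2 - (\<sigma> 2)\<^sup>2) * z $ 1 * det3 u z (vector [1, 0, 0])"
  using assms by (simp add: alpha_def det3_def algebra_simps power2_eq_square)

lemma eliminant_two_equal:
  fixes z :: "complex ^ 3"
  assumes eq: "\<sigma> 3 = \<sigma> 2" and z: "dform \<sigma> z z = 0"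
  shows "eliminant \<sigma> u v z = ((\<sigma> 1)\<^sup>2 - (\<sigma> 2)\<^sup>2) * z $ 1 * cubic \<sigma> u v z"
proof -
  have "\<sigma> 2 * (z $ 2 * z $ 2) + \<sigma> 2 * (z $ 3 * z $ 3) = - (\<sigma> 1 * (z $ 1 * z $ 1))"
    using z eq by (simp add: dform_def sum_3 eq_neg_iff_add_eq_0 algebra_simps)
  then have c: "(\<sigma> 2)\<^sup>2 * (\<sigma> 2 * (z $ 2 * z $ 2) + \<sigma> 2 * (z $ 3 * z $ 3)) = (\<sigma> 2)\<^sup>2 * - (\<sigma> 1 * (z $ 1 * z $ 1))"
    by simp
  have "dform \<sigma> z (diag_mult \<sigma> (diag_mult \<sigma> z)) = (\<sigma> 1)\<^sup>2 * (\<sigma> 1 * (z $ 1 * z $ 1)) +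
      (\<sigma> 2)\<^sup>2 * (\<sigma> 2 * (z $ 2 * z $ 2) + \<sigma> 2 * (z $ 3 * z $ 3))"
    using eq by (simp add: dform_def sum_3 algebra_simps power2_eq_square)
  also have "\<dots> = ((\<sigma> 1)\<^sup>2 - (\<sigma> 2)\<^sup>2) * \<sigma> 1 * (z $ 1)\<^sup>2"
    unfolding c by (simp add: algebra_simps power2_eq_square)
  finally have g: "dform \<sigma> z (diag_mult \<sigma> (diag_mult \<sigma> z)) = ((\<sigma> 1)\<^sup>2 - (\<sigma> 2)\<^sup>2) * \<sigma> 1 * (z $ 1)\<^sup>2" .
  define k where "k = (\<sigma> 1)\<^sup>2 - (\<sigma> 2)\<^sup>2"
  show ?thesis
    unfolding eliminant_def cubic_def g alpha_two_equal[OF eq] k_def[symmetric]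
    by (simp add: algebra_simps power2_eq_square)
qed

text \<open>On the line z1 = 0, that is for x = 1 and x = -1, \<open>alpha\<close> vanishes while
  \<open>beta\<close> generically does not, so no multiplier exists. Asking that the cubic be
  nonzero there keeps its six roots off that line; simple roots then exclude the other factor of
  \<open>alpha\<close> as well.\<close>

lemma generic_card_diag_pairs_2:
  fixes \<sigma> :: "3 \<Rightarrow> complex"
  assumes \<sigma>: "\<And>k. \<sigma> k \<noteq> 0" and ne: "(\<sigma> 1)\<^sup>2 \<noteq> (\<sigma> 2)\<^sup>2" and eq: "\<sigma> 3 = \<sigma> 2"
  shows "generic (\<lambda>u v. finite (diag_pairs \<sigma> u v) \<and> card (diag_pairs \<sigma> u v) = 6)"
proof -
  let ?p = "conic_point \<sigma>"
  have s0: "csqrt (\<sigma> k) \<noteq> 0" for k using \<sigma> by simp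
  have conic: "dform \<sigma> (?p x) (?p x) = 0" for x by (rule dform_conic_point(1)[OF \<sigma>])
  have p1: "?p x $ 1 = 0 \<longleftrightarrow> x\<^sup>2 = 1" for x using s0[of 1] by (simp add: conic_point_nth)
  have pne: "?p x $ 2 \<noteq> 0" "?p x $ 3 \<noteq> 0" if "x\<^sup>2 = 1" for x
    using that s0 by (auto simp: conic_point_nth)
  \<comment> \<open>Only the middle term of the cubic survives on the line z1 = 0, and for this
    \<open>v\<close> it is a product whose factors are nonzero for suitable
    \<open>u\<close>.\<close>
  have cubic_special: "cubic \<sigma> u (vector [0, 0, 1]) (?p x) =
      - 2 * (u $ 2 * ?p x $ 3 - u $ 3 * ?p x $ 2) * (\<sigma> 3 * u $ 1 * ?p x $ 2) * ((\<sigma> 3)\<^sup>2 * ?p x $ 3)"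
    if "x\<^sup>2 = 1" for x u
  proof -
    have z: "?p x $ 1 = 0" using p1 that by blast
    show ?thesis unfolding cubic_def beta_def det3_def dform_def sum_3
      by (simp add: z algebra_simps power2_eq_square)
  qed
  have simple: "generic (\<lambda>u v. degree (cubic_poly \<sigma> u v) = 6 \<and> simple_roots (cubic_poly \<sigma> u v))"
  proof -
    obtain \<epsilon> S where S: "\<epsilon> \<noteq> 0" "finite S" "card S \<ge> 6"
      "\<And>x. x \<in> S \<Longrightarrow> x\<^sup>2 \<noteq> 1 \<and> eliminant \<sigma> (vector [1, \<epsilon>, 0]) (vector [0, 0, 1]) (?p x) = 0"
      using eliminant_special_roots[OF \<sigma> ne, of 3] ne eq by auto
    let ?E = "cubic_poly \<sigma> (vector [1, \<epsilon>, 0]) (vector [0, 0, 1])"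
    have "poly ?E 1 \<noteq> 0"
      using S(1) \<sigma> pne[of 1] by (simp add: poly_cubic_poly cubic_special)
    then have E0: "?E \<noteq> 0" by auto
    have "poly ?E x = 0" if "x \<in> S" for x
      using S(4)[OF that] eliminant_two_equal[where \<sigma> = \<sigma>, OF eq conic[of x]] ne p1[of x] by (auto simp: poly_cubic_poly)
    then have "card S \<le> card {x. poly ?E x = 0}"
      by (intro card_mono poly_roots_finite[OF E0]) auto
    with S(3) have "6 \<le> card {x. poly ?E x = 0}" by simp
    from generic_simple_roots[OF poly_family_cubic degree_cubic_poly _ card_sylvester_index(2) E0 this]
    show ?thesis by simp
  qed
  have g1: "generic (\<lambda>u v. \<forall>x\<in>{1, - 1}. cubic \<sigma> u v (?p x) \<noteq> 0)"
  proof (rule generic_ball)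
    fix x :: complex assume "x \<in> {1, - 1}"
    then have x: "x\<^sup>2 = 1" by auto
    have "cubic \<sigma> (vector [1, 0, 1]) (vector [0, 0, 1]) (?p x) \<noteq> 0"
      unfolding cubic_special[OF x] using \<sigma> pne[OF x] by simp
    then show "generic (\<lambda>u v. cubic \<sigma> u v (?p x) \<noteq> 0)" by (rule genericI[OF poly_fun2_cubic])
  qed simp
  have "generic (\<lambda>u v. (degree (cubic_poly \<sigma> u v) = 6 \<and> simple_roots (cubic_poly \<sigma> u v)) \<and>
      eliminant \<sigma> u v (conic_infinity \<sigma>) \<noteq> 0 \<and> dform (\<lambda>k. 1 / \<sigma> k) u u \<noteq> 0 \<and> dform (\<lambda>k. 1 / \<sigma> k) v v \<noteq> 0 \<and>
      (\<forall>x\<in>{1, - 1}. cubic \<sigma> u v (?p x) \<noteq> 0))"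
    by (rule generic_conj[OF simple generic_conj[OF generic_eliminant_infinity[OF \<sigma> ne]
          generic_conj[OF generic_dform(1) generic_conj[OF generic_dform(2) g1]]]])
      (simp_all add: \<sigma>)
  then show ?thesis
  proof (rule generic_mono)
    fix u v
    assume H: "(degree (cubic_poly \<sigma> u v) = 6 \<and> simple_roots (cubic_poly \<sigma> u v)) \<and>
      eliminant \<sigma> u v (conic_infinity \<sigma>) \<noteq> 0 \<and> dform (\<lambda>k. 1 / \<sigma> k) u u \<noteq> 0 \<and> dform (\<lambda>k. 1 / \<sigma> k) v v \<noteq> 0 \<and>
      (\<forall>x\<in>{1, - 1}. cubic \<sigma> u v (?p x) \<noteq> 0)"
    let ?E = "cubic_poly \<sigma> u v"
    let ?R = "{x. poly ?E x = 0}"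
    have E0: "?E \<noteq> 0" using H by auto
    have elim: "eliminant \<sigma> u v (?p x) = ((\<sigma> 1)\<^sup>2 - (\<sigma> 2)\<^sup>2) * ?p x $ 1 * cubic \<sigma> u v (?p x)" for x
      by (rule eliminant_two_equal[where \<sigma> = \<sigma>, OF eq conic])
    have "finite (diag_pairs \<sigma> u v) \<and> card (diag_pairs \<sigma> u v) = card ?R"
    proof (rule card_diag_pairs[OF \<sigma>])
      fix x assume "x \<in> ?R"
      then have x: "cubic \<sigma> u v (?p x) = 0" by (simp add: poly_cubic_poly)
      then have "x \<noteq> 1" "x \<noteq> - 1" using H by auto
      then have z1: "?p x $ 1 \<noteq> 0" unfolding p1 by (simp add: power2_eq_1_iff)
      have "det3 u (?p x) (vector [1, 0, 0]) \<noteq> 0"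
      proof
        assume d: "det3 u (?p x) (vector [1, 0, 0]) = 0"
        then have b: "beta \<sigma> u v (?p x) = 0" using x z1 \<sigma> by (simp add: cubic_def)
        let ?A = "det3 (const_vec u) (conic_poly \<sigma>) (vector [1, 0, 0])"
        let ?B = "beta (\<lambda>k. [:\<sigma> k:]) (const_vec u) (const_vec v) (conic_poly \<sigma>)"
        have "poly ?A x = det3 u (?p x) (vector [1, 0, 0])" "poly ?B x = beta \<sigma> u v (?p x)"
          by (simp_all only: beta_def poly_det3 poly_diag_mult poly_eval_conic_poly poly_eval_const_vec poly_eval_e1)
        with d b have "\<not> simple_roots ?E"
          unfolding cubic_poly_def cubic_def by (intro alpha_beta_zero_not_simple) auto
        with H show False by simp
      qed
      then have "alpha \<sigma> u (?p x) \<noteq> 0"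
        unfolding alpha_two_equal[where \<sigma> = \<sigma>, OF eq] using z1 ne by simp
      moreover have "dform (\<lambda>k. 1 / \<sigma> k) (?p x) (?p x) \<noteq> 0"
      proof
        assume "dform (\<lambda>k. 1 / \<sigma> k) (?p x) (?p x) = 0"
        then have "?p x $ 1 * ?p x $ 1 / \<sigma> 1 + (?p x $ 2 * ?p x $ 2 + ?p x $ 3 * ?p x $ 3) / \<sigma> 2 = 0"
          by (simp add: dform_def sum_3 eq add_divide_distrib add.assoc)
        then have 1: "\<sigma> 2 * (?p x $ 1 * ?p x $ 1) + \<sigma> 1 * (?p x $ 2 * ?p x $ 2 + ?p x $ 3 * ?p x $ 3) = 0"
          using \<sigma>[of 1] \<sigma>[of 2] by (simp add: field_simps)
        have 2: "\<sigma> 1 * (?p x $ 1 * ?p x $ 1) + \<sigma> 2 * (?p x $ 2 * ?p x $ 2 + ?p x $ 3 * ?p x $ 3) = 0"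
          using conic[of x] by (simp add: dform_def sum_3 eq algebra_simps)
        \<comment> \<open>Eliminating z2^2 + z3^2 between the conic and its dual leaves a nonzero
          multiple of z1^2.\<close>
        have "\<sigma> 2 * (\<sigma> 2 * (?p x $ 1 * ?p x $ 1) + \<sigma> 1 * (?p x $ 2 * ?p x $ 2 + ?p x $ 3 * ?p x $ 3)) -
            \<sigma> 1 * (\<sigma> 1 * (?p x $ 1 * ?p x $ 1) + \<sigma> 2 * (?p x $ 2 * ?p x $ 2 + ?p x $ 3 * ?p x $ 3)) =
            ((\<sigma> 2)\<^sup>2 - (\<sigma> 1)\<^sup>2) * (?p x $ 1 * ?p x $ 1)"
          by (simp add: algebra_simps power2_eq_square)
        then show False using z1 ne unfolding 1 2 by simp
      qed
      ultimately show "eliminant \<sigma> u v (?p x) = 0 \<and> alpha \<sigma> u (?p x) \<noteq> 0 \<and>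
        (dform (\<lambda>k. 1 / \<sigma> k) (?p x) (?p x) \<noteq> 0 \<or>
         det3 v (dinv \<sigma> (?p x)) (diag_mult \<sigma> (?p x)) \<noteq> 0)"
        by (simp add: elim x)
    next
      fix x m
      assume e: "eliminant \<sigma> u v (?p x) = 0" and b: "beta \<sigma> u v (?p x) = m * alpha \<sigma> u (?p x)"
      \<comment> \<open>Where z1 is zero so is \<open>alpha\<close>; the multiplier equation then
        forces \<open>beta = 0\<close> and with it the vanishing of the cubic. Elsewhere the linear
        factor is cancelled.\<close>
      have "cubic \<sigma> u v (?p x) = 0"
      proof (cases "?p x $ 1 = 0")
        case True
        then have "beta \<sigma> u v (?p x) = 0" using b by (simp add: alpha_two_equal[where \<sigma> = \<sigma>, OF eq])
        with True show ?thesis by (simp add: cubic_def)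
      qed (use e ne in \<open>simp add: elim\<close>)
      then show "x \<in> ?R" by (simp add: poly_cubic_poly)
    qed (use H poly_roots_finite[OF E0] in auto)
    then show "finite (diag_pairs \<sigma> u v) \<and> card (diag_pairs \<sigma> u v) = 6"
      using H card_simple_roots[of ?E] E0 by simp
  qed
qed

section \<open>Conics\<close>

lemma takagi_form_exists:
  assumes sym: "transpose A = A"
  shows "\<exists>U \<sigma>. takagi_form A U \<sigma>"
proof (rule takagi[OF sym])
  fix U :: "complex ^ 3 ^ 3" and \<sigma> :: "3 \<Rightarrow> real"
  assume "\<And>k. \<sigma> k \<ge> 0" "conj_transpose U ** U = mat 1"
    "\<And>x y. bform A (U *v x) (U *v y) = (\<Sum>k\<in>UNIV. of_real (\<sigma> k) * x $ k * y $ k)"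
  then have "takagi_form A U \<sigma>" by unfold_locales (simp_all add: sym dform_def)
  then show ?thesis by blast
qed

text \<open>Reordering the Takagi basis reorders the singular values, so a distinguished one can be
  moved to a fixed position. Transpositions are enough for that, hence the restriction to
  involutions.\<close>

lemma takagi_form_permute:
  assumes "takagi_form A U \<sigma>" and \<pi>: "\<And>k. \<pi> (\<pi> k) = k"
  shows "takagi_form A (\<chi> i j. U $ i $ \<pi> j) (\<sigma> \<circ> \<pi>)"
proof -
  interpret takagi_form A U \<sigma> by fact
  let ?U = "(\<chi> i j. U $ i $ \<pi> j) :: complex ^ 3 ^ 3"
  have bij: "bij_betw \<pi> UNIV UNIV" by (rule bij_betw_byWitness[of _ \<pi>]) (auto simp: \<pi>)
  have U: "?U *v x = U *v (\<chi> k. x $ \<pi> k)" for x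
  proof (subst vec_eq_iff, intro allI)
    fix i
    have "(?U *v x) $ i = (\<Sum>j\<in>UNIV. U $ i $ \<pi> j * x $ \<pi> (\<pi> j))"
      by (simp add: matrix_vector_mult_def \<pi>)
    also have "\<dots> = (\<Sum>j\<in>UNIV. U $ i $ j * x $ \<pi> j)" by (rule sum.reindex_bij_betw[OF bij])
    finally show "(?U *v x) $ i = (U *v (\<chi> k. x $ \<pi> k)) $ i" by (simp add: matrix_vector_mult_def)
  qed
  have UU: "(conj_transpose U ** U) $ i $ j = (if i = j then 1 else 0)" for i j
    by (simp add: unitary mat_def)
  show ?thesis
  proof
    show "transpose A = A" by (rule sym)
    show "(\<sigma> \<circ> \<pi>) k \<ge> 0" for k by (simp add: \<sigma>_nonneg)
    have "(conj_transpose ?U ** ?U) $ i $ j = (conj_transpose U ** U) $ \<pi> i $ \<pi> j" for i j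
      by (simp add: conj_transpose_def transpose_def matrix_matrix_mult_def map_matrix_def)
    then show "conj_transpose ?U ** ?U = mat 1" unfolding UU by (simp add: vec_eq_iff mat_def) (metis \<pi>)
    fix x y
    have "bform A (?U *v x) (?U *v y) = (\<Sum>k\<in>UNIV. cs k * x $ \<pi> k * y $ \<pi> k)"
      unfolding U diag by (simp add: dform_def)
    also have "\<dots> = (\<Sum>k\<in>UNIV. cs (\<pi> (\<pi> k)) * x $ \<pi> k * y $ \<pi> k)" by (simp add: \<pi>)
    also have "\<dots> = (\<Sum>k\<in>UNIV. cs (\<pi> k) * x $ k * y $ k)"
      by (rule sum.reindex_bij_betw[OF bij, of "\<lambda>k. cs (\<pi> k) * x $ k * y $ k"])
    finally show "bform A (?U *v x) (?U *v y) = dform (\<lambda>k. of_real ((\<sigma> \<circ> \<pi>) k)) x y"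
      by (simp add: dform_def)
  qed
qed

lemma takagi_form_swap:
  assumes "takagi_form A U \<sigma>"
  shows "takagi_form A (\<chi> i j. U $ i $ Transposition.transpose a b j) (\<sigma> \<circ> Transposition.transpose a b)"
  using assms by (rule takagi_form_permute) simp

context takagi_form
begin

lemma cs_square_neq: "\<sigma> i \<noteq> \<sigma> j \<Longrightarrow> (cs i)\<^sup>2 \<noteq> (cs j)\<^sup>2"
  using \<sigma>_nonneg[of i] \<sigma>_nonneg[of j] power2_eq_iff_nonneg[of "\<sigma> i" "\<sigma> j"]
  by (simp flip: of_real_power)

lemma vHDdeg_conic_3:
  assumes "\<And>k. \<sigma> k \<noteq> 0" "\<sigma> 1 \<noteq> \<sigma> 2" "\<sigma> 1 \<noteq> \<sigma> 3" "\<sigma> 2 \<noteq> \<sigma> 3"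
  shows "vHDdeg {z. qform A z = 0} = 8"
  by (intro vHDdeg_conic generic_card_diag_pairs_3 cs_square_neq assms) (simp add: assms)

lemma vHDdeg_conic_2:
  assumes "\<And>k. \<sigma> k \<noteq> 0" "\<sigma> 1 \<noteq> \<sigma> 2" "\<sigma> 3 = \<sigma> 2"
  shows "vHDdeg {z. qform A z = 0} = 6"
  by (intro vHDdeg_conic generic_card_diag_pairs_2 cs_square_neq assms) (simp_all add: assms)

section \<open>Singular conics: double lines and pairs of lines\<close>

definition line :: "complex ^ 3 \<Rightarrow> complex ^ 3" where
  "line c = cvec (U *v cvec c)"

lemma line_eq_0_iff [simp]: "line c = 0 \<longleftrightarrow> c = 0"
  by (simp add: line_def)

text \<open>\<open>line\<close> carries a covector from Takagi coordinates to the original ones: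
  composing with the inverse of \<open>U\<close>, its conjugate transpose, multiplies the
  coefficients by the conjugate of \<open>U\<close>.\<close>

lemma in_hyperplane_line: "U *v x \<in> hyperplane (line c) \<longleftrightarrow> cdot c x = 0"
proof -
  have "(\<Sum>j\<in>UNIV. line c $ j * z $ j) = cdot c (conj_transpose U *v z)" for z
  proof -
    have "(\<Sum>j\<in>UNIV. line c $ j * z $ j) = (\<Sum>j\<in>UNIV. \<Sum>i\<in>UNIV. cnj (U $ j $ i) * c $ i * z $ j)"
      by (simp add: line_def matrix_vector_mult_def sum_distrib_right)
    also have "\<dots> = (\<Sum>i\<in>UNIV. \<Sum>j\<in>UNIV. cnj (U $ j $ i) * c $ i * z $ j)" by (rule sum.swap)
    also have "\<dots> = cdot c (conj_transpose U *v z)"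
      by (simp add: cdot_def conj_transpose_def transpose_def map_matrix_def matrix_vector_mult_def
          sum_distrib_left mult_ac)
    finally show ?thesis .
  qed
  then show ?thesis by (simp add: hyperplane_def)
qed

lemma set_eq_via_U: "(\<And>x. U *v x \<in> S \<longleftrightarrow> U *v x \<in> T) \<Longrightarrow> S = T"
  by (metis U_UH subset_antisym subsetI)

lemma A_entry: "A $ m $ n = cvec (U *v cvec (diag_mult cs (conj_transpose U *v axis n 1))) $ m"
proof -
  have "A *v axis n 1 = cvec (U *v cvec (diag_mult cs (conj_transpose U *v axis n 1)))"
    using A_U[of "conj_transpose U *v axis n 1"] by simp
  moreover have "(A *v axis n 1) $ m = A $ m $ n"
    by (simp add: matrix_vector_mult_def axis_def if_distrib[of "\<lambda>x. _ * x"] cong: if_cong)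
  ultimately show ?thesis by simp
qed

text \<open>The form is a multiple of the square of one coordinate, and the rows of \<open>A\<close>
  are multiples of the vector \<open>g\<close>. The rank bound is used to exclude rank two in the
  final case distinction.\<close>

lemma double_line:
  assumes "\<sigma> 1 \<noteq> 0" "\<sigma> 2 = 0" "\<sigma> 3 = 0"
  shows "\<exists>a. a \<noteq> 0 \<and> {z. qform A z = 0} = hyperplane a" and "rank A \<le> 1"
proof -
  have "{z. qform A z = 0} = hyperplane (line (vector [1, 0, 0]))"
    by (rule set_eq_via_U) (use assms in \<open>simp add: in_hyperplane_line qform_U dform_def cdot_def sum_3\<close>)
  moreover have "vector [1, 0, 0] \<noteq> (0 :: complex ^ 3)" by (simp add: vec_eq_iff forall_3)
  ultimately show "\<exists>a. a \<noteq> 0 \<and> {z. qform A z = 0} = hyperplane a"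
    by (metis line_eq_0_iff)
  define g where "g = (\<chi> n. cs 1 * (conj_transpose U *v axis n 1) $ 1)"
  have "A $ m = cnj (U $ m $ 1) *s g" for m
    by (subst vec_eq_iff) (simp add: A_entry g_def matrix_vector_mult_def[of U] sum_3 assms)
  moreover have "rows A = range (\<lambda>m. A $ m)"
    by (auto simp: rows_def row_def vec_lambda_eta)
  ultimately have "rows A \<subseteq> vec.span {g}"
    by (simp only: image_subset_iff) (intro ballI vec.span_scale vec.span_base singletonI)
  then have "vec.dim (rows A) \<le> card {g}" by (intro vec.dim_le_card) auto
  then show "rank A \<le> 1" by (simp add: row_rank_def_gen)
qed

text \<open>A sum of two complex squares splits into linear factors. The claim on the rank separates
  this case from a double line.\<close>

lemma two_lines:
  assumes \<sigma>: "\<sigma> 1 \<noteq> 0" "\<sigma> 2 \<noteq> 0" "\<sigma> 3 = 0"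
  shows "\<exists>a b. a \<noteq> 0 \<and> b \<noteq> 0 \<and> \<not> hyperplane a \<subseteq> hyperplane b \<and> \<not> hyperplane b \<subseteq> hyperplane a \<and>
      {z. qform A z = 0} = hyperplane a \<union> hyperplane b"
    and "rank A \<noteq> 1"
proof -
  define r s where "r = csqrt (cs 1)" and "s = csqrt (cs 2)"
  have rs: "r * r = cs 1" "s * s = cs 2" "r \<noteq> 0" "s \<noteq> 0"
    using \<sigma> power2_csqrt[of "cs 1"] power2_csqrt[of "cs 2"] by (simp_all add: r_def s_def power2_eq_square)
  define c d :: "complex ^ 3" where "c = vector [r, \<i> * s, 0]" and "d = vector [r, - \<i> * s, 0]"
  have cd: "cdot c x = r * x $ 1 + \<i> * s * x $ 2" "cdot d x = r * x $ 1 - \<i> * s * x $ 2" for x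
    by (simp_all add: c_def d_def cdot_def sum_3)
  have nz: "c \<noteq> 0" "d \<noteq> 0" using rs by (simp_all add: vec_eq_iff forall_3 c_def d_def)
  have "dform cs x x = cdot c x * cdot d x" for x
  proof -
    have "cdot c x * cdot d x = (r * r) * x $ 1 * x $ 1 + (s * s) * x $ 2 * x $ 2"
      by (simp add: cd algebra_simps)
    then show ?thesis unfolding rs using \<sigma>(3) by (simp add: dform_def sum_3)
  qed
  then have "{z. qform A z = 0} = hyperplane (line c) \<union> hyperplane (line d)"
    by (intro set_eq_via_U) (simp add: in_hyperplane_line qform_U)
  moreover have "U *v vector [\<i> * s, - r, 0] \<in> hyperplane (line c) - hyperplane (line d)"
    using rs by (simp add: in_hyperplane_line cd algebra_simps)
  moreover have "U *v vector [\<i> * s, r, 0] \<in> hyperplane (line d) - hyperplane (line c)"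
    using rs by (simp add: in_hyperplane_line cd algebra_simps)
  ultimately show "\<exists>a b. a \<noteq> 0 \<and> b \<noteq> 0 \<and> \<not> hyperplane a \<subseteq> hyperplane b \<and> \<not> hyperplane b \<subseteq> hyperplane a \<and>
      {z. qform A z = 0} = hyperplane a \<union> hyperplane b"
    using nz by (intro exI[of _ "line c"] exI[of _ "line d"]) auto
  show "rank A \<noteq> 1"
  proof
    assume "rank A = 1"
    then have dim: "vec.dim (rows A) = 1" by (simp add: row_rank_def_gen)
    obtain B where B: "B \<subseteq> rows A" "vec.independent B" "rows A \<subseteq> vec.span B" "card B = vec.dim (rows A)"
      using vec.basis_exists by blast
    then obtain g where g: "B = {g}" using dim by (metis card_1_singletonE)
    have "\<exists>k. A $ m = k *s g" for m
    proof -
      have "A $ m \<in> rows A" by (auto simp: rows_def row_def vec_lambda_eta)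
      then show ?thesis using B(3) by (auto simp: g vec.span_singleton)
    qed
    then obtain k where k: "\<And>m. A $ m = k m *s g" by metis
    \<comment> \<open>If all rows were multiples of one vector, the bilinear form would be a product
      of linear forms and its minor on the first two basis vectors zero; but that minor is
      \<open>cs 1 * cs 2\<close>.\<close>
    have bf: "bform A x y = (\<Sum>m\<in>UNIV. x $ m * k m) * (\<Sum>n\<in>UNIV. g $ n * y $ n)" for x y
      by (simp add: bform_def matrix_vector_mult_def k mult.assoc sum_distrib_right flip: sum_distrib_left)
    have "bform A (U *v axis 1 1) (U *v axis 1 1) * bform A (U *v axis 2 1) (U *v axis 2 1) =
        bform A (U *v axis 1 1) (U *v axis 2 1) * bform A (U *v axis 2 1) (U *v axis 1 1)"
      unfolding bf by (simp add: mult_ac)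
    then have "cs 1 * cs 2 = 0" unfolding diag by (simp add: dform_def sum_3 axis_def)
    with \<sigma> show False by simp
  qed
qed

end

lemma affine_cone_proj_quadric: "affine_cone (proj_quadric A) = {z. qform A z = 0}"
proof (intro equalityI subsetI)
  fix z assume "z \<in> affine_cone (proj_quadric A)"
  then consider "z = 0" | p c where "qform A p = 0" "z = c *s p"
    by (auto simp: affine_cone_def proj_quadric_def proj_point_def qform_def)
  then show "z \<in> {z. qform A z = 0}"
    by cases (auto simp: qform_scale, simp add: qform_def)
next
  fix z assume z: "z \<in> {z. qform A z = 0}"
  show "z \<in> affine_cone (proj_quadric A)"
  proof (cases "z = 0")
    case False
    have "z \<in> proj_point z" unfolding proj_point_def by (intro image_eqI[of _ _ 1]) auto
    moreover have "proj_point z \<in> proj_quadric A"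
      using z False unfolding proj_quadric_def qform_def by blast
    ultimately show ?thesis by (auto simp: affine_cone_def)
  qed (simp add: affine_cone_def)
qed

lemma ex_3: "(\<exists>k::3. P k) \<longleftrightarrow> P 1 \<or> P 2 \<or> P 3"
  by (metis exhaust_3)

lemma range_3: "range f = {f 1, f 2, f (3::3)}"
  by (auto simp: UNIV_3)

theorem theorem3p18:
  fixes A :: "complex ^ 3 ^ 3" and X :: "(complex ^ 3) set set"
  assumes "transpose A = A" and "A \<noteq> 0" and "X = proj_quadric A"
  shows "(det A = 0 \<longrightarrow>
            (rank A = 1 \<longrightarrow> proj_vHDdeg X = 1 \<and> proj_HDdeg X = {1}) \<and>
            (rank A = 2 \<longrightarrow> proj_vHDdeg X = 2 \<and> proj_HDdeg X = {2})) \<and>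
         (det A \<noteq> 0 \<longrightarrow>
            (card (singular_values A) = 1 \<longrightarrow> proj_vHDdeg X = 2 \<and> proj_HDdeg X = {2}) \<and>
            (card (singular_values A) = 2 \<longrightarrow> proj_vHDdeg X = 6) \<and>
            (card (singular_values A) = 3 \<longrightarrow> proj_vHDdeg X = 8))"
proof -
  obtain U \<sigma> where form: "takagi_form A U \<sigma>" using takagi_form_exists[OF assms(1)] by blast
  interpret takagi_form A U \<sigma> by (rule form)
  have deg: "proj_vHDdeg X = vHDdeg {z. qform A z = 0}" "proj_HDdeg X = HDdeg {z. qform A z = 0}"
    by (simp_all add: proj_vHDdeg_def proj_HDdeg_def assms(3) affine_cone_proj_quadric)
  have not_all_zero: "\<exists>k. \<sigma> k \<noteq> 0"
  proof (rule ccontr)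
    assume "\<nexists>k. \<sigma> k \<noteq> 0"
    then have "A $ m $ n = 0" for m n by (simp add: A_entry matrix_vector_mult_def[of U])
    with assms(2) show False by (simp add: vec_eq_iff)
  qed
  have singular: "(rank A = 1 \<longrightarrow> proj_vHDdeg X = 1 \<and> proj_HDdeg X = {1}) \<and>
      (rank A = 2 \<longrightarrow> proj_vHDdeg X = 2 \<and> proj_HDdeg X = {2})" if det: "det A = 0"
  proof -
    obtain j where j: "\<sigma> j = 0" using det det_nonzero_iff by blast
    \<comment> \<open>Among three values at least one is zero and not all are, so exactly one is
      nonzero or exactly one is zero.\<close>
    consider i where "\<sigma> i \<noteq> 0" "\<forall>k. k \<noteq> i \<longrightarrow> \<sigma> k = 0" | "\<forall>k. k \<noteq> j \<longrightarrow> \<sigma> k \<noteq> 0"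
      using not_all_zero j exhaust_3[of j] by (simp add: ex_3 forall_3) (metis distinct_3)
    then show ?thesis
    proof cases
      case 1
      let ?\<pi> = "Transposition.transpose 1 i"
      interpret P: takagi_form A "\<chi> i' j. U $ i' $ ?\<pi> j" "\<sigma> \<circ> ?\<pi>" by (rule takagi_form_swap[OF form])
      have "?\<pi> k \<noteq> i" if "k \<noteq> 1" for k using that by (auto simp: Transposition.transpose_def split: if_splits)
      then have *: "(\<sigma> \<circ> ?\<pi>) 1 \<noteq> 0" "(\<sigma> \<circ> ?\<pi>) 2 = 0" "(\<sigma> \<circ> ?\<pi>) 3 = 0" using 1 by auto
      obtain a where "a \<noteq> 0" "{z. qform A z = 0} = hyperplane a" using P.double_line(1)[OF *] by blast
      then show ?thesis using degrees_hyperplane[of a] P.double_line(2)[OF *] by (simp add: deg)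
    next
      case 2
      let ?\<pi> = "Transposition.transpose 3 j"
      interpret P: takagi_form A "\<chi> i' j'. U $ i' $ ?\<pi> j'" "\<sigma> \<circ> ?\<pi>" by (rule takagi_form_swap[OF form])
      have "?\<pi> k \<noteq> j" if "k \<noteq> 3" for k using that by (auto simp: Transposition.transpose_def split: if_splits)
      then have *: "(\<sigma> \<circ> ?\<pi>) 1 \<noteq> 0" "(\<sigma> \<circ> ?\<pi>) 2 \<noteq> 0" "(\<sigma> \<circ> ?\<pi>) 3 = 0" using 2 j by auto
      obtain a b where "a \<noteq> 0" "b \<noteq> 0" "\<not> hyperplane a \<subseteq> hyperplane b" "\<not> hyperplane b \<subseteq> hyperplane a"
        "{z. qform A z = 0} = hyperplane a \<union> hyperplane b" using P.two_lines(1)[OF *] by blast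
      then show ?thesis using degrees_hyperplane_Un[of a b] P.two_lines(2)[OF *] by (simp add: deg)
    qed
  qed
  have regular: "(card (singular_values A) = 1 \<longrightarrow> proj_vHDdeg X = 2 \<and> proj_HDdeg X = {2}) \<and>
      (card (singular_values A) = 2 \<longrightarrow> proj_vHDdeg X = 6) \<and>
      (card (singular_values A) = 3 \<longrightarrow> proj_vHDdeg X = 8)" if "det A \<noteq> 0"
  proof (intro conjI impI)
    have nz: "\<sigma> k \<noteq> 0" for k using that det_nonzero_iff by blast
    have sv: "singular_values A = {\<sigma> 1, \<sigma> 2, \<sigma> 3}" by (simp add: singular_values_eq range_3)
    {
      assume "card (singular_values A) = 1"
      then obtain s where s: "range \<sigma> = {s}" unfolding singular_values_eq by (metis card_1_singletonE)
      then have "\<sigma> k = s" for k by (metis rangeI singletonD)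
      with nz[of 1] show "proj_vHDdeg X = 2" "proj_HDdeg X = {2}"
        using degrees_conic_scalar[of s] by (auto simp: deg)
    next
      assume c: "card (singular_values A) = 2"
      \<comment> \<open>With exactly two distinct values, one index stands alone and the other two
        agree; a transposition moves it to position 1.\<close>
      have "\<exists>i. (\<forall>k. k \<noteq> i \<longrightarrow> \<sigma> k \<noteq> \<sigma> i) \<and> (\<forall>k l. k \<noteq> i \<longrightarrow> l \<noteq> i \<longrightarrow> \<sigma> k = \<sigma> l)"
        using c unfolding sv ex_3 forall_3
        by (cases "\<sigma> 1 = \<sigma> 2"; cases "\<sigma> 1 = \<sigma> 3"; cases "\<sigma> 2 = \<sigma> 3") auto
      then obtain i where i: "\<And>k. k \<noteq> i \<Longrightarrow> \<sigma> k \<noteq> \<sigma> i" "\<And>k l. k \<noteq> i \<Longrightarrow> l \<noteq> i \<Longrightarrow> \<sigma> k = \<sigma> l" by blast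
      let ?\<pi> = "Transposition.transpose 1 i"
      interpret P: takagi_form A "\<chi> i' j. U $ i' $ ?\<pi> j" "\<sigma> \<circ> ?\<pi>" by (rule takagi_form_swap[OF form])
      have \<pi>: "?\<pi> k \<noteq> i" if "k \<noteq> 1" for k using that by (auto simp: Transposition.transpose_def split: if_splits)
      have "(\<sigma> \<circ> ?\<pi>) 1 \<noteq> (\<sigma> \<circ> ?\<pi>) 2" using i(1)[OF \<pi>[of 2]] by auto
      moreover have "(\<sigma> \<circ> ?\<pi>) 3 = (\<sigma> \<circ> ?\<pi>) 2" using i(2)[OF \<pi>[of 3] \<pi>[of 2]] by simp
      ultimately show "proj_vHDdeg X = 6" using P.vHDdeg_conic_2 nz by (simp add: deg)
    next
      assume "card (singular_values A) = 3"
      then have "\<sigma> 1 \<noteq> \<sigma> 2" "\<sigma> 1 \<noteq> \<sigma> 3" "\<sigma> 2 \<noteq> \<sigma> 3" unfolding sv by (auto simp: card_insert_if split: if_splits)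
      then show "proj_vHDdeg X = 8" using vHDdeg_conic_3[OF nz] by (simp add: deg)
    }
  qed
  show ?thesis using singular regular by blast
qed

end
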